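(* There is a constant $\gamma_0>0$, depending only on the coefficients $r,q,\kappa,\theta,\rho,\sigma$ of $A$, such that for $\gamma\in(0,\gamma_0)$ the following holds. Let $f\in L^2(\mathcal O,\mathfrak w)$ and let $\psi\in H^1(\mathcal O,\mathfrak w)$ with $\psi^+\in H^1_0(\mathcal O\cup\Gamma_0,\mathfrak w)$. Set $\mathbb K=\{v\in H^1_0(\mathcal O\cup\Gamma_0,\mathfrak w): v\ge\psi\ \text{a.e. on }\mathcal O\}$. Then there exists a unique $u\in\mathbb K$ such that $$a_\lambda(u,v-u)\ge(f,v-u)_{L^2(\mathcal O,\mathfrak w)}\qquad\forall v\in\mathbb K .$$
   Context: $\mathbb H=\mathbb R\times(0,\infty)$ with coordinates $(x,y)$. The constants satisfy $\sigma\ne0$, $-1<\rho<1$, $\kappa>0$, $\theta>0$, $r\ge0$, $q\ge0$, and (standing normalization) $b_1:=r-q-\kappa\theta\rho/\sigma=0$; they are the coefficients of the Heston operator $$Av=-\tfrac y2\left(v_{xx}+2\rho\sigma v_{xy}+\sigma^2v_{yy}\right)-\left(r-q-\tfrac y2\right)v_x-\kappa(\theta-y)v_y+rv .$$ Put $\beta=2\kappa\theta/\sigma^2$, $\mu=2\kappa/\sigma^2$, $a_1=\kappa\rho/\sigma-\tfrac12$ and $\mathfrak w(x,y)=y^{\beta-1}e^{-\gamma|x|-\mu y}$ on $\mathbb H$. $\mathcal O\subset\mathbb H$ is a possibly unbounded domain; $\Gamma_0$ is the interior (in $\{y=0\}$) of $\{y=0\}\cap\partial\mathcal O$, assumed non-empty.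 $L^2(\mathcal O,\mathfrak w)$ is the $L^2$ space for $\mathfrak w\,dx\,dy$; $H^1(\mathcal O,\mathfrak w)$ is the space with finite norm $\|u\|_{H^1(\mathcal O,\mathfrak w)}^2=\int_{\mathcal O}(y|Du|^2+(1+y)u^2)\mathfrak w\,dx\,dy$ (distributional derivatives); $H^1_0(\mathcal O\cup\Gamma_0,\mathfrak w)$ is the closure in $H^1(\mathcal O,\mathfrak w)$ of $C^\infty_0(\mathcal O\cup\Gamma_0)$ (smooth functions with compact support in $\mathcal O\cup\Gamma_0$). $w^+=\max\{w,0\}$. The Heston bilinear form is $$a(u,v)=\tfrac12\int_{\mathcal O}\left(u_xv_x+\rho\sigma u_yv_x+\rho\sigma u_xv_y+\sigma^2u_yv_y\right)y\,\mathfrak w\,dx\,dy-\tfrac\gamma2\int_{\mathcal O}(u_x+\rho\sigma u_y)v\,\operatorname{sign}(x)\,y\,\mathfrak w\,dx\,dy$$ $$\qquad-\int_{\mathcal O}a_1y\,u_xv\,\mathfrak w\,dx\,dy+\int_{\mathcal O}ruv\,\mathfrak w\,dx\,dy,$$ and $a_\lambda(u,v)=a(u,v)+\lambda((1+y)u,v)_{L^2(\mathcal O,\mathfrak w)}$. Here $\lambda>0$ is a fixed constant depending only on the coefficients of $A$, chosen so large that $a_\lambda$ is continuous and coercive on $V=H^1_0(\mathcal O\cup\Gamma_0,\mathfrak w)$: $|a_\lambda(u,v)|\le C\|u\|_V\|v\|_V$ and $a_\lambda(v,v)\ge\nu_1\|v\|_V^2$ for all $u,v\in V$, with constants $C,\nu_1>0$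 depending only on the coefficients of $A$. *)

theory Defs
  imports "HOL-Analysis.Analysis"
begin

section \<open>Coefficients and weight\<close>

record heston =
  hr :: real
  hq :: real
  hkappa :: real
  htheta :: real
  hrho :: real
  hsigma :: real

definition heston_coeffs :: "heston \<Rightarrow> bool" where
  "heston_coeffs A \<longleftrightarrow>
     hsigma A \<noteq> 0 \<and> -1 < hrho A \<and> hrho A < 1 \<and> 0 < hkappa A \<and> 0 < htheta A \<and>
     0 \<le> hr A \<and> 0 \<le> hq A \<and>
     hr A - hq A - hkappa A * htheta A * hrho A / hsigma A = 0"

definition hbeta :: "heston \<Rightarrow> real" where
  "hbeta A = 2 * hkappa A * htheta A / (hsigma A)\<^sup>2"

definition hmu :: "heston \<Rightarrow> real" where
  "hmu A = 2 * hkappa A / (hsigma A)\<^sup>2"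

definition ha1 :: "heston \<Rightarrow> real" where
  "ha1 A = hkappa A * hrho A / hsigma A - 1/2"

definition hweight :: "heston \<Rightarrow> real \<Rightarrow> real \<times> real \<Rightarrow> real" where
  "hweight A \<gamma> = (\<lambda>(x, y). y powr (hbeta A - 1) * exp (- \<gamma> * \<bar>x\<bar> - hmu A * y))"

definition hmeasure :: "heston \<Rightarrow> real \<Rightarrow> (real \<times> real) set \<Rightarrow> (real \<times> real) measure" where
  "hmeasure A \<gamma> \<O> = density (lebesgue_on \<O>) (\<lambda>p. ennreal (hweight A \<gamma> p))"

section \<open>Domains in the upper half-plane\<close>

definition half_plane :: "(real \<times> real) set" where
  "half_plane = {p. 0 < snd p}"

definition half_plane_domain :: "(real \<times> real) set \<Rightarrow> bool" where
  "half_plane_domain \<O> \<longleftrightarrow> open \<O> \<and> connected \<O> \<and> \<O> \<noteq> {} \<and> \<O> \<subseteq> half_plane"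

definition Gamma0 :: "(real \<times> real) set \<Rightarrow> (real \<times> real) set" where
  "Gamma0 \<O> = top_of_set {p. snd p = 0} interior_of ({p. snd p = 0} \<inter> frontier \<O>)"

section \<open>Smooth functions and weak derivatives\<close>

text \<open>For \<open>U\<close> open and \<open>U \<subseteq> T \<subseteq> closure U\<close>: \<open>f\<close> is \<open>k\<close> times continuously differentiable
  on \<open>U\<close>, and \<open>f\<close> and all its partial derivatives of order at most \<open>k\<close> extend continuously
  to \<open>T\<close>. The values of \<open>fx\<close> and \<open>fy\<close> on \<open>T - U\<close> are those of the continuous extension.\<close>

primrec Ck_upto :: "nat \<Rightarrow> (real \<times> real) set \<Rightarrow> (real \<times> real) set \<Rightarrow> (real \<times> real \<Rightarrow> real) \<Rightarrow> bool"
where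
  "Ck_upto 0 U T f \<longleftrightarrow> continuous_on T f"
| "Ck_upto (Suc k) U T f \<longleftrightarrow> continuous_on T f \<and>
     (\<exists>fx fy. (\<forall>p\<in>U. (f has_derivative (\<lambda>h. fx p * fst h + fy p * snd h)) (at p)) \<and>
              Ck_upto k U T fx \<and> Ck_upto k U T fy)"

text \<open>Elements are regarded as extended by zero to the whole plane. The set \<open>T\<close> is \<open>U\<close>
  for the usual test functions on \<open>U\<close>, and \<open>U \<union> Gamma0 U\<close> for functions that need not
  vanish near \<open>Gamma0 U\<close>.\<close>

definition Cinf_cpt :: "(real \<times> real) set \<Rightarrow> (real \<times> real) set \<Rightarrow> (real \<times> real \<Rightarrow> real) set" where
  "Cinf_cpt U T = {\<phi>. (\<forall>k. Ck_upto k U T \<phi>) \<and>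
     compact (closure {p. \<phi> p \<noteq> 0}) \<and> closure {p. \<phi> p \<noteq> 0} \<subseteq> T}"

definition loc_integrable :: "(real \<times> real) set \<Rightarrow> (real \<times> real \<Rightarrow> real) \<Rightarrow> bool" where
  "loc_integrable \<O> u \<longleftrightarrow> (\<forall>K. compact K \<and> K \<subseteq> \<O> \<longrightarrow> u absolutely_integrable_on K)"

definition has_weak_deriv ::
  "(real \<times> real) set \<Rightarrow> real \<times> real \<Rightarrow> (real \<times> real \<Rightarrow> real) \<Rightarrow> (real \<times> real \<Rightarrow> real) \<Rightarrow> bool" where
  "has_weak_deriv \<O> e u g \<longleftrightarrow> loc_integrable \<O> u \<and> loc_integrable \<O> g \<and>
     (\<forall>\<phi>\<in>Cinf_cpt \<O> \<O>.
        (LINT p:\<O>|lebesgue. u p * frechet_derivative \<phi> (at p) e)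
          = - (LINT p:\<O>|lebesgue. g p * \<phi> p))"

text \<open>Weak derivatives are determined only up to a null set; the choice of representative
  is immaterial below.\<close>

definition weak_deriv ::
  "(real \<times> real) set \<Rightarrow> real \<times> real \<Rightarrow> (real \<times> real \<Rightarrow> real) \<Rightarrow> real \<times> real \<Rightarrow> real" where
  "weak_deriv \<O> e u = (SOME g. has_weak_deriv \<O> e u g)"

abbreviation wdx :: "(real \<times> real) set \<Rightarrow> (real \<times> real \<Rightarrow> real) \<Rightarrow> real \<times> real \<Rightarrow> real" where
  "wdx \<O> \<equiv> weak_deriv \<O> (1, 0)"

abbreviation wdy :: "(real \<times> real) set \<Rightarrow> (real \<times> real \<Rightarrow> real) \<Rightarrow> real \<times> real \<Rightarrow> real" where
  "wdy \<O> \<equiv> weak_deriv \<O> (0, 1)"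

section \<open>Weighted function spaces\<close>

text \<open>The spaces consist of functions on the plane of which only the restriction to the domain
  matters; two elements are identified when they agree almost everywhere on the domain.\<close>

definition L2_space :: "heston \<Rightarrow> real \<Rightarrow> (real \<times> real) set \<Rightarrow> (real \<times> real \<Rightarrow> real) set" where
  "L2_space A \<gamma> \<O> = {f. f \<in> borel_measurable (hmeasure A \<gamma> \<O>) \<and>
     integrable (hmeasure A \<gamma> \<O>) (\<lambda>p. (f p)\<^sup>2)}"

definition L2_inner ::
  "heston \<Rightarrow> real \<Rightarrow> (real \<times> real) set \<Rightarrow> (real \<times> real \<Rightarrow> real) \<Rightarrow> (real \<times> real \<Rightarrow> real) \<Rightarrow> real" where
  "L2_inner A \<gamma> \<O> f g = (LINT p|hmeasure A \<gamma> \<O>. f p * g p)"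

definition H1_density :: "(real \<times> real) set \<Rightarrow> (real \<times> real \<Rightarrow> real) \<Rightarrow> real \<times> real \<Rightarrow> real" where
  "H1_density \<O> u p =
     snd p * ((wdx \<O> u p)\<^sup>2 + (wdy \<O> u p)\<^sup>2) + (1 + snd p) * (u p)\<^sup>2"

definition H1_space :: "heston \<Rightarrow> real \<Rightarrow> (real \<times> real) set \<Rightarrow> (real \<times> real \<Rightarrow> real) set" where
  "H1_space A \<gamma> \<O> = {u. (\<exists>g. has_weak_deriv \<O> (1, 0) u g) \<and> (\<exists>g. has_weak_deriv \<O> (0, 1) u g) \<and>
     integrable (hmeasure A \<gamma> \<O>) (H1_density \<O> u)}"

definition H1_norm :: "heston \<Rightarrow> real \<Rightarrow> (real \<times> real) set \<Rightarrow> (real \<times> real \<Rightarrow> real) \<Rightarrow> real" where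
  "H1_norm A \<gamma> \<O> u = sqrt (LINT p|hmeasure A \<gamma> \<O>. H1_density \<O> u p)"

definition H10_space :: "heston \<Rightarrow> real \<Rightarrow> (real \<times> real) set \<Rightarrow> (real \<times> real \<Rightarrow> real) set" where
  "H10_space A \<gamma> \<O> = {u \<in> H1_space A \<gamma> \<O>.
     \<forall>\<epsilon>>0. \<exists>\<phi>\<in>Cinf_cpt \<O> (\<O> \<union> Gamma0 \<O>). H1_norm A \<gamma> \<O> (\<lambda>p. u p - \<phi> p) < \<epsilon>}"

section \<open>The Heston bilinear form\<close>

definition heston_form ::
  "heston \<Rightarrow> real \<Rightarrow> (real \<times> real) set \<Rightarrow> (real \<times> real \<Rightarrow> real) \<Rightarrow> (real \<times> real \<Rightarrow> real) \<Rightarrow> real" where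
  "heston_form A \<gamma> \<O> u v =
     1/2 * (LINT p|hmeasure A \<gamma> \<O>.
        (wdx \<O> u p * wdx \<O> v p + hrho A * hsigma A * wdy \<O> u p * wdx \<O> v p
         + hrho A * hsigma A * wdx \<O> u p * wdy \<O> v p
         + (hsigma A)\<^sup>2 * wdy \<O> u p * wdy \<O> v p) * snd p)
     - \<gamma>/2 * (LINT p|hmeasure A \<gamma> \<O>.
        (wdx \<O> u p + hrho A * hsigma A * wdy \<O> u p) * v p * sgn (fst p) * snd p)
     - (LINT p|hmeasure A \<gamma> \<O>. ha1 A * snd p * wdx \<O> u p * v p)
     + (LINT p|hmeasure A \<gamma> \<O>. hr A * u p * v p)"

definition heston_form_shifted ::
  "heston \<Rightarrow> real \<Rightarrow> real \<Rightarrow> (real \<times> real) set \<Rightarrow>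
     (real \<times> real \<Rightarrow> real) \<Rightarrow> (real \<times> real \<Rightarrow> real) \<Rightarrow> real" where
  "heston_form_shifted A \<gamma> l \<O> u v =
     heston_form A \<gamma> \<O> u v + l * L2_inner A \<gamma> \<O> (\<lambda>p. (1 + snd p) * u p) v"

text \<open>The constants \<open>C\<close> and \<open>\<nu>\<close> are uniform over all domains and all weights with
  \<open>0 < \<gamma> < \<gamma>0\<close>, so that, like \<open>l\<close>, they depend only on the coefficients once
  \<open>\<gamma>0\<close> does.\<close>

definition admissible_shift :: "heston \<Rightarrow> real \<Rightarrow> real \<Rightarrow> bool" where
  "admissible_shift A \<gamma>0 l \<longleftrightarrow> 0 < l \<and>
     (\<exists>C>0. \<exists>\<nu>>0. \<forall>\<gamma> \<O>. 0 < \<gamma> \<and> \<gamma> < \<gamma>0 \<and> half_plane_domain \<O> \<and> Gamma0 \<O> \<noteq> {} \<longrightarrow>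
        (\<forall>u\<in>H10_space A \<gamma> \<O>. \<forall>v\<in>H10_space A \<gamma> \<O>.
           \<bar>heston_form_shifted A \<gamma> l \<O> u v\<bar> \<le> C * H1_norm A \<gamma> \<O> u * H1_norm A \<gamma> \<O> v) \<and>
        (\<forall>v\<in>H10_space A \<gamma> \<O>.
           heston_form_shifted A \<gamma> l \<O> v v \<ge> \<nu> * (H1_norm A \<gamma> \<O> v)\<^sup>2))"

section \<open>The obstacle problem\<close>

definition obstacle_set ::
  "heston \<Rightarrow> real \<Rightarrow> (real \<times> real) set \<Rightarrow> (real \<times> real \<Rightarrow> real) \<Rightarrow> (real \<times> real \<Rightarrow> real) set" where
  "obstacle_set A \<gamma> \<O> \<psi> = {v \<in> H10_space A \<gamma> \<O>. AE p in lebesgue_on \<O>. v p \<ge> \<psi> p}"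

definition solves_VI ::
  "heston \<Rightarrow> real \<Rightarrow> real \<Rightarrow> (real \<times> real) set \<Rightarrow>
     (real \<times> real \<Rightarrow> real) \<Rightarrow> (real \<times> real \<Rightarrow> real) \<Rightarrow> (real \<times> real \<Rightarrow> real) \<Rightarrow> bool" where
  "solves_VI A \<gamma> l \<O> f \<psi> u \<longleftrightarrow> u \<in> obstacle_set A \<gamma> \<O> \<psi> \<and>
     (\<forall>v\<in>obstacle_set A \<gamma> \<O> \<psi>.
        heston_form_shifted A \<gamma> l \<O> u (\<lambda>p. v p - u p) \<ge> L2_inner A \<gamma> \<O> f (\<lambda>p. v p - u p))"

end

theory Submission
  imports Defs "HOL-Library.Function_Algebras"
begin

text \<open>
  The obstacle problem is a variational inequality for a bounded coercive bilinear form over a closed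
  convex set, so existence is the theorem of Lions and Stampacchia and uniqueness is coercivity. The
  mathematical content lies in checking that the Heston form and the weighted spaces fit this
  pattern.

  \<^bold>\<open>The energy vector.\<close> For a weakly differentiable \<open>u\<close> put
  \<open>E u = (sqrt y * u_x, sqrt y * u_y, sqrt (1 + y) * u)\<close>. The norm of \<open>u\<close> in the weighted Sobolev
  space is the \<open>L2\<close> norm of \<open>E u\<close> for the weighted measure, and the shifted Heston form is the
  integral of \<open>q p (E u p) (E v p)\<close> for an explicit bilinear form \<open>q p\<close> on three-dimensional
  space (\<open>heston_form_shifted_eq\<close>). Hence all estimates are pointwise. Boundedness
  (\<open>form_density_bounded\<close>) holds because the coefficients of \<open>q p\<close> are bounded once \<open>\<gamma> < 1\<close>.
  For coercivity (\<open>form_density_coercive\<close>), the second-order part is elliptic because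
  \<open>\<bar>\<rho>\<bar> < 1\<close>, and each first-order term is the product of a derivative component of \<open>E u\<close> with
  its last component, so that Young's inequality and a large shift \<open>l\<close> absorb it. The parameter
  \<open>\<gamma>\<close> occurs only as the bounded factor of one such term, so \<open>\<gamma>0 = 1\<close> is a valid choice.

  \<^bold>\<open>The variational inequality.\<close> For a symmetric form the solution minimises a quadratic functional
  over the convex set, and the parallelogram identity makes minimising sequences Cauchy
  (\<open>minimizer_exists\<close>). In general one takes the symmetric part of the form as semi-inner product; the
  skew part is then handled by a fixed-point iteration whose steps are minimisation problems. Because
  the skew part pairs each vector only with the directions orthogonal to it, a suitable relaxation
  parameter makes the iteration a contraction (\<open>skew_perturbation_bound\<close>,
  \<open>Lions_Stampacchia\<close>). Elements of the spaces are functions and not equivalence classes, so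
  everything is done for semi-norms.

  \<^bold>\<open>The spaces.\<close> The derivatives in \<open>E u\<close> are arbitrarily chosen weak derivatives, so linearity of
  \<open>E\<close> up to null sets requires that weak derivatives are unique almost everywhere. This is the
  fundamental lemma of the calculus of variations: testing with bump functions that converge to
  the indicator of a box shows that the integral over every small box vanishes, and Lebesgue
  differentiation concludes. Completeness (\<open>H1_complete\<close>) follows from completeness of \<open>L2\<close>, since on
  compact subsets of the domain the weights are bounded away from zero and the identity defining weak
  derivatives passes to the limit. Test functions that do not vanish at the degenerate boundary
  \<open>y = 0\<close> have finite norm (\<open>test_function_in_H1\<close>), because \<open>\<beta> > 0\<close> makes the weight
  \<open>y powr (\<beta> - 1)\<close> integrable there. Finally the obstacle set is non-empty, as it contains the
  positive part of the obstacle, and it is closed, because a norm-convergent sequence has a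
  subsequence that converges almost everywhere.
\<close>

section \<open>Variational inequalities in semi-inner product spaces\<close>

text \<open>Pointwise operations make a function type a real vector space, so that sets of functions such as the
  Sobolev spaces are subspaces in the sense of the linear algebra library.\<close>

instantiation "fun" :: (type, real_vector) real_vector
begin

definition scaleR_fun :: "real \<Rightarrow> ('a \<Rightarrow> 'b) \<Rightarrow> 'a \<Rightarrow> 'b" where
  "scaleR_fun c f = (\<lambda>x. c *\<^sub>R f x)"

instance
  by standard (auto simp: scaleR_fun_def fun_eq_iff algebra_simps)

end

lemma scaleR_apply [simp]: "(c *\<^sub>R f) x = c *\<^sub>R f x"
  by (simp add: scaleR_fun_def)

definition linear_form_on :: "'v::real_vector set \<Rightarrow> ('v \<Rightarrow> real) \<Rightarrow> bool" where
  "linear_form_on V F \<longleftrightarrow>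
     (\<forall>u\<in>V. \<forall>v\<in>V. F (u + v) = F u + F v) \<and> (\<forall>c. \<forall>v\<in>V. F (c *\<^sub>R v) = c * F v)"

definition bilinear_form_on :: "'v::real_vector set \<Rightarrow> ('v \<Rightarrow> 'v \<Rightarrow> real) \<Rightarrow> bool" where
  "bilinear_form_on V B \<longleftrightarrow>
     (\<forall>v\<in>V. linear_form_on V (\<lambda>u. B u v)) \<and> (\<forall>u\<in>V. linear_form_on V (B u))"

lemma linear_form_on_subset: "linear_form_on V F \<Longrightarrow> W \<subseteq> V \<Longrightarrow> linear_form_on W F"
  unfolding linear_form_on_def by (meson subsetD)

lemma bilinear_form_on_subset: "bilinear_form_on V B \<Longrightarrow> W \<subseteq> V \<Longrightarrow> bilinear_form_on W B"
  unfolding bilinear_form_on_def by (meson subsetD linear_form_on_subset)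

lemma linear_form_on_diff:
  assumes "subspace V" "linear_form_on V F" "u \<in> V" "v \<in> V"
  shows "F (u - v) = F u - F v"
proof -
  have "(-1) *\<^sub>R v \<in> V" using assms subspace_scale by blast
  then have "F (u + (-1) *\<^sub>R v) = F u + (-1) * F v"
    using assms unfolding linear_form_on_def by metis
  then show ?thesis by simp
qed

locale semi_inner_space =
  fixes V :: "'v::real_vector set" and ip :: "'v \<Rightarrow> 'v \<Rightarrow> real"
  assumes subsp: "subspace V"
    and ip_bilinear: "bilinear_form_on V ip"
    and ip_sym: "\<And>u v. u \<in> V \<Longrightarrow> v \<in> V \<Longrightarrow> ip u v = ip v u"
    and ip_nonneg: "\<And>u. u \<in> V \<Longrightarrow> 0 \<le> ip u u"
begin

definition nrm :: "'v \<Rightarrow> real" where "nrm v = sqrt (ip v v)"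

definition complete_on :: "'v set \<Rightarrow> bool" where
  "complete_on K \<longleftrightarrow>
     (\<forall>s. (\<forall>n. s n \<in> K) \<longrightarrow> (\<forall>\<epsilon>>0. \<exists>N. \<forall>m\<ge>N. \<forall>n\<ge>N. nrm (s m - s n) < \<epsilon>) \<longrightarrow>
       (\<exists>u\<in>K. (\<lambda>n. nrm (s n - u)) \<longlonglongrightarrow> 0))"

lemma mem_add [simp, intro]: "u \<in> V \<Longrightarrow> v \<in> V \<Longrightarrow> u + v \<in> V"
  and mem_diff [simp, intro]: "u \<in> V \<Longrightarrow> v \<in> V \<Longrightarrow> u - v \<in> V"
  and mem_scale [simp, intro]: "u \<in> V \<Longrightarrow> c *\<^sub>R u \<in> V"
  using subsp by (auto simp: subspace_add subspace_diff subspace_scale)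

lemma form_simps:
  assumes "linear_form_on V F"
  shows "u \<in> V \<Longrightarrow> v \<in> V \<Longrightarrow> F (u + v) = F u + F v"
    "u \<in> V \<Longrightarrow> v \<in> V \<Longrightarrow> F (u - v) = F u - F v"
    "u \<in> V \<Longrightarrow> F (c *\<^sub>R u) = c * F u"
  using assms linear_form_on_diff[OF subsp] unfolding linear_form_on_def by auto

lemma bilinear_simps:
  assumes "bilinear_form_on V B" "w \<in> V"
  shows "u \<in> V \<Longrightarrow> v \<in> V \<Longrightarrow> B (u + v) w = B u w + B v w"
    "u \<in> V \<Longrightarrow> v \<in> V \<Longrightarrow> B (u - v) w = B u w - B v w"
    "u \<in> V \<Longrightarrow> B (c *\<^sub>R u) w = c * B u w"
    "u \<in> V \<Longrightarrow> v \<in> V \<Longrightarrow> B w (u + v) = B w u + B w v"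
    "u \<in> V \<Longrightarrow> v \<in> V \<Longrightarrow> B w (u - v) = B w u - B w v"
    "u \<in> V \<Longrightarrow> B w (c *\<^sub>R u) = c * B w u"
  using form_simps(1,2)[of "\<lambda>x. B x w" u v] form_simps(3)[where F = "\<lambda>x. B x w"] form_simps(1,2)[of "B w" u v]
    form_simps(3)[where F = "B w"] assms
  unfolding bilinear_form_on_def by auto

lemmas ip_simps = bilinear_simps[OF ip_bilinear]

lemma nrm_nonneg [simp]: "v \<in> V \<Longrightarrow> 0 \<le> nrm v"
  by (simp add: nrm_def ip_nonneg)

lemma nrm_zero [simp]: "nrm 0 = 0"
  using ip_simps(3)[of 0 0 0] subspace_0[OF subsp] by (simp add: nrm_def)

lemma nrm_sq: "v \<in> V \<Longrightarrow> (nrm v)\<^sup>2 = ip v v"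
  by (simp add: nrm_def ip_nonneg)

lemma ip_add_sq: "u \<in> V \<Longrightarrow> v \<in> V \<Longrightarrow>
    ip (u + c *\<^sub>R v) (u + c *\<^sub>R v) = ip u u + 2 * c * ip u v + c\<^sup>2 * ip v v"
  using ip_sym[of u v] by (simp add: ip_simps algebra_simps power2_eq_square)

lemma ip_diff_sq: "u \<in> V \<Longrightarrow> v \<in> V \<Longrightarrow> ip (u - v) (u - v) = ip u u - 2 * ip u v + ip v v"
  using ip_sym[of u v] by (simp add: ip_simps algebra_simps)

lemma Cauchy_Schwarz:
  assumes "u \<in> V" "v \<in> V"
  shows "\<bar>ip u v\<bar> \<le> nrm u * nrm v"
proof -
  have q: "0 \<le> ip u u + 2 * c * ip u v + c\<^sup>2 * ip v v" for c
    using ip_nonneg[of "u + c *\<^sub>R v"] assms by (simp add: ip_add_sq)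
  have "(ip u v)\<^sup>2 \<le> ip u u * ip v v"
  proof (cases "ip v v = 0")
    case True
    have "ip u v = 0"
    proof (rule ccontr)
      assume n: "ip u v \<noteq> 0"
      have "2 * (- (ip u u + 1) / (2 * ip u v)) * ip u v = - (ip u u + 1)"
        using n by simp
      then show False using q[of "- (ip u u + 1) / (2 * ip u v)"] True by simp
    qed
    then show ?thesis using True by simp
  next
    case False
    then have p: "ip v v > 0" using ip_nonneg[OF assms(2)] by simp
    have "ip u u + 2 * (- ip u v / ip v v) * ip u v + (- ip u v / ip v v)\<^sup>2 * ip v v
        = ip u u - (ip u v)\<^sup>2 / ip v v"
      using p by (simp add: power2_eq_square field_simps)
    then have "(ip u v)\<^sup>2 / ip v v \<le> ip u u" using q[of "- ip u v / ip v v"] by linarith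
    then show ?thesis using p by (simp add: field_simps)
  qed
  then have "sqrt ((ip u v)\<^sup>2) \<le> sqrt (ip u u * ip v v)" by (rule real_sqrt_le_mono)
  then show ?thesis by (simp add: nrm_def real_sqrt_mult)
qed

lemma nrm_triangle:
  assumes "u \<in> V" "v \<in> V"
  shows "nrm (u + v) \<le> nrm u + nrm v"
proof (rule power2_le_imp_le)
  have "(nrm (u + v))\<^sup>2 = ip u u + 2 * ip u v + ip v v"
    using assms ip_add_sq[of u v 1] by (simp add: nrm_sq)
  also have "\<dots> \<le> (nrm u)\<^sup>2 + 2 * (nrm u * nrm v) + (nrm v)\<^sup>2"
    using Cauchy_Schwarz[OF assms] assms by (simp add: nrm_sq)
  finally show "(nrm (u + v))\<^sup>2 \<le> (nrm u + nrm v)\<^sup>2"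
    by (simp add: power2_eq_square algebra_simps)
qed (use assms in simp)

lemma nrm_minus: "u \<in> V \<Longrightarrow> v \<in> V \<Longrightarrow> nrm (u - v) = nrm (v - u)"
  using ip_sym[of u v] by (simp add: nrm_def ip_diff_sq)

lemma nrm_triangle_diff:
  "u \<in> V \<Longrightarrow> v \<in> V \<Longrightarrow> w \<in> V \<Longrightarrow> nrm (u - w) \<le> nrm (u - v) + nrm (v - w)"
  using nrm_triangle[of "u - v" "v - w"] by simp

text \<open>The functional \<open>J v = ip v v / 2 - F v\<close> is bounded below since the quadratic term dominates. The
  parallelogram identity and convexity bound the distance of two near-minimisers by their excess in
  \<open>J\<close>, so a minimising sequence is Cauchy. At the limit, the one-sided derivative of \<open>J\<close> in every
  direction that points into \<open>K\<close> is non-negative, which is the variational inequality.\<close>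

lemma minimizer_exists:
  assumes K: "K \<subseteq> V" "K \<noteq> {}" "convex K" "complete_on K"
    and F: "linear_form_on V F" "\<And>v. v \<in> V \<Longrightarrow> \<bar>F v\<bar> \<le> c * nrm v"
  shows "\<exists>u\<in>K. \<forall>v\<in>K. F (v - u) \<le> ip u (v - u)"
proof -
  define J where "J v = ip v v / 2 - F v" for v
  have KV: "v \<in> V" if "v \<in> K" for v using that K by auto
  have J_lower: "- (c\<^sup>2) / 2 \<le> J v" if "v \<in> K" for v
  proof -
    have "0 \<le> (nrm v - c)\<^sup>2" by simp
    then have "c * nrm v \<le> (nrm v)\<^sup>2 / 2 + c\<^sup>2 / 2" by (simp add: power2_eq_square algebra_simps)
    then show ?thesis using F(2)[OF KV[OF that]] nrm_sq[OF KV[OF that]] unfolding J_def by linarith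
  qed
  define m where "m = Inf (J ` K)"
  have bdd: "bdd_below (J ` K)" using J_lower by (auto simp: bdd_below_def)
  have m_le: "m \<le> J v" if "v \<in> K" for v
    unfolding m_def using bdd that by (simp add: cINF_lower)
  have "\<exists>v\<in>K. J v < m + inverse (real (Suc n))" for n :: nat
    using cINF_less_iff[OF K(2) bdd, of "m + inverse (real (Suc n))"] unfolding m_def by auto
  then obtain s where s: "\<And>n::nat. s n \<in> K" "\<And>n::nat. J (s n) < m + inverse (real (Suc n))" by metis
  have par: "ip (u - v) (u - v) \<le> 4 * (J u + J v - 2 * m)" if "u \<in> K" "v \<in> K" for u v
  proof -
    \<comment> \<open>The midpoint lies in the convex set, so its value of \<open>J\<close> is at least \<open>m\<close>.\<close>
    let ?w = "(1/2) *\<^sub>R u + (1/2) *\<^sub>R v"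
    have "?w \<in> K" using K(3) that by (simp add: convex_def)
    then have "m \<le> J ?w" by (rule m_le)
    moreover have "J ?w = (ip u u + 2 * ip u v + ip v v) / 8 - (F u + F v) / 2"
      using that KV ip_sym[of u v] unfolding J_def
      by (simp add: ip_simps form_simps[OF F(1)] field_simps)
    ultimately show ?thesis
      using that KV unfolding J_def by (simp add: ip_diff_sq field_simps)
  qed
  have arith: "x < 4 * (a + a)" if "x \<le> 4 * (y + z - 2 * m)" "y < m + b" "z < m + c" "b \<le> a" "c \<le> a"
    for x y z a b c :: real using that by argo
  have "\<exists>N. \<forall>p\<ge>N. \<forall>n\<ge>N. nrm (s p - s n) < \<epsilon>" if "\<epsilon> > 0" for \<epsilon>
  proof -
    obtain N :: nat where N: "8 / \<epsilon>\<^sup>2 < N" using reals_Archimedean2 by blast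
    have "nrm (s p - s n) < \<epsilon>" if "p \<ge> N" "n \<ge> N" for p n
    proof -
      have N0: "0 < real N" using N \<open>\<epsilon> > 0\<close> by (meson divide_nonneg_nonneg le_less_trans zero_le_numeral zero_le_power2)
      have "inverse (real (Suc p)) \<le> inverse N" "inverse (real (Suc n)) \<le> inverse N"
        using that N0 by (auto intro!: le_imp_inverse_le)
      then have "ip (s p - s n) (s p - s n) < 4 * (inverse N + inverse N)"
        using arith[OF par[OF s(1)[of p] s(1)[of n]] s(2)[of p] s(2)[of n]] by blast
      also have "\<dots> < \<epsilon>\<^sup>2" using N N0 \<open>\<epsilon> > 0\<close> by (simp add: field_simps)
      finally show ?thesis
        unfolding nrm_def using \<open>\<epsilon> > 0\<close> by (simp add: real_less_lsqrt)
    qed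
    then show ?thesis by blast
  qed
  with K(4) s(1) obtain u where u: "u \<in> K" "(\<lambda>n. nrm (s n - u)) \<longlonglongrightarrow> 0"
    unfolding complete_on_def by blast
  have Ju: "J u \<le> m"
  proof (rule LIMSEQ_le_const)
    let ?b = "\<lambda>n. m + inverse (real (Suc n)) + (nrm u * nrm (s n - u) + c * nrm (s n - u))"
    have "?b \<longlonglongrightarrow> m + 0 + (nrm u * 0 + c * 0)"
      by (intro tendsto_intros u(2) LIMSEQ_inverse_real_of_nat)
    then show "?b \<longlonglongrightarrow> m" by simp
    have "J u \<le> ?b n" for n
    proof -
      let ?d = "s n - u"
      have d: "?d \<in> V" "u \<in> V" using s(1) u(1) KV by auto
      have "J (s n) = J u + ip u ?d - F ?d + ip ?d ?d / 2"
        using ip_add_sq[OF d(2,1), of 1] form_simps(1)[OF F(1) d(2,1)] unfolding J_def by simp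
      then show ?thesis
        using Cauchy_Schwarz[OF d(2,1)] F(2)[OF d(1)] ip_nonneg[OF d(1)] s(2)[of n]
        by linarith
    qed
    then show "\<exists>N. \<forall>n\<ge>N. J u \<le> ?b n" by blast
  qed
  have "F (v - u) \<le> ip u (v - u)" if "v \<in> K" for v
  proof (rule ccontr)
    let ?d = "v - u"
    assume "\<not> ?thesis"
    then have neg: "0 < F ?d - ip u ?d" (is "0 < ?g") by simp
    have V: "u \<in> V" "?d \<in> V" using u(1) that KV by auto
    \<comment> \<open>A step so short that the quadratic term cannot compensate the linear decrease \<open>t * ?g\<close>.\<close>
    define t where "t = min 1 (?g / (ip ?d ?d + 1))"
    have i0: "0 \<le> ip ?d ?d" using ip_nonneg V by simp
    have t01: "0 < t" "t \<le> 1" using neg i0 by (simp_all add: t_def)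
    have "t \<le> ?g / (ip ?d ?d + 1)" by (simp add: t_def)
    then have "t * (ip ?d ?d + 1) \<le> ?g" using i0 by (simp add: pos_le_divide_eq)
    note t = t01 this
    have "u + t *\<^sub>R ?d = (1 - t) *\<^sub>R u + t *\<^sub>R v" by (simp add: algebra_simps)
    then have "u + t *\<^sub>R ?d \<in> K" using K(3) u(1) that t by (simp add: convex_def)
    then have "m \<le> J (u + t *\<^sub>R ?d)" by (rule m_le)
    also have "\<dots> = J u - t * ?g + t\<^sup>2 * ip ?d ?d / 2"
    proof -
      have "F (u + t *\<^sub>R ?d) = F u + t * F ?d"
        using V by (simp only: form_simps[OF F(1)] mem_scale)
      then show ?thesis
        unfolding J_def ip_add_sq[OF V] by (simp only:) (simp add: field_simps)
    qed
    finally have "t * ?g \<le> t * (t * ip ?d ?d / 2)" using Ju by (simp add: power2_eq_square)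
    then have "?g \<le> t * ip ?d ?d / 2" using t(1) by simp
    moreover have "0 \<le> t * ip ?d ?d" "t * (ip ?d ?d + 1) = t * ip ?d ?d + t"
      using t(1) i0 by (simp_all add: algebra_simps)
    ultimately show False using t by linarith
  qed
  then show ?thesis using u(1) by blast
qed

text \<open>Banach's fixed point theorem for a semi-norm: the limit \<open>u\<close> of the iterates is only known to be
  at distance zero from its image.\<close>

lemma contraction_fixed_point:
  assumes K: "K \<subseteq> V" "K \<noteq> {}" "complete_on K"
    and T: "\<And>w. w \<in> K \<Longrightarrow> T w \<in> K"
    and k: "0 \<le> k" "k < 1" "\<And>v w. v \<in> K \<Longrightarrow> w \<in> K \<Longrightarrow> nrm (T v - T w) \<le> k * nrm (v - w)"
  shows "\<exists>u\<in>K. nrm (T u - u) = 0"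
proof -
  have KV: "v \<in> V" if "v \<in> K" for v using that K by auto
  obtain w0 where w0: "w0 \<in> K" using K by auto
  define s where "s n = (T ^^ n) w0" for n
  have sK: "s n \<in> K" for n by (induction n) (auto simp: s_def w0 T)
  have s_Suc: "s (Suc n) = T (s n)" for n by (simp add: s_def)
  have step: "nrm (s (Suc n) - s n) \<le> k ^ n * nrm (s 1 - s 0)" for n
  proof (induction n)
    case (Suc n)
    have "nrm (s (Suc (Suc n)) - s (Suc n)) \<le> k * nrm (s (Suc n) - s n)"
      using k(3)[OF sK sK, of "Suc n" n] by (simp add: s_Suc)
    also have "\<dots> \<le> k * (k ^ n * nrm (s 1 - s 0))" using Suc k(1) by (intro mult_left_mono) auto
    finally show ?case by (simp add: mult.assoc)
  qed simp
  define D where "D = nrm (s 1 - s 0) / (1 - k)"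
  have D0: "0 \<le> D" using k KV[OF sK] by (simp add: D_def)
  have tail: "nrm (s (n + j) - s n) \<le> k ^ n * (1 - k ^ j) * D" for n j
  proof (induction j)
    case 0
    show ?case by simp
  next
    case (Suc j)
    have "nrm (s (n + Suc j) - s n) \<le> nrm (s (Suc (n + j)) - s (n + j)) + nrm (s (n + j) - s n)"
      using nrm_triangle_diff KV sK by simp
    also have "\<dots> \<le> k ^ (n + j) * nrm (s 1 - s 0) + k ^ n * (1 - k ^ j) * D"
      using step Suc by (intro add_mono) auto
    also have "nrm (s 1 - s 0) = (1 - k) * D" using k by (simp add: D_def)
    finally show ?case by (simp add: power_add algebra_simps)
  qed
  have tail': "nrm (s m - s n) \<le> k ^ n * D" if "m \<ge> n" for m n
  proof -
    have "nrm (s m - s n) \<le> k ^ n * (1 - k ^ (m - n)) * D" using tail[of n "m - n"] that by simp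
    also have "\<dots> \<le> k ^ n * 1 * D" using k D0 by (intro mult_right_mono mult_left_mono) auto
    finally show ?thesis by simp
  qed
  have lim0: "(\<lambda>n. k ^ n * D) \<longlonglongrightarrow> 0"
    using tendsto_mult_right[OF LIMSEQ_realpow_zero[OF k(1,2)], of D] by simp
  have "\<exists>N. \<forall>m\<ge>N. \<forall>n\<ge>N. nrm (s m - s n) < \<epsilon>" if "\<epsilon> > 0" for \<epsilon>
  proof -
    obtain N where N: "\<And>n. n \<ge> N \<Longrightarrow> k ^ n * D < \<epsilon>"
      using order_tendstoD(2)[OF lim0 \<open>\<epsilon> > 0\<close>] by (auto simp: eventually_sequentially)
    have "nrm (s m - s n) < \<epsilon>" if "m \<ge> N" "n \<ge> N" for m n
    proof (cases "m \<ge> n")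
      case True then show ?thesis using tail'[OF True] N[OF that(2)] by linarith
    next
      case False
      then have "nrm (s n - s m) < \<epsilon>" using tail'[of m n] N[OF that(1)] by linarith
      then show ?thesis using nrm_minus KV sK by metis
    qed
    then show ?thesis by blast
  qed
  with K(3) sK obtain u where u: "u \<in> K" "(\<lambda>n. nrm (s n - u)) \<longlonglongrightarrow> 0"
    unfolding complete_on_def by blast
  have "nrm (T u - u) \<le> 0"
  proof (rule LIMSEQ_le_const)
    have "(\<lambda>n. k * nrm (s n - u) + nrm (s (Suc n) - u)) \<longlonglongrightarrow> k * 0 + 0"
      by (intro tendsto_intros u(2) LIMSEQ_Suc[OF u(2)])
    then show "(\<lambda>n. k * nrm (s n - u) + nrm (s (Suc n) - u)) \<longlonglongrightarrow> 0" by simp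
    have "nrm (T u - u) \<le> k * nrm (s n - u) + nrm (s (Suc n) - u)" for n
    proof -
      have "nrm (T u - u) \<le> nrm (T u - T (s n)) + nrm (T (s n) - u)"
        using nrm_triangle_diff KV T sK u(1) by simp
      also have "nrm (T u - T (s n)) \<le> k * nrm (s n - u)"
        using k(3)[OF u(1) sK[of n]] nrm_minus[of u "s n"] KV sK u(1) by simp
      finally show ?thesis by (simp add: s_Suc)
    qed
    then show "\<exists>N. \<forall>n\<ge>N. nrm (T u - u) \<le> k * nrm (s n - u) + nrm (s (Suc n) - u)" by blast
  qed
  then have "nrm (T u - u) = 0" using KV u(1) T by (intro antisym) auto
  then show ?thesis using u(1) by blast
qed

text \<open>By Pythagoras' theorem the constant is the root of \<open>a\<^sup>2 + b\<^sup>2 * M\<^sup>2\<close> and not \<open>\<bar>a\<bar> + \<bar>b\<bar> * M\<close>: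
  after splitting \<open>z\<close> into its component along \<open>w\<close> and a component \<open>z'\<close> orthogonal to \<open>w\<close>, the
  inner product sees only the former and the skew form only the latter. With \<open>a = 1 - t\<close> and
  \<open>b = - t\<close> for small positive \<open>t\<close> the constant is therefore less than one, however large \<open>M\<close> is.\<close>

lemma skew_perturbation_bound:
  assumes S: "bilinear_form_on V S" "\<And>w. w \<in> V \<Longrightarrow> S w w = 0"
    "\<And>w z. w \<in> V \<Longrightarrow> z \<in> V \<Longrightarrow> \<bar>S w z\<bar> \<le> M * (nrm w * nrm z)" "0 \<le> M"
    and wz: "w \<in> V" "z \<in> V"
  shows "\<bar>a * ip w z + b * S w z\<bar> \<le> sqrt (a\<^sup>2 + b\<^sup>2 * M\<^sup>2) * (nrm w * nrm z)"
proof (cases "nrm w = 0")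
  case True
  then have "ip w z = 0" "S w z = 0" using Cauchy_Schwarz[OF wz] S(3)[OF wz] by auto
  then show ?thesis using True by simp
next
  case False
  then have w0: "ip w w > 0" using ip_nonneg[OF wz(1)] nrm_def[of w] by (metis less_eq_real_def real_sqrt_zero)
  define \<alpha> where "\<alpha> = ip w z / ip w w"
  define z' where "z' = z - \<alpha> *\<^sub>R w"
  have z'V: "z' \<in> V" using wz by (simp add: z'_def)
  have orth: "ip w z' = 0" using wz w0 by (simp add: z'_def ip_simps \<alpha>_def)
  have Sz: "S w z = S w z'" using wz by (simp add: z'_def bilinear_simps[OF S(1)] S(2))
  have zeq: "z = z' + \<alpha> *\<^sub>R w" by (simp add: z'_def)
  have "ip z z = ip z' z' + \<alpha>\<^sup>2 * ip w w"
    unfolding zeq using ip_add_sq[OF z'V wz(1)] orth ip_sym[OF wz(1) z'V] by simp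
  then have nz: "(nrm z)\<^sup>2 = (nrm z')\<^sup>2 + (\<alpha> * nrm w)\<^sup>2"
    using wz z'V by (simp add: nrm_sq power_mult_distrib)
  have ipz: "ip w z = (\<alpha> * nrm w) * nrm w"
    using w0 wz nrm_sq[OF wz(1)] by (simp add: \<alpha>_def power2_eq_square field_simps)
  have "\<bar>a * ip w z + b * S w z\<bar> \<le> \<bar>a * ip w z\<bar> + \<bar>b * S w z\<bar>" by simp
  also have "\<dots> \<le> \<bar>a\<bar> * (\<bar>\<alpha> * nrm w\<bar> * nrm w) + \<bar>b\<bar> * (M * (nrm w * nrm z'))"
    using S(3)[OF wz(1) z'V] wz(1) unfolding Sz ipz abs_mult
    by (intro add_mono mult_left_mono) auto
  also have "\<dots> = nrm w * (\<bar>a\<bar> * \<bar>\<alpha> * nrm w\<bar> + (\<bar>b\<bar> * M) * nrm z')" by (simp add: algebra_simps)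
  also have "\<dots> \<le> nrm w * (sqrt (a\<^sup>2 + b\<^sup>2 * M\<^sup>2) * nrm z)"
  proof (rule mult_left_mono, rule power2_le_imp_le)
    have cs2: "(x1 * y1 + x2 * y2)\<^sup>2 \<le> (x1\<^sup>2 + x2\<^sup>2) * (y1\<^sup>2 + y2\<^sup>2)" for x1 x2 y1 y2 :: real
      using zero_le_power2[of "x1 * y2 - x2 * y1"] by (simp add: power2_eq_square algebra_simps)
    have "(\<bar>a\<bar> * \<bar>\<alpha> * nrm w\<bar> + (\<bar>b\<bar> * M) * nrm z')\<^sup>2
        \<le> (\<bar>a\<bar>\<^sup>2 + (\<bar>b\<bar> * M)\<^sup>2) * (\<bar>\<alpha> * nrm w\<bar>\<^sup>2 + (nrm z')\<^sup>2)" by (rule cs2)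
    also have "\<dots> = (sqrt (a\<^sup>2 + b\<^sup>2 * M\<^sup>2) * nrm z)\<^sup>2"
      by (simp add: power_mult_distrib nz)
    finally show "(\<bar>a\<bar> * \<bar>\<alpha> * nrm w\<bar> + (\<bar>b\<bar> * M) * nrm z')\<^sup>2 \<le> (sqrt (a\<^sup>2 + b\<^sup>2 * M\<^sup>2) * nrm z)\<^sup>2" .
  qed (use wz in auto)
  finally show ?thesis by (simp add: algebra_simps)
qed

text \<open>Let \<open>g\<close> and \<open>S\<close> be the symmetric and the skew part of \<open>B\<close>. By coercivity \<open>g\<close> is a semi-inner
  product whose semi-norm is equivalent to the given one. For \<open>t > 0\<close> the solutions are the fixed points of the map
  \<open>T\<close> that sends \<open>w\<close> to the minimiser for the functional \<open>z \<mapsto> g w z - t * (B w z - F z)\<close>, and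
  \<open>skew_perturbation_bound\<close> makes \<open>T\<close> a contraction.\<close>

theorem Lions_Stampacchia:
  assumes K: "K \<subseteq> V" "K \<noteq> {}" "convex K" "complete_on K"
    and B: "bilinear_form_on V B"
      "\<And>u v. u \<in> V \<Longrightarrow> v \<in> V \<Longrightarrow> \<bar>B u v\<bar> \<le> C * nrm u * nrm v"
      "\<And>v. v \<in> V \<Longrightarrow> \<nu> * (nrm v)\<^sup>2 \<le> B v v" "0 < \<nu>" "0 < C"
    and F: "linear_form_on V F" "\<And>v. v \<in> V \<Longrightarrow> \<bar>F v\<bar> \<le> c * nrm v" "0 \<le> c"
  shows "\<exists>u\<in>K. \<forall>v\<in>K. F (v - u) \<le> B u (v - u)"
proof -
  have KV: "v \<in> V" if "v \<in> K" for v using that K by auto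
  note Bs = bilinear_simps[OF B(1)]
  define g where "g u v = (B u v + B v u) / 2" for u v
  define S where "S u v = (B u v - B v u) / 2" for u v
  have Bpos: "0 \<le> B v v" if "v \<in> V" for v
    using B(3)[OF that] B(4) by (smt (verit) mult_nonneg_nonneg zero_le_power2)
  interpret g: semi_inner_space V g
  proof
    show "subspace V" by (rule subsp)
    show "bilinear_form_on V g"
      unfolding bilinear_form_on_def linear_form_on_def g_def
      by (auto simp: Bs field_simps)
    show "g u v = g v u" for u v by (simp add: g_def)
    show "0 \<le> g u u" if "u \<in> V" for u using Bpos[OF that] by (simp add: g_def)
  qed
  have gn: "g.nrm v = sqrt (B v v)" for v by (simp add: g.nrm_def g_def)
  have n_le: "sqrt \<nu> * nrm v \<le> g.nrm v" if "v \<in> V" for v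
  proof -
    have "sqrt (\<nu> * (nrm v)\<^sup>2) \<le> sqrt (B v v)" using B(3)[OF that] by simp
    then show ?thesis using that by (simp add: gn real_sqrt_mult)
  qed
  have n_ge: "g.nrm v \<le> sqrt C * nrm v" if "v \<in> V" for v
  proof -
    have "sqrt (B v v) \<le> sqrt (C * (nrm v)\<^sup>2)"
      using B(2)[OF that that] by (simp add: power2_eq_square mult.assoc)
    then show ?thesis using that by (simp add: gn real_sqrt_mult)
  qed
  have n_le': "nrm v \<le> g.nrm v / sqrt \<nu>" if "v \<in> V" for v
    using n_le[OF that] B(4) by (simp add: field_simps)
  have complete: "g.complete_on K"
    unfolding g.complete_on_def
  proof (intro allI impI)
    fix s :: "nat \<Rightarrow> 'v"
    assume s: "\<forall>n. s n \<in> K" and c: "\<forall>\<epsilon>>0. \<exists>N. \<forall>m\<ge>N. \<forall>n\<ge>N. g.nrm (s m - s n) < \<epsilon>"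
    have V: "s m - s n \<in> V" for m n using s KV by auto
    have "\<exists>N. \<forall>m\<ge>N. \<forall>n\<ge>N. nrm (s m - s n) < \<epsilon>" if "\<epsilon> > 0" for \<epsilon>
    proof -
      obtain N where N: "\<forall>m\<ge>N. \<forall>n\<ge>N. g.nrm (s m - s n) < sqrt \<nu> * \<epsilon>"
        using c B(4) \<open>\<epsilon> > 0\<close> by (meson mult_pos_pos real_sqrt_gt_zero)
      have "nrm (s m - s n) < \<epsilon>" if "m \<ge> N" "n \<ge> N" for m n
      proof -
        have "sqrt \<nu> * nrm (s m - s n) < sqrt \<nu> * \<epsilon>"
          using n_le[OF V[of m n]] N that by (meson le_less_trans)
        then show ?thesis using B(4) by simp
      qed
      then show ?thesis by blast
    qed
    with K(4) s obtain u where u: "u \<in> K" "(\<lambda>n. nrm (s n - u)) \<longlonglongrightarrow> 0"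
      unfolding complete_on_def by blast
    have "(\<lambda>n. g.nrm (s n - u)) \<longlonglongrightarrow> 0"
    proof (rule tendsto_sandwich[where f = "\<lambda>_. 0"])
      show "(\<lambda>n. sqrt C * nrm (s n - u)) \<longlonglongrightarrow> 0" using tendsto_mult_left[OF u(2), of "sqrt C"] by simp
      show "\<forall>\<^sub>F n in sequentially. 0 \<le> g.nrm (s n - u)" using s u(1) KV by simp
      show "\<forall>\<^sub>F n in sequentially. g.nrm (s n - u) \<le> sqrt C * nrm (s n - u)" using n_ge s u(1) KV by simp
    qed simp
    then show "\<exists>u\<in>K. (\<lambda>n. g.nrm (s n - u)) \<longlonglongrightarrow> 0" using u(1) by blast
  qed
  have S: "bilinear_form_on V S"
    unfolding bilinear_form_on_def linear_form_on_def S_def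
    by (auto simp: Bs field_simps)
  define M where "M = C / \<nu>"
  have M0: "0 \<le> M" using B(4,5) by (simp add: M_def)
  have S_bound: "\<bar>S w z\<bar> \<le> M * (g.nrm w * g.nrm z)" if "w \<in> V" "z \<in> V" for w z
  proof -
    have "\<bar>S w z\<bar> \<le> C * (nrm w * nrm z)"
      using B(2)[OF that] B(2)[OF that(2,1)] unfolding S_def by (simp add: mult_ac)
    also have "\<dots> \<le> C * (g.nrm w / sqrt \<nu> * (g.nrm z / sqrt \<nu>))"
      using B(4,5) that n_le' by (intro mult_left_mono mult_mono) auto
    finally show ?thesis using B(4) by (simp add: M_def)
  qed
  \<comment> \<open>This value minimises \<open>(1 - t)\<^sup>2 + t\<^sup>2 * M\<^sup>2\<close>, with minimum \<open>1 - t\<close>.\<close>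
  define t where "t = 1 / (1 + M\<^sup>2)"
  define k where "k = sqrt ((1 - t)\<^sup>2 + (- t)\<^sup>2 * M\<^sup>2)"
  have Mp: "1 + M\<^sup>2 > 0" by (simp add: add_pos_nonneg)
  have t0: "0 < t" using Mp by (simp add: t_def)
  have "(1 - t)\<^sup>2 + (- t)\<^sup>2 * M\<^sup>2 = 1 - 2 * t + t\<^sup>2 * (1 + M\<^sup>2)"
    by (simp add: power2_eq_square algebra_simps)
  also have "t\<^sup>2 * (1 + M\<^sup>2) = t" using Mp by (simp add: t_def power2_eq_square)
  finally have keq: "(1 - t)\<^sup>2 + (- t)\<^sup>2 * M\<^sup>2 = 1 - t" by simp
  have k_eq: "k = sqrt (1 - t)" by (simp only: k_def keq)
  have "t \<le> 1" using Mp by (simp add: t_def)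
  then have k: "0 \<le> k" "k < 1" using t0 by (simp_all add: k_eq)
  have contr: "\<bar>(1 - t) * g w z + (- t) * S w z\<bar> \<le> k * (g.nrm w * g.nrm z)"
    if "w \<in> V" "z \<in> V" for w z
    unfolding k_def by (rule g.skew_perturbation_bound[OF S _ S_bound M0 that]) (auto simp: S_def)
  have Beq: "B u v = g u v + S u v" for u v by (simp add: g_def S_def field_simps)
  define G where "G w z = g w z - t * (B w z - F z)" for w z
  have G_lin: "linear_form_on V (G w)" if "w \<in> V" for w
    using that unfolding linear_form_on_def G_def
    by (auto simp: Bs g.ip_simps form_simps[OF F(1)] algebra_simps)
  have G_bdd: "\<bar>G w z\<bar> \<le> (k * g.nrm w + t * (c / sqrt \<nu>)) * g.nrm z" if "w \<in> V" "z \<in> V" for w z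
  proof -
    have "G w z = ((1 - t) * g w z + (- t) * S w z) + t * F z"
      unfolding G_def Beq by (simp add: algebra_simps)
    moreover have "\<bar>t * F z\<bar> \<le> t * (c * (g.nrm z / sqrt \<nu>))"
    proof -
      have "\<bar>F z\<bar> \<le> c * (g.nrm z / sqrt \<nu>)"
        using F(2)[OF that(2)] mult_left_mono[OF n_le'[OF that(2)] F(3)] by linarith
      from mult_left_mono[OF this, of t] show ?thesis using t0 by (simp add: abs_mult)
    qed
    ultimately have "\<bar>G w z\<bar> \<le> k * (g.nrm w * g.nrm z) + t * (c * (g.nrm z / sqrt \<nu>))"
      using contr[OF that] by linarith
    then show ?thesis by (simp add: algebra_simps)
  qed
  have "\<exists>u\<in>K. \<forall>v\<in>K. G w (v - u) \<le> g u (v - u)" if "w \<in> K" for w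
    using g.minimizer_exists[OF K(1-3) complete G_lin G_bdd] KV[OF that] by blast
  then obtain T where T: "\<And>w. w \<in> K \<Longrightarrow> T w \<in> K"
    "\<And>w v. w \<in> K \<Longrightarrow> v \<in> K \<Longrightarrow> G w (v - T w) \<le> g (T w) (v - T w)" by metis
  have T_contr: "g.nrm (T w1 - T w2) \<le> k * g.nrm (w1 - w2)" if "w1 \<in> K" "w2 \<in> K" for w1 w2
  proof -
    let ?z = "T w1 - T w2" and ?w = "w1 - w2"
    have V: "T w1 \<in> V" "T w2 \<in> V" "w1 \<in> V" "w2 \<in> V" "?z \<in> V" "?w \<in> V" using that T(1) KV by auto
    have 1: "G w1 (T w2 - T w1) \<le> g (T w1) (T w2 - T w1)" "G w2 ?z \<le> g (T w2) ?z"
      using T that by auto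
    have "G w1 (T w2 - T w1) = - G w1 ?z" "g (T w1) (T w2 - T w1) = - g (T w1) ?z"
      using V form_simps(2)[OF G_lin[OF V(3)]] by (auto simp: g.ip_simps)
    then have "g (T w1) ?z - g (T w2) ?z \<le> G w1 ?z - G w2 ?z" using 1 by linarith
    moreover have "g (T w1) ?z - g (T w2) ?z = g ?z ?z" using V by (simp add: g.ip_simps)
    moreover have "G w1 ?z - G w2 ?z = (1 - t) * g ?w ?z + (- t) * S ?w ?z"
      using V unfolding G_def Beq by (simp add: g.ip_simps bilinear_simps[OF S] algebra_simps)
    ultimately have "(g.nrm ?z)\<^sup>2 \<le> k * (g.nrm ?w * g.nrm ?z)"
      using contr[OF V(6,5)] V by (simp add: g.nrm_sq)
    then have "g.nrm ?z * g.nrm ?z \<le> (k * g.nrm ?w) * g.nrm ?z" by (simp add: power2_eq_square mult_ac)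
    then show ?thesis
      using g.nrm_nonneg[OF V(5)] k(1) g.nrm_nonneg[OF V(6)]
      by (metis mult_le_cancel_right mult_nonneg_nonneg order_le_less)
  qed
  obtain u where u: "u \<in> K" "g.nrm (T u - u) = 0"
    using g.contraction_fixed_point[OF K(1,2) complete T(1) k T_contr] by blast
  have V: "u \<in> V" "T u \<in> V" "T u - u \<in> V" using u(1) T(1) KV by auto
  have "F (v - u) \<le> B u (v - u)" if "v \<in> K" for v
  proof -
    have vV: "v \<in> V" "v - T u \<in> V" using that KV V by auto
    have "G u (v - T u) \<le> g (T u) (v - T u)" using T u(1) that by auto
    moreover have "g (T u) (v - T u) = g u (v - T u)"
      using g.Cauchy_Schwarz[OF V(3) vV(2)] u(2) V vV by (simp add: g.ip_simps)
    ultimately have "0 \<le> t * (B u (v - T u) - F (v - T u))" unfolding G_def by linarith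
    then have "F (v - T u) \<le> B u (v - T u)" using t0 by (simp add: zero_le_mult_iff)
    moreover have n0: "nrm (T u - u) = 0" using n_le'[OF V(3)] u(2) nrm_nonneg[OF V(3)] by simp
    moreover have "B u (T u - u) = 0" using B(2)[OF V(1,3)] n0 by simp
    moreover have "F (T u - u) = 0" using F(2)[OF V(3)] n0 by simp
    ultimately show ?thesis
      using V vV by (simp add: Bs form_simps[OF F(1)])
  qed
  then show ?thesis using u(1) by blast
qed

end

section \<open>Smooth bump functions on boxes\<close>

lemma Ck_upto_continuous: "Ck_upto k U T f \<Longrightarrow> continuous_on T f"
  by (cases k) auto

lemma Ck_upto_SucE:
  assumes "Ck_upto (Suc k) U T f"
  obtains fx fy where
    "\<And>p. p \<in> U \<Longrightarrow> (f has_derivative (\<lambda>h. fx p * fst h + fy p * snd h)) (at p)"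
    "Ck_upto k U T fx" "Ck_upto k U T fy"
  using assms unfolding Ck_upto.simps by blast

lemma Ck_upto_SucD: "Ck_upto (Suc k) U T f \<Longrightarrow> Ck_upto k U T f"
proof (induction k arbitrary: f)
  case (Suc k)
  from Suc.prems have c: "continuous_on T f" by (rule Ck_upto_continuous)
  obtain fx fy where "\<And>p. p \<in> U \<Longrightarrow> (f has_derivative (\<lambda>h. fx p * fst h + fy p * snd h)) (at p)"
    "Ck_upto (Suc k) U T fx" "Ck_upto (Suc k) U T fy"
    using Ck_upto_SucE[OF Suc.prems] by blast
  with Suc.IH c show ?case unfolding Ck_upto.simps(2)[of k U T f] by blast
qed simp

lemma Ck_upto_const: "Ck_upto k U T (\<lambda>_. c)"
proof (induction k arbitrary: c)
  case (Suc k)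
  have "((\<lambda>_. c) has_derivative (\<lambda>h. 0 * fst h + 0 * snd h)) (at p)" for p :: "real \<times> real"
    by (auto intro!: derivative_eq_intros)
  with Suc show ?case
    by (auto intro!: exI[of _ "\<lambda>_. 0"])
qed simp

lemma Ck_upto_add:
  "Ck_upto k U T f \<Longrightarrow> Ck_upto k U T g \<Longrightarrow> Ck_upto k U T (\<lambda>p. f p + g p)"
proof (induction k arbitrary: f g)
  case (Suc k)
  obtain fx fy where
    f: "\<And>p. p \<in> U \<Longrightarrow> (f has_derivative (\<lambda>h. fx p * fst h + fy p * snd h)) (at p)"
      "Ck_upto k U T fx" "Ck_upto k U T fy"
    using Ck_upto_SucE[OF Suc.prems(1)] by blast
  obtain gx gy where
    g: "\<And>p. p \<in> U \<Longrightarrow> (g has_derivative (\<lambda>h. gx p * fst h + gy p * snd h)) (at p)"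
      "Ck_upto k U T gx" "Ck_upto k U T gy"
    using Ck_upto_SucE[OF Suc.prems(2)] by blast
  have "((\<lambda>p. f p + g p) has_derivative (\<lambda>h. (fx p + gx p) * fst h + (fy p + gy p) * snd h)) (at p)"
    if "p \<in> U" for p
    by (rule has_derivative_eq_rhs[OF has_derivative_add[OF f(1)[OF that] g(1)[OF that]]])
      (auto simp: algebra_simps)
  moreover have "Ck_upto k U T (\<lambda>p. fx p + gx p)" "Ck_upto k U T (\<lambda>p. fy p + gy p)"
    using Suc.IH f(2,3) g(2,3) by blast+
  moreover have "continuous_on T (\<lambda>p. f p + g p)"
    using Suc.prems by (intro continuous_on_add Ck_upto_continuous)
  ultimately show ?case
    unfolding Ck_upto.simps by (intro conjI exI[of _ "\<lambda>p. fx p + gx p"] exI[of _ "\<lambda>p. fy p + gy p"]) auto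
qed (auto intro: continuous_intros)

lemma Ck_upto_mult:
  "Ck_upto k U T f \<Longrightarrow> Ck_upto k U T g \<Longrightarrow> Ck_upto k U T (\<lambda>p. f p * g p)"
proof (induction k arbitrary: f g)
  case (Suc k)
  obtain fx fy where
    f: "\<And>p. p \<in> U \<Longrightarrow> (f has_derivative (\<lambda>h. fx p * fst h + fy p * snd h)) (at p)"
      "Ck_upto k U T fx" "Ck_upto k U T fy"
    using Ck_upto_SucE[OF Suc.prems(1)] by blast
  obtain gx gy where
    g: "\<And>p. p \<in> U \<Longrightarrow> (g has_derivative (\<lambda>h. gx p * fst h + gy p * snd h)) (at p)"
      "Ck_upto k U T gx" "Ck_upto k U T gy"
    using Ck_upto_SucE[OF Suc.prems(2)] by blast
  have fg: "Ck_upto k U T f" "Ck_upto k U T g" using Suc.prems Ck_upto_SucD by blast+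
  let ?x = "\<lambda>p. f p * gx p + fx p * g p" and ?y = "\<lambda>p. f p * gy p + fy p * g p"
  have "((\<lambda>p. f p * g p) has_derivative (\<lambda>h. ?x p * fst h + ?y p * snd h)) (at p)" if "p \<in> U" for p
    by (rule has_derivative_eq_rhs[OF has_derivative_mult[OF f(1)[OF that] g(1)[OF that]]])
      (auto simp: algebra_simps)
  moreover have "Ck_upto k U T ?x" "Ck_upto k U T ?y"
    using Suc.IH fg f(2,3) g(2,3) by (auto intro!: Ck_upto_add)
  moreover have "continuous_on T (\<lambda>p. f p * g p)"
    using Suc.prems by (intro continuous_on_mult Ck_upto_continuous)
  ultimately show ?case
    unfolding Ck_upto.simps by (intro conjI exI[of _ ?x] exI[of _ ?y]) auto
qed (auto intro: continuous_intros)

text \<open>All partial derivatives of a function of one affine variable are of the same shape, up to a constant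
  factor; the factor \<open>d\<close> and the order \<open>n\<close> are there for the induction.\<close>

lemma Ck_upto_comp_affine:
  assumes G: "\<And>n x. (G n has_real_derivative G (Suc n) x) (at x)"
  shows "Ck_upto k U T (\<lambda>p. d * G n (a * fst p + b * snd p + c))"
proof (induction k arbitrary: d n)
  case 0
  have "continuous_on UNIV (G n)"
    using G DERIV_isCont continuous_at_imp_continuous_on by blast
  then show ?case
    by (auto intro!: continuous_intros continuous_on_compose2[of UNIV "G n"])
next
  case (Suc k)
  let ?l = "\<lambda>p::real \<times> real. a * fst p + b * snd p + c"
  have der: "((\<lambda>p. d * G n (?l p)) has_derivative
      (\<lambda>h. (d * a * G (Suc n) (?l p)) * fst h + (d * b * G (Suc n) (?l p)) * snd h)) (at p)" for p
  proof -
    have "(?l has_derivative (\<lambda>h. a * fst h + b * snd h)) (at p)"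
      by (auto intro!: derivative_eq_intros)
    from has_derivative_compose[OF this has_field_derivative_imp_has_derivative[OF G]]
    have "((\<lambda>p. G n (?l p)) has_derivative (\<lambda>h. G (Suc n) (?l p) * (a * fst h + b * snd h))) (at p)"
      by simp
    from has_derivative_mult_right[OF this, of d] show ?thesis by (simp add: algebra_simps)
  qed
  have "continuous_on T (\<lambda>p. d * G n (?l p))"
    by (intro continuous_at_imp_continuous_on ballI has_derivative_continuous[OF der])
  moreover have "Ck_upto k U T (\<lambda>p. d * a * G (Suc n) (?l p))"
    "Ck_upto k U T (\<lambda>p. d * b * G (Suc n) (?l p))"
    using Suc[of "d * a" "Suc n"] Suc[of "d * b" "Suc n"] by auto
  ultimately show ?case
    unfolding Ck_upto.simps
    by (intro conjI exI[of _ "\<lambda>p. d * a * G (Suc n) (?l p)"]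
        exI[of _ "\<lambda>p. d * b * G (Suc n) (?l p)"] ballI der)
qed

text \<open>The classical smooth function that vanishes to infinite order at the origin. Its \<open>n\<close>-th derivative is
  a polynomial in \<open>1 / t\<close> times the function itself, and differentiating \<open>P (1 / t) * exp (- (1 / t))\<close>
  gives the recursion for the polynomials.\<close>

definition ramp :: "real \<Rightarrow> real" where
  "ramp t = (if t \<le> 0 then 0 else exp (- (1 / t)))"

primrec ramp_poly :: "nat \<Rightarrow> real poly" where
  "ramp_poly 0 = 1"
| "ramp_poly (Suc n) = [:0, 0, 1:] * (ramp_poly n - pderiv (ramp_poly n))"

definition ramp_deriv :: "nat \<Rightarrow> real \<Rightarrow> real" where
  "ramp_deriv n t = (if t \<le> 0 then 0 else poly (ramp_poly n) (1 / t) * exp (- (1 / t)))"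

lemma ramp_deriv_0: "ramp_deriv 0 = ramp"
  by (simp add: fun_eq_iff ramp_deriv_def ramp_def)

lemma poly_times_exp_minus_tendsto_0: "((\<lambda>s. poly p s * exp (- s)) \<longlongrightarrow> (0::real)) at_top"
proof -
  have "((\<lambda>s. \<Sum>i\<le>degree p. coeff p i * (s ^ i / exp s)) \<longlongrightarrow> (\<Sum>i\<le>degree p. coeff p i * 0)) at_top"
    by (intro tendsto_intros tendsto_power_div_exp_0)
  moreover have "(\<Sum>i\<le>degree p. coeff p i * (s ^ i / exp s)) = poly p s * exp (- s)" for s
    by (simp add: poly_altdef exp_minus sum_distrib_right divide_inverse mult.assoc)
  ultimately show ?thesis by simp
qed

lemma ramp_deriv_deriv: "(ramp_deriv n has_real_derivative ramp_deriv (Suc n) t) (at t)"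
proof -
  consider "t < 0" | "t > 0" | "t = 0" by linarith
  then show ?thesis
  proof cases
    case 1
    have "((\<lambda>_. 0) has_real_derivative 0) (at t)" by simp
    then show ?thesis
      by (rule DERIV_cong_ev[THEN iffD1, rotated -1])
        (use 1 in \<open>auto simp: ramp_deriv_def eventually_nhds intro!: exI[of _ "{..<0}"]\<close>)
  next
    case 2
    let ?p = "ramp_poly n"
    have "((\<lambda>t. poly ?p (1 / t) * exp (- (1 / t))) has_real_derivative
        poly ?p (1 / t) * (exp (- (1 / t)) * (1 / t\<^sup>2)) + (poly (pderiv ?p) (1 / t) * (- (1 / t\<^sup>2))) * exp (- (1 / t))) (at t)"
      using 2 by (auto intro!: derivative_eq_intros DERIV_chain2[of "poly ?p"] poly_DERIV
          simp: power2_eq_square field_simps)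
    also have "poly ?p (1 / t) * (exp (- (1 / t)) * (1 / t\<^sup>2)) + (poly (pderiv ?p) (1 / t) * (- (1 / t\<^sup>2))) * exp (- (1 / t))
       = ramp_deriv (Suc n) t"
      using 2 by (simp add: ramp_deriv_def power2_eq_square field_simps)
    finally show ?thesis
      by (rule DERIV_cong_ev[THEN iffD1, rotated -1])
        (use 2 in \<open>auto simp: ramp_deriv_def eventually_nhds intro!: exI[of _ "{0<..}"]\<close>)
  next
    case 3
    let ?q = "\<lambda>h. (ramp_deriv n (0 + h) - ramp_deriv n 0) / h"
    have "(?q \<longlongrightarrow> 0) (at_left 0)"
      by (rule tendsto_eventually) (auto simp: eventually_at_filter ramp_deriv_def)
    moreover have "(?q \<longlongrightarrow> 0) (at_right 0)"
    proof (rule Lim_transform_eventually)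
      have "((\<lambda>h. poly (pCons 0 (ramp_poly n)) (inverse h) * exp (- inverse h)) \<longlongrightarrow> 0) (at_right 0)"
        by (rule filterlim_compose[OF poly_times_exp_minus_tendsto_0 filterlim_inverse_at_top_right])
      then show "((\<lambda>h. poly (pCons 0 (ramp_poly n)) (inverse h) * exp (- inverse h)) \<longlongrightarrow> 0) (at_right 0)" .
      show "\<forall>\<^sub>F h in at_right 0. poly (pCons 0 (ramp_poly n)) (inverse h) * exp (- inverse h) = ?q h"
        by (auto simp: eventually_at_filter ramp_deriv_def field_simps)
    qed
    ultimately have "(?q \<longlongrightarrow> 0) (at 0)" by (simp add: filterlim_split_at)
    then show ?thesis using 3 by (simp add: DERIV_def ramp_deriv_def)
  qed
qed

lemma Ck_upto_ramp_affine: "Ck_upto k U T (\<lambda>p. ramp (a * fst p + b * snd p + c))"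
  using Ck_upto_comp_affine[of ramp_deriv k U T 1 0 a b c] ramp_deriv_deriv
  by (simp add: ramp_deriv_0)

lemma ramp_bounds: "0 \<le> ramp t" "ramp t \<le> 1"
  by (auto simp: ramp_def)

lemma ramp_nonpos: "t \<le> 0 \<Longrightarrow> ramp t = 0"
  by (simp add: ramp_def)

lemma ramp_scaled_tendsto: "t > 0 \<Longrightarrow> (\<lambda>n. ramp (real (Suc n) * t)) \<longlonglongrightarrow> 1"
proof -
  assume t: "t > 0"
  have "(\<lambda>n. exp (- (inverse (real (Suc n)) * (1 / t)))) \<longlonglongrightarrow> exp (- (0 * (1 / t)))"
    by (intro tendsto_intros LIMSEQ_inverse_real_of_nat)
  moreover have "exp (- (inverse (real (Suc n)) * (1 / t))) = ramp (real (Suc n) * t)" for n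
  proof -
    have "0 < real (Suc n) * t" using t by simp
    then show ?thesis by (simp add: ramp_def divide_inverse del: of_nat_Suc)
  qed
  ultimately show ?thesis by simp
qed

text \<open>Rescaling \<open>ramp\<close> by a large factor drives it to one at every positive argument. A product of four
  such factors, one for each side, is therefore supported in the closed box and converges boundedly
  to the indicator of the open box.\<close>

definition box_bump :: "real \<times> real \<Rightarrow> real \<times> real \<Rightarrow> nat \<Rightarrow> real \<times> real \<Rightarrow> real" where
  "box_bump a b n p =
     ramp (real (Suc n) * (fst p - fst a)) * ramp (real (Suc n) * (fst b - fst p)) *
     (ramp (real (Suc n) * (snd p - snd a)) * ramp (real (Suc n) * (snd b - snd p)))"

lemma box_pair: "p \<in> box a b \<longleftrightarrow> fst a < fst p \<and> fst p < fst b \<and> snd a < snd p \<and> snd p < snd (b::real\<times>real)"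
  by (auto simp: box_def Basis_prod_def inner_prod_def)

lemma box_bump_zero:
  assumes "p \<notin> box a b"
  shows "box_bump a b n p = 0"
proof -
  have r: "ramp (real (Suc n) * t) = 0" if "t \<le> 0" for t
    by (rule ramp_nonpos) (use that in \<open>auto intro: mult_nonneg_nonpos\<close>)
  from assms consider "fst p - fst a \<le> 0" | "fst b - fst p \<le> 0" | "snd p - snd a \<le> 0" | "snd b - snd p \<le> 0"
    unfolding box_pair by linarith
  then show ?thesis unfolding box_bump_def by cases (simp_all only: r mult_zero_left mult_zero_right)
qed

lemma box_bump_bound: "\<bar>box_bump a b n p\<bar> \<le> 1"
proof -
  have "0 \<le> box_bump a b n p" by (simp add: box_bump_def ramp_bounds)
  moreover have "box_bump a b n p \<le> 1"
    unfolding box_bump_def by (intro mult_le_one mult_nonneg_nonneg ramp_bounds)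
  ultimately show ?thesis by simp
qed

lemma box_bump_tendsto: "(\<lambda>n. box_bump a b n p) \<longlonglongrightarrow> indicator (box a b) p"
proof (cases "p \<in> box a b")
  case True
  then have "(\<lambda>n. box_bump a b n p) \<longlonglongrightarrow> 1 * 1 * (1 * 1)"
    unfolding box_bump_def by (intro tendsto_mult ramp_scaled_tendsto) (auto simp: box_pair)
  then show ?thesis using True by simp
qed (simp add: box_bump_zero)

lemma box_bump_test_function:
  assumes "cbox a b \<subseteq> U"
  shows "box_bump a b n \<in> Cinf_cpt U U"
proof -
  have sub: "closure {p. box_bump a b n p \<noteq> 0} \<subseteq> cbox a b"
  proof (rule closure_minimal)
    show "{p. box_bump a b n p \<noteq> 0} \<subseteq> cbox a b"
      using box_bump_zero box_subset_cbox by blast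
  qed (rule closed_cbox)
  then have "compact (closure {p. box_bump a b n p \<noteq> 0})"
    using bounded_subset[OF bounded_cbox] by (simp add: compact_eq_bounded_closed)
  moreover have "Ck_upto k U U (box_bump a b n)" for k
  proof -
    have 1: "Ck_upto k U U (\<lambda>p. ramp (N * (fst p - c)))" for N c
      using Ck_upto_ramp_affine[of k U U N 0 "- N * c"] by (simp add: right_diff_distrib)
    have 2: "Ck_upto k U U (\<lambda>p. ramp (N * (c - fst p)))" for N c
      using Ck_upto_ramp_affine[of k U U "- N" 0 "N * c"] by (simp add: right_diff_distrib)
    have 3: "Ck_upto k U U (\<lambda>p. ramp (N * (snd p - c)))" for N c
      using Ck_upto_ramp_affine[of k U U 0 N "- N * c"] by (simp add: right_diff_distrib)
    have 4: "Ck_upto k U U (\<lambda>p. ramp (N * (c - snd p)))" for N c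
      using Ck_upto_ramp_affine[of k U U 0 "- N" "N * c"] by (simp add: right_diff_distrib)
    show ?thesis
      unfolding box_bump_def[abs_def]
      by (rule Ck_upto_mult[OF Ck_upto_mult[OF 1 2] Ck_upto_mult[OF 3 4]])
  qed
  ultimately show ?thesis using order_trans[OF sub assms] by (simp add: Cinf_cpt_def)
qed

section \<open>Weak derivatives\<close>

lemma AE_lebesgue_on_iff:
  fixes S :: "'a::euclidean_space set"
  shows "open S \<Longrightarrow> (AE p in lebesgue_on S. P p) \<longleftrightarrow> (AE p in lebesgue. p \<in> S \<longrightarrow> P p)"
  by (subst AE_restrict_space_iff) auto

text \<open>Off the support the derivatives are known to vanish at points of \<open>U\<close> only, where they are genuine
  derivatives; on the rest of \<open>T\<close> the functions \<open>fx\<close> and \<open>fy\<close> are continuous extensions.\<close>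

lemma test_function_derivative:
  assumes "open U" "\<phi> \<in> Cinf_cpt U T"
  obtains S fx fy where "compact S" "S \<subseteq> T" "\<And>p. p \<notin> S \<Longrightarrow> \<phi> p = 0" "continuous_on T \<phi>"
    "\<And>p. p \<in> U \<Longrightarrow> (\<phi> has_derivative (\<lambda>h. fx p * fst h + fy p * snd h)) (at p)"
    "continuous_on T fx" "continuous_on T fy"
    "\<And>p. p \<in> U \<Longrightarrow> p \<notin> S \<Longrightarrow> fx p = 0" "\<And>p. p \<in> U \<Longrightarrow> p \<notin> S \<Longrightarrow> fy p = 0"
proof -
  define S where "S = closure {p. \<phi> p \<noteq> 0}"
  have S: "\<phi> p = 0" if "p \<notin> S" for p
    using that closure_subset[of "{p. \<phi> p \<noteq> 0}"] by (auto simp: S_def)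
  have S': "compact S" "S \<subseteq> T" using assms(2) by (auto simp: Cinf_cpt_def S_def)
  have Ck: "Ck_upto (Suc 0) U T \<phi>" using assms(2) by (auto simp: Cinf_cpt_def simp del: Ck_upto.simps)
  obtain fx fy where
    f: "\<And>p. p \<in> U \<Longrightarrow> (\<phi> has_derivative (\<lambda>h. fx p * fst h + fy p * snd h)) (at p)"
      "Ck_upto 0 U T fx" "Ck_upto 0 U T fy" using Ck_upto_SucE[OF Ck] by blast
  have "fx p = 0 \<and> fy p = 0" if "p \<in> U" "p \<notin> S" for p
  proof -
    have "(\<phi> has_derivative (\<lambda>_. 0)) (at p)"
      by (rule has_derivative_transform_within_open[of "\<lambda>_. 0" _ _ _ "- S"])
        (use S that compact_imp_closed[OF S'(1)] in \<open>auto simp: open_Compl\<close>)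
    from has_derivative_unique[OF this f(1)[OF that(1)]]
    have e: "0 = fx p * fst h + fy p * snd h" for h by meson
    show ?thesis using e[of "(1, 0)"] e[of "(0, 1)"] by simp
  qed
  then show ?thesis
    using that[of S fx fy] S S' f Ck_upto_continuous[OF Ck] by simp
qed

lemma test_function_directional_derivative:
  assumes "open U" "\<phi> \<in> Cinf_cpt U U"
  obtains S where "compact S" "S \<subseteq> U" "\<And>p. p \<notin> S \<Longrightarrow> \<phi> p = 0" "continuous_on U \<phi>"
    "continuous_on U (\<lambda>p. frechet_derivative \<phi> (at p) e)"
    "\<And>p. p \<in> U \<Longrightarrow> p \<notin> S \<Longrightarrow> frechet_derivative \<phi> (at p) e = 0"
proof -
  obtain S fx fy where S: "compact S" "S \<subseteq> U" "\<And>p. p \<notin> S \<Longrightarrow> \<phi> p = 0" "continuous_on U \<phi>"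
    "\<And>p. p \<in> U \<Longrightarrow> (\<phi> has_derivative (\<lambda>h. fx p * fst h + fy p * snd h)) (at p)"
    "continuous_on U fx" "continuous_on U fy"
    "\<And>p. p \<in> U \<Longrightarrow> p \<notin> S \<Longrightarrow> fx p = 0" "\<And>p. p \<in> U \<Longrightarrow> p \<notin> S \<Longrightarrow> fy p = 0"
    by (rule test_function_derivative[OF assms]) (rule that)
  have fr: "frechet_derivative \<phi> (at p) e = fx p * fst e + fy p * snd e" if "p \<in> U" for p
    using frechet_derivative_at[OF S(5)[OF that], symmetric] by simp
  have "continuous_on U (\<lambda>p. fx p * fst e + fy p * snd e)"
    by (intro continuous_intros S)
  then have "continuous_on U (\<lambda>p. frechet_derivative \<phi> (at p) e)"
    by (rule continuous_on_eq) (simp add: fr)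
  then show ?thesis using that[of S] S fr by simp
qed

lemma loc_integrable_mult_cpt:
  assumes "loc_integrable U u" "continuous_on U \<eta>" "compact S" "S \<subseteq> U"
    "\<And>p. p \<in> U \<Longrightarrow> p \<notin> S \<Longrightarrow> \<eta> p = 0"
  shows "set_integrable lebesgue U (\<lambda>p. u p * \<eta> p)"
proof -
  have \<eta>: "continuous_on S \<eta>" using assms by (meson continuous_on_subset)
  have S: "S \<in> sets lebesgue" using lmeasurable_compact[OF assms(3)] by (rule fmeasurableD)
  have u: "u absolutely_integrable_on S" using assms(1,3,4) by (simp add: loc_integrable_def)
  have "(\<lambda>p. \<eta> p * u p) absolutely_integrable_on S"
  proof (rule absolutely_integrable_bounded_measurable_product[OF bilinear_times])
    show "\<eta> \<in> borel_measurable (lebesgue_on S)"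
      using \<eta> S by (rule continuous_imp_measurable_on_sets_lebesgue)
    show "bounded (\<eta> ` S)"
      using compact_continuous_image[OF \<eta> assms(3)] compact_imp_bounded by blast
  qed (use S u in auto)
  moreover have "(\<lambda>p. indicat_real S p *\<^sub>R (\<eta> p * u p)) = (\<lambda>p. indicat_real U p *\<^sub>R (u p * \<eta> p))"
    using assms(4,5) by (auto simp: fun_eq_iff indicator_def)
  ultimately show ?thesis unfolding set_integrable_def by simp
qed

lemma continuous_loc_integrable:
  assumes "continuous_on U u"
  shows "loc_integrable U u"
  unfolding loc_integrable_def
proof (intro allI impI)
  fix K assume K: "compact K \<and> K \<subseteq> U"
  then have "integrable lborel (\<lambda>x. indicator K x *\<^sub>R u x)"
    using assms by (intro borel_integrable_compact) (auto intro: continuous_on_subset)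
  then show "u absolutely_integrable_on K"
    unfolding set_integrable_def
    by (subst integrable_completion) auto
qed

text \<open>Dominated convergence along the bump functions of the box.\<close>

lemma integral_zero_on_boxes:
  assumes "loc_integrable U g" "\<And>\<phi>. \<phi> \<in> Cinf_cpt U U \<Longrightarrow> (LINT p:U|lebesgue. g p * \<phi> p) = 0"
    and sub: "cbox a b \<subseteq> U"
  shows "integral (cbox a b) g = 0"
proof -
  have I: "set_integrable lebesgue (cbox a b) g"
    using assms(1) sub by (simp add: loc_integrable_def)
  let ?f = "\<lambda>n p. indicat_real U p *\<^sub>R (g p * box_bump a b n p)"
  have eq: "?f n p = box_bump a b n p * (indicat_real (cbox a b) p *\<^sub>R g p)" for n p
    using sub box_subset_cbox[of a b] box_bump_zero[of p a b n]
    by (auto simp: indicator_def)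
  have "(\<lambda>n. integral\<^sup>L lebesgue (?f n)) \<longlonglongrightarrow> (LINT p|lebesgue. indicat_real (box a b) p *\<^sub>R g p)"
  proof (rule integral_dominated_convergence)
    have g: "(\<lambda>p. indicat_real (cbox a b) p *\<^sub>R g p) \<in> borel_measurable lebesgue"
      using I unfolding set_integrable_def by (rule borel_measurable_integrable)
    have "continuous_on UNIV (box_bump a b n)" for n
      using box_bump_test_function[of a b UNIV n] Ck_upto_continuous[of 0] unfolding Cinf_cpt_def by blast
    then have b: "box_bump a b n \<in> borel_measurable lebesgue" for n
      by (intro measurable_completion) (simp add: borel_measurable_continuous_onI)
    show "?f n \<in> borel_measurable lebesgue" for n
      unfolding eq using b g by (rule borel_measurable_times)
    have e: "indicat_real (box a b) p *\<^sub>R g p = indicat_real (box a b) p * (indicat_real (cbox a b) p *\<^sub>R g p)" for p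
      using box_subset_cbox[of a b] by (auto simp: indicator_def)
    show "(\<lambda>p. indicat_real (box a b) p *\<^sub>R g p) \<in> borel_measurable lebesgue"
      unfolding e using g by (intro borel_measurable_times borel_measurable_indicator) auto
    show "integrable lebesgue (\<lambda>p. norm (indicat_real (cbox a b) p *\<^sub>R g p))"
      using I unfolding set_integrable_def by (rule integrable_norm)
    show "AE p in lebesgue. (\<lambda>n. ?f n p) \<longlonglongrightarrow> indicat_real (box a b) p *\<^sub>R g p"
      unfolding e eq by (intro always_eventually allI tendsto_mult box_bump_tendsto tendsto_const)
    show "AE p in lebesgue. norm (?f n p) \<le> norm (indicat_real (cbox a b) p *\<^sub>R g p)" for n
      unfolding eq norm_mult[of "box_bump a b n _"] real_norm_def[of "box_bump a b n _"]
      by (intro always_eventually allI mult_left_le_one_le box_bump_bound norm_ge_zero abs_ge_zero)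
  qed
  moreover have "integral\<^sup>L lebesgue (?f n) = 0" for n
    using assms(2)[OF box_bump_test_function[OF sub], of n] by (simp add: set_lebesgue_integral_def)
  ultimately have "(LINT p|lebesgue. indicat_real (box a b) p *\<^sub>R g p) = 0"
    using LIMSEQ_unique[OF _ tendsto_const] by simp
  moreover have "set_integrable lebesgue (box a b) g"
    by (rule set_integrable_subset[OF I]) (auto simp: box_subset_cbox)
  ultimately have "integral (box a b) g = 0"
    using set_lebesgue_integral_eq_integral(2) by (metis set_lebesgue_integral_def)
  then show ?thesis by (simp add: integral_open_interval)
qed

text \<open>Since the integral over every box inside \<open>U\<close> vanishes, so do the averages over small boxes at each
  point, and almost everywhere these converge to the value of the function. The differentiation theorem
  asks for integrability on all boxes of the plane; it is applied to the restriction of \<open>g\<close> to one box at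
  a time, and countably many boxes cover \<open>U\<close>.\<close>

lemma fundamental_lemma_calculus_of_variations:
  assumes "open U" "loc_integrable U g"
    and test: "\<And>\<phi>. \<phi> \<in> Cinf_cpt U U \<Longrightarrow> (LINT p:U|lebesgue. g p * \<phi> p) = 0"
  shows "AE p in lebesgue_on U. g p = 0"
proof -
  have box0: "AE p in lebesgue. p \<in> cbox a b \<longrightarrow> g p = 0" if sub: "cbox a b \<subseteq> U" for a b
  proof -
    let ?f = "\<lambda>p. if p \<in> cbox a b then g p else 0"
    have "g absolutely_integrable_on cbox a b" using assms(2) sub by (simp add: loc_integrable_def)
    then have "g integrable_on cbox a b" by (rule set_lebesgue_integral_eq_integral(1))
    then have "?f integrable_on UNIV" by (simp add: integrable_restrict_UNIV)
    then have "?f integrable_on cbox c d" for c d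
      by (rule integrable_on_subcbox) simp
    then obtain N where N: "negligible N" and
      lim: "\<And>p e. p \<notin> N \<Longrightarrow> 0 < e \<Longrightarrow> \<exists>d>0. \<forall>h. 0 < h \<and> h < d \<longrightarrow>
         norm (integral (cbox p (p + h *\<^sub>R One)) ?f /\<^sub>R h ^ DIM(real \<times> real) - ?f p) < e"
      by (rule integrable_ccontinuous_explicit) blast
    have zero: "g p = 0" if p: "p \<in> box a b" "p \<notin> N" for p
    proof (rule ccontr)
      assume "g p \<noteq> 0"
      then obtain d where d: "d > 0" "\<And>h. 0 < h \<Longrightarrow> h < d \<Longrightarrow>
          norm (integral (cbox p (p + h *\<^sub>R One)) ?f /\<^sub>R h ^ DIM(real \<times> real) - ?f p) < norm (g p)"
        using lim[OF p(2), of "norm (g p)"] by auto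
      have "((\<lambda>h::real. p + h *\<^sub>R One) \<longlongrightarrow> p + 0 *\<^sub>R One) (at_right 0)"
        by (intro tendsto_intros)
      then have "\<forall>\<^sub>F h in at_right (0::real). p + h *\<^sub>R One \<in> box a b"
        using p(1) by (intro topological_tendstoD) (auto simp: open_box)
      moreover have "\<forall>\<^sub>F h in at_right (0::real). 0 < h \<and> h < d"
        using d(1) by (auto simp: eventually_at_right_field)
      ultimately obtain h where h: "p + h *\<^sub>R One \<in> box a b" "0 < h" "h < d"
        using eventually_happens[OF eventually_conj, of _ "at_right (0::real)"] by fastforce
      have cs: "cbox p (p + h *\<^sub>R One) \<subseteq> cbox a b"
        using p(1) h(1) box_subset_cbox by (intro subset_box_imp) (auto simp: mem_box intro: less_imp_le)
      have "integral (cbox p (p + h *\<^sub>R One)) ?f = integral (cbox p (p + h *\<^sub>R One)) g"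
        by (rule Henstock_Kurzweil_Integration.integral_cong) (use cs in auto)
      also have "\<dots> = 0"
        using integral_zero_on_boxes[OF assms(2) test] cs sub by blast
      finally show False using d(2)[OF h(2,3)] p(1) box_subset_cbox[of a b] by auto
    qed
    have "negligible (N \<union> (cbox a b - box a b))"
      using N negligible_frontier_interval by (rule negligible_Un)
    then have "AE p in lebesgue. p \<notin> N \<union> (cbox a b - box a b)"
      by (intro AE_not_in) (simp add: negligible_iff_null_sets)
    then show ?thesis by eventually_elim (use zero in blast)
  qed
  obtain D where D: "countable D" "D \<subseteq> Pow U" "\<And>X. X \<in> D \<Longrightarrow> \<exists>a b. X = cbox a b" "\<Union>D = U"
    using open_countable_Union_open_cbox[OF assms(1)] by metis
  have "AE p in lebesgue. \<forall>X\<in>D. p \<in> X \<longrightarrow> g p = 0"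
  proof (subst AE_ball_countable[OF D(1)], intro ballI)
    fix X assume "X \<in> D"
    then obtain a b where "X = cbox a b" "cbox a b \<subseteq> U" using D(2,3) by (metis PowD subsetD)
    then show "AE p in lebesgue. p \<in> X \<longrightarrow> g p = 0" using box0 by simp
  qed
  then have "AE p in lebesgue. p \<in> U \<longrightarrow> g p = 0"
    by eventually_elim (use D(4) in blast)
  then show ?thesis using AE_lebesgue_on_iff[OF assms(1)] by blast
qed

lemma loc_integrable_lincomb:
  assumes "loc_integrable U u" "loc_integrable U v"
  shows "loc_integrable U (\<lambda>p. a * u p + b * v p)"
  using assms unfolding loc_integrable_def
  by (auto intro!: set_integral_add set_integrable_mult_right)

lemma weak_deriv_integrable:
  assumes "open U" "has_weak_deriv U e u g" "\<phi> \<in> Cinf_cpt U U"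
  shows "set_integrable lebesgue U (\<lambda>p. u p * frechet_derivative \<phi> (at p) e)"
    "set_integrable lebesgue U (\<lambda>p. g p * \<phi> p)"
proof -
  obtain S where S: "compact S" "S \<subseteq> U" "\<And>p. p \<notin> S \<Longrightarrow> \<phi> p = 0" "continuous_on U \<phi>"
    "continuous_on U (\<lambda>p. frechet_derivative \<phi> (at p) e)"
    "\<And>p. p \<in> U \<Longrightarrow> p \<notin> S \<Longrightarrow> frechet_derivative \<phi> (at p) e = 0"
    by (rule test_function_directional_derivative[OF assms(1,3)]) (rule that)
  show "set_integrable lebesgue U (\<lambda>p. u p * frechet_derivative \<phi> (at p) e)"
    "set_integrable lebesgue U (\<lambda>p. g p * \<phi> p)"
    using assms(2) S by (auto intro!: loc_integrable_mult_cpt[of U _ _ S] simp: has_weak_deriv_def)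
qed

lemma has_weak_deriv_lincomb:
  assumes "open U" "has_weak_deriv U e u g" "has_weak_deriv U e v k"
  shows "has_weak_deriv U e (\<lambda>p. a * u p + b * v p) (\<lambda>p. a * g p + b * k p)"
  unfolding has_weak_deriv_def
proof (intro conjI ballI)
  show "loc_integrable U (\<lambda>p. a * u p + b * v p)" "loc_integrable U (\<lambda>p. a * g p + b * k p)"
    using assms by (auto intro!: loc_integrable_lincomb simp: has_weak_deriv_def)
  fix \<phi> assume \<phi>: "\<phi> \<in> Cinf_cpt U U"
  let ?d = "\<lambda>p. frechet_derivative \<phi> (at p) e"
  note i = weak_deriv_integrable[OF assms(1,2) \<phi>] weak_deriv_integrable[OF assms(1,3) \<phi>]
  have "(LINT p:U|lebesgue. (a * u p + b * v p) * ?d p) = (LINT p:U|lebesgue. a * (u p * ?d p) + b * (v p * ?d p))"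
    by (simp add: algebra_simps)
  also have "\<dots> = a * (LINT p:U|lebesgue. u p * ?d p) + b * (LINT p:U|lebesgue. v p * ?d p)"
    using i by (simp add: set_integral_add set_integrable_mult_right set_integral_mult_right)
  also have "\<dots> = - (a * (LINT p:U|lebesgue. g p * \<phi> p) + b * (LINT p:U|lebesgue. k p * \<phi> p))"
    using assms \<phi> by (simp add: has_weak_deriv_def)
  also have "a * (LINT p:U|lebesgue. g p * \<phi> p) + b * (LINT p:U|lebesgue. k p * \<phi> p)
      = (LINT p:U|lebesgue. a * (g p * \<phi> p) + b * (k p * \<phi> p))"
    using i by (simp add: set_integral_add set_integrable_mult_right set_integral_mult_right)
  also have "\<dots> = (LINT p:U|lebesgue. (a * g p + b * k p) * \<phi> p)"
    by (simp add: algebra_simps)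
  finally show "(LINT p:U|lebesgue. (a * u p + b * v p) * ?d p) = - (LINT p:U|lebesgue. (a * g p + b * k p) * \<phi> p)" .
qed

lemma has_weak_deriv_unique:
  assumes "open U" "has_weak_deriv U e u g" "has_weak_deriv U e u k"
  shows "AE p in lebesgue_on U. g p = k p"
proof -
  have w: "has_weak_deriv U e (\<lambda>p. 1 * u p + (-1) * u p) (\<lambda>p. 1 * g p + (-1) * k p)"
    by (rule has_weak_deriv_lincomb[OF assms])
  have "AE p in lebesgue_on U. 1 * g p + (-1) * k p = 0"
  proof (rule fundamental_lemma_calculus_of_variations[OF assms(1)])
    show "loc_integrable U (\<lambda>p. 1 * g p + (-1) * k p)" using w by (simp only: has_weak_deriv_def)
    fix \<phi> assume "\<phi> \<in> Cinf_cpt U U"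
    from w[unfolded has_weak_deriv_def, THEN conjunct2, THEN conjunct2, rule_format, OF this]
    show "(LINT p:U|lebesgue. (1 * g p + (-1) * k p) * \<phi> p) = 0" by simp
  qed
  then show ?thesis by simp
qed

text \<open>The operator \<open>weak_deriv\<close> is an arbitrary choice among the weak derivatives, so it becomes computable only
  up to null sets, through uniqueness.\<close>

lemma weak_deriv_AE_eq:
  assumes "open U" "has_weak_deriv U e u g"
  shows "has_weak_deriv U e u (weak_deriv U e u)" "AE p in lebesgue_on U. weak_deriv U e u p = g p"
proof -
  show 1: "has_weak_deriv U e u (weak_deriv U e u)"
    unfolding weak_deriv_def by (rule someI[of "has_weak_deriv U e u", OF assms(2)])
  show "AE p in lebesgue_on U. weak_deriv U e u p = g p"
    by (rule has_weak_deriv_unique[OF assms(1) 1 assms(2)])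
qed

lemma lborel_integral_translation:
  fixes h :: "'a::euclidean_space \<Rightarrow> real"
  assumes "integrable lborel h"
  shows "integrable lborel (\<lambda>p. h (p + c))" "(LINT p|lborel. h (p + c)) = (LINT p|lborel. h p)"
proof -
  have h: "h \<in> borel_measurable borel" using assms borel_measurable_integrable by fastforce
  have "integrable (distr lborel borel ((+) c)) h" using assms by (simp add: lborel_distr_plus)
  from integrable_distr[OF _ this] show "integrable lborel (\<lambda>p. h (p + c))"
    by (simp add: add.commute)
  have "(LINT p|lborel. h p) = (LINT p|distr lborel borel ((+) c). h p)" by (simp add: lborel_distr_plus)
  also have "\<dots> = (LINT p|lborel. h (c + p))" using h by (intro integral_distr) auto
  finally show "(LINT p|lborel. h (p + c)) = (LINT p|lborel. h p)" by (simp add: add.commute)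
qed

text \<open>The integral of a difference quotient vanishes by translation invariance. The quotients converge to the
  directional derivative and are dominated, by the mean value theorem and the compact support.\<close>

lemma integral_directional_derivative_zero:
  fixes h :: "'a::euclidean_space \<Rightarrow> real"
  assumes der: "\<And>p. (h has_derivative h' p) (at p)"
    and S: "compact S" "\<And>p. p \<notin> S \<Longrightarrow> h p = 0" "\<And>p. p \<notin> S \<Longrightarrow> h' p e = 0"
    and cont: "continuous_on UNIV (\<lambda>p. h' p e)"
  shows "(LINT p|lborel. h' p e) = 0"
proof -
  have hc: "continuous_on UNIV h"
    by (intro continuous_at_imp_continuous_on ballI has_derivative_continuous[OF der])
  have "integrable lborel (\<lambda>p. indicator S p *\<^sub>R h p)"
    using S(1) hc by (intro borel_integrable_compact) (auto intro: continuous_on_subset)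
  moreover have "(\<lambda>p. indicator S p *\<^sub>R h p) = h" using S(2) by (auto simp: indicator_def fun_eq_iff)
  ultimately have hi: "integrable lborel h" by simp
  have line: "((\<lambda>t. h (p + t *\<^sub>R e)) has_real_derivative h' (p + t *\<^sub>R e) e) (at t)" for p t
  proof -
    have "((\<lambda>t. p + t *\<^sub>R e) has_derivative (\<lambda>s. s *\<^sub>R e)) (at t)"
      by (auto intro!: derivative_eq_intros)
    from has_derivative_compose[OF this der]
    have "((\<lambda>t. h (p + t *\<^sub>R e)) has_derivative (\<lambda>s. h' (p + t *\<^sub>R e) (s *\<^sub>R e))) (at t)" .
    moreover have "h' (p + t *\<^sub>R e) (s *\<^sub>R e) = h' (p + t *\<^sub>R e) e * s" for s
      using linear_scale[OF has_derivative_linear[OF der]] by simp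
    ultimately show ?thesis by (simp add: has_field_derivative_def)
  qed
  obtain B where B: "\<And>p. \<bar>h' p e\<bar> \<le> B"
  proof -
    have "bounded ((\<lambda>p. h' p e) ` S)"
      using compact_continuous_image[OF continuous_on_subset[OF cont] S(1)] compact_imp_bounded by blast
    then obtain B where B: "\<And>p. p \<in> S \<Longrightarrow> \<bar>h' p e\<bar> \<le> B" by (auto simp: bounded_iff)
    have "\<bar>h' p e\<bar> \<le> max B 0" for p
      using B[of p] S(3)[of p] by (cases "p \<in> S") auto
    then show ?thesis using that by blast
  qed
  obtain R where "\<And>p. p \<in> S \<Longrightarrow> norm p \<le> R"
    using compact_imp_bounded[OF S(1)] by (auto simp: bounded_iff)
  then have R: "S \<subseteq> cball 0 R" by auto
  let ?t = "\<lambda>n. inverse (real (Suc n))"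
  let ?q = "\<lambda>n p. (h (p + ?t n *\<^sub>R e) - h p) / ?t n"
  have t0: "0 < ?t n" "?t n \<le> 1" for n by (auto simp: inverse_le_1_iff)
  have zero: "(LINT p|lborel. ?q n p) = 0" for n
    using lborel_integral_translation[OF hi, of "?t n *\<^sub>R e"] hi by simp
  have "(\<lambda>n. LINT p|lborel. ?q n p) \<longlonglongrightarrow> (LINT p|lborel. h' p e)"
  proof (rule integral_dominated_convergence)
    show "(\<lambda>p. h' p e) \<in> borel_measurable lborel"
      using cont by (simp add: borel_measurable_continuous_onI)
    show "?q n \<in> borel_measurable lborel" for n
      using lborel_integral_translation(1)[OF hi, of "?t n *\<^sub>R e"] hi
      by (intro borel_measurable_divide borel_measurable_diff borel_measurable_integrable) auto
    show "integrable lborel (\<lambda>p. indicator (cball 0 (R + norm e)) p *\<^sub>R B)"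
      by (intro borel_integrable_compact) auto
    have "(\<lambda>n. ?q n p) \<longlonglongrightarrow> h' p e" for p
    proof -
      have "((\<lambda>s. (h (p + s *\<^sub>R e) - h p) / s) \<longlongrightarrow> h' p e) (at 0)"
        using line[of p 0] by (simp add: DERIV_def)
      moreover have "filterlim ?t (at 0) sequentially"
        using LIMSEQ_inverse_real_of_nat by (simp add: filterlim_at)
      ultimately show ?thesis by (rule filterlim_compose)
    qed
    then show "AE p in lborel. (\<lambda>n. ?q n p) \<longlonglongrightarrow> h' p e" by simp
    have "norm (?q n p) \<le> indicator (cball 0 (R + norm e)) p *\<^sub>R B" for n p
    proof (cases "p \<in> cball 0 (R + norm e)")
      case True
      have "\<exists>z>0. z < ?t n \<and> h (p + ?t n *\<^sub>R e) - h (p + 0 *\<^sub>R e) = (?t n - 0) * h' (p + z *\<^sub>R e) e"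
        by (rule MVT2[OF t0(1), where f = "\<lambda>t. h (p + t *\<^sub>R e)"]) (rule line)
      then obtain z where "h (p + ?t n *\<^sub>R e) - h (p + 0 *\<^sub>R e) = (?t n - 0) * h' (p + z *\<^sub>R e) e"
        by (elim exE conjE)
      then have "?q n p = h' (p + z *\<^sub>R e) e" using t0[of n] by (simp del: of_nat_Suc)
      then show ?thesis using B True by simp
    next
      case False
      have "p \<notin> S" using R False by (auto simp: subset_eq) (meson add_increasing2 norm_ge_zero order_trans)
      moreover have "p + ?t n *\<^sub>R e \<notin> S"
      proof
        assume "p + ?t n *\<^sub>R e \<in> S"
        then have "norm (p + ?t n *\<^sub>R e) \<le> R" using R by (auto simp: subset_eq)
        moreover have "norm (?t n *\<^sub>R e) \<le> norm e"
          using t0[of n] by (simp add: mult_left_le_one_le del: of_nat_Suc)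
        moreover have "norm p \<le> norm (p + ?t n *\<^sub>R e) + norm (?t n *\<^sub>R e)"
          using norm_triangle_sub[of p "p + ?t n *\<^sub>R e"] by (simp del: of_nat_Suc)
        ultimately show False using False by simp
      qed
      ultimately show ?thesis using S(2) False by simp
    qed
    then show "AE p in lborel. norm (?q n p) \<le> indicator (cball 0 (R + norm e)) p *\<^sub>R B" for n by simp
  qed
  then show ?thesis unfolding zero using LIMSEQ_unique[OF tendsto_const] by fastforce
qed

text \<open>Integration by parts: the product of \<open>\<phi>\<close> with a test function \<open>\<eta>\<close>, extended by zero, is continuously
  differentiable on the whole plane with compact support, and the integral of its directional derivative
  is zero.\<close>

lemma classical_imp_weak_deriv:
  assumes U: "open U" and \<phi>: "continuous_on U \<phi>" "continuous_on U fx" "continuous_on U fy"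
    "\<And>p. p \<in> U \<Longrightarrow> (\<phi> has_derivative (\<lambda>h. fx p * fst h + fy p * snd h)) (at p)"
  shows "has_weak_deriv U e \<phi> (\<lambda>p. fx p * fst e + fy p * snd e)"
  unfolding has_weak_deriv_def
proof (intro conjI ballI)
  let ?g = "\<lambda>p. fx p * fst e + fy p * snd e"
  have gc: "continuous_on U ?g" using \<phi> by (intro continuous_intros)
  show "loc_integrable U \<phi>" "loc_integrable U ?g"
    using \<phi>(1) gc by (auto intro: continuous_loc_integrable)
  fix \<eta> assume \<eta>: "\<eta> \<in> Cinf_cpt U U"
  obtain S hx hy where S: "compact S" "S \<subseteq> U" "\<And>p. p \<notin> S \<Longrightarrow> \<eta> p = 0" "continuous_on U \<eta>"
    "\<And>p. p \<in> U \<Longrightarrow> (\<eta> has_derivative (\<lambda>h. hx p * fst h + hy p * snd h)) (at p)"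
    "continuous_on U hx" "continuous_on U hy"
    "\<And>p. p \<in> U \<Longrightarrow> p \<notin> S \<Longrightarrow> hx p = 0" "\<And>p. p \<in> U \<Longrightarrow> p \<notin> S \<Longrightarrow> hy p = 0"
    by (rule test_function_derivative[OF U \<eta>]) (rule that)
  let ?k = "\<lambda>p. hx p * fst e + hy p * snd e"
  have kc: "continuous_on U ?k" using S by (intro continuous_intros)
  have fr: "frechet_derivative \<eta> (at p) e = ?k p" if "p \<in> U" for p
    using frechet_derivative_at[OF S(5)[OF that], symmetric] by simp
  define h' where "h' p = (\<lambda>v. if p \<in> U then \<phi> p * (hx p * fst v + hy p * snd v) + (fx p * fst v + fy p * snd v) * \<eta> p else 0)" for p
  have opS: "open (- S)" using S(1) by (simp add: compact_imp_closed open_Compl)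
  have cov: "U \<union> - S = UNIV" using S(2) by auto
  have h'0: "h' p v = 0" if "p \<notin> S" for p v
    using that S(3,8,9) by (simp add: h'_def)
  have contg: "continuous_on UNIV (\<lambda>p. h' p e)"
  proof -
    have "continuous_on (U \<union> - S) (\<lambda>p. h' p e)"
    proof (rule continuous_on_open_Un[OF U opS])
      have "continuous_on U (\<lambda>p. \<phi> p * ?k p + ?g p * \<eta> p)"
        by (rule continuous_on_add[OF continuous_on_mult[OF \<phi>(1) kc] continuous_on_mult[OF gc S(4)]])
      then show "continuous_on U (\<lambda>p. h' p e)" by (rule continuous_on_eq) (simp add: h'_def)
      show "continuous_on (- S) (\<lambda>p. h' p e)"
        by (rule continuous_on_eq[OF continuous_on_const[of _ 0]]) (simp add: h'0)
    qed
    then show ?thesis by (simp only: cov)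
  qed
  have "(LINT p|lborel. h' p e) = 0"
  proof (rule integral_directional_derivative_zero[OF _ S(1), where h = "\<lambda>p. \<phi> p * \<eta> p"])
    show "((\<lambda>p. \<phi> p * \<eta> p) has_derivative h' p) (at p)" for p
    proof (cases "p \<in> U")
      case True
      then show ?thesis
        unfolding h'_def using has_derivative_mult[OF \<phi>(4)[OF True] S(5)[OF True]] by simp
    next
      case False
      have "h' p = (\<lambda>_. 0)" using False by (simp add: h'_def)
      moreover have "((\<lambda>p. \<phi> p * \<eta> p) has_derivative (\<lambda>_. 0)) (at p)"
        by (rule has_derivative_transform_within_open[of "\<lambda>_. 0" _ _ _ "- S"])
          (use S(2,3) False opS in auto)
      ultimately show ?thesis by simp
    qed
  qed (use S(3) h'0 contg in auto)
  then have "(LINT p|lebesgue. h' p e) = 0"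
    using contg by (subst integral_completion) (auto intro: borel_measurable_continuous_onI)
  moreover have "(LINT p|lebesgue. h' p e) = (LINT p:U|lebesgue. \<phi> p * ?k p + ?g p * \<eta> p)"
    unfolding set_lebesgue_integral_def
    by (rule Bochner_Integration.integral_cong) (auto simp: h'_def indicator_def)
  moreover have "(LINT p:U|lebesgue. \<phi> p * ?k p + ?g p * \<eta> p) =
      (LINT p:U|lebesgue. \<phi> p * ?k p) + (LINT p:U|lebesgue. ?g p * \<eta> p)"
    using \<phi>(1) gc kc S continuous_loc_integrable
    by (intro set_integral_add loc_integrable_mult_cpt[of U _ _ S]) auto
  moreover have "(LINT p:U|lebesgue. \<phi> p * ?k p) = (LINT p:U|lebesgue. \<phi> p * frechet_derivative \<eta> (at p) e)"
    unfolding set_lebesgue_integral_def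
    by (rule Bochner_Integration.integral_cong) (auto simp: fr indicator_def)
  ultimately show "(LINT p:U|lebesgue. \<phi> p * frechet_derivative \<eta> (at p) e) = - (LINT p:U|lebesgue. ?g p * \<eta> p)"
    by linarith
qed

section \<open>Square-integrable vector-valued functions\<close>

definition L2_fun :: "'a measure \<Rightarrow> ('a \<Rightarrow> 'b::euclidean_space) set" where
  "L2_fun M = {X \<in> borel_measurable M. integrable M (\<lambda>p. (norm (X p))\<^sup>2)}"

definition L2_ip :: "'a measure \<Rightarrow> ('a \<Rightarrow> 'b::euclidean_space) \<Rightarrow> ('a \<Rightarrow> 'b) \<Rightarrow> real" where
  "L2_ip M X Y = (LINT p|M. X p \<bullet> Y p)"

lemma L2_fun_inner_integrable:
  assumes "X \<in> L2_fun M" "Y \<in> L2_fun M"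
  shows "integrable M (\<lambda>p. X p \<bullet> Y p)" "integrable M (\<lambda>p. norm (X p) * norm (Y p))"
proof -
  have [measurable]: "X \<in> borel_measurable M" "Y \<in> borel_measurable M"
    using assms by (auto simp: L2_fun_def)
  have i: "integrable M (\<lambda>p. (norm (X p))\<^sup>2 + (norm (Y p))\<^sup>2)"
    using assms by (auto simp: L2_fun_def)
  have b: "norm (X p) * norm (Y p) \<le> (norm (X p))\<^sup>2 + (norm (Y p))\<^sup>2" for p
  proof -
    have "0 \<le> (norm (X p) - norm (Y p))\<^sup>2" "0 \<le> norm (X p) * norm (Y p)" by simp_all
    moreover have "(norm (X p) - norm (Y p))\<^sup>2 = (norm (X p))\<^sup>2 + (norm (Y p))\<^sup>2 - 2 * (norm (X p) * norm (Y p))"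
      by (simp add: power2_eq_square algebra_simps)
    ultimately show ?thesis by linarith
  qed
  show "integrable M (\<lambda>p. norm (X p) * norm (Y p))"
    by (rule Bochner_Integration.integrable_bound[OF i]) (use b in \<open>auto simp: abs_mult\<close>)
  show "integrable M (\<lambda>p. X p \<bullet> Y p)"
  proof (rule Bochner_Integration.integrable_bound[OF i])
    show "AE p in M. norm (X p \<bullet> Y p) \<le> norm ((norm (X p))\<^sup>2 + (norm (Y p))\<^sup>2)"
      using b Cauchy_Schwarz_ineq2 order_trans by (fastforce intro: always_eventually)
  qed simp
qed

lemma L2_fun_add: "X \<in> L2_fun M \<Longrightarrow> Y \<in> L2_fun M \<Longrightarrow> X + Y \<in> L2_fun M"
proof -
  assume a: "X \<in> L2_fun M" "Y \<in> L2_fun M"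
  have "(norm (X p + Y p))\<^sup>2 = (norm (X p))\<^sup>2 + 2 * (X p \<bullet> Y p) + (norm (Y p))\<^sup>2" for p
    by (simp add: power2_norm_eq_inner inner_add_left inner_add_right inner_commute)
  then show ?thesis
    using a L2_fun_inner_integrable(1)[OF a] unfolding L2_fun_def by (auto simp: plus_fun_def)
qed

lemma L2_fun_scale: "X \<in> L2_fun M \<Longrightarrow> c *\<^sub>R X \<in> L2_fun M"
  unfolding L2_fun_def by (auto simp: scaleR_fun_def power_mult_distrib)

interpretation L2: semi_inner_space "L2_fun M" "L2_ip M" for M :: "'a measure"
proof
  show "subspace (L2_fun M)"
    unfolding subspace_def
    by (intro conjI ballI allI L2_fun_add L2_fun_scale) (simp_all add: L2_fun_def zero_fun_def)
  show "bilinear_form_on (L2_fun M) (L2_ip M)"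
    unfolding bilinear_form_on_def linear_form_on_def L2_ip_def
    by (simp add: inner_add_left inner_add_right L2_fun_inner_integrable(1))
  show "L2_ip M X Y = L2_ip M Y X" for X Y by (simp add: L2_ip_def inner_commute)
  show "0 \<le> L2_ip M X X" for X by (simp add: L2_ip_def)
qed

lemma L2_nrm_sq: "X \<in> L2_fun M \<Longrightarrow> (L2.nrm M X)\<^sup>2 = (LINT p|M. (norm (X p))\<^sup>2)"
  by (simp add: L2.nrm_sq L2_ip_def power2_norm_eq_inner)

lemma L2_nn_integral: "X \<in> L2_fun M \<Longrightarrow> (\<integral>\<^sup>+p. ennreal ((norm (X p))\<^sup>2) \<partial>M) = ennreal ((L2.nrm M X)\<^sup>2)"
  by (simp add: L2_nrm_sq L2_fun_def nn_integral_eq_integral)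

text \<open>By monotone convergence the series of \<open>4 ^ n * (norm (s (Suc n) p - s n p))\<^sup>2\<close> is finite for almost
  every \<open>p\<close>. Its terms are then eventually below one, so the increments of \<open>s\<close> at \<open>p\<close> decay like
  \<open>(1/2) ^ n\<close>.\<close>

lemma fast_Cauchy_converges_AE:
  fixes s :: "nat \<Rightarrow> 'a \<Rightarrow> 'b::euclidean_space"
  assumes s: "\<And>n. s n \<in> L2_fun M" and fast: "\<And>n. (L2.nrm M (s (Suc n) - s n))\<^sup>2 \<le> (1/8) ^ n"
  shows "AE p in M. convergent (\<lambda>n. s n p)"
proof -
  let ?d = "\<lambda>n. s (Suc n) - s n"
  have d: "?d n \<in> L2_fun M" for n using s by simp
  have [measurable]: "s n \<in> borel_measurable M" for n using s by (simp add: L2_fun_def)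
  let ?g = "\<lambda>p n. ennreal (4 ^ n * (norm (?d n p))\<^sup>2)"
  have "(\<integral>\<^sup>+p. (\<Sum>n. ?g p n) \<partial>M) = (\<Sum>n. \<integral>\<^sup>+p. ?g p n \<partial>M)"
    by (rule nn_integral_suminf) simp
  also have "\<dots> \<le> (\<Sum>n. ennreal ((1/2) ^ n))"
  proof (rule suminf_le)
    fix n
    have "(\<integral>\<^sup>+p. ?g p n \<partial>M) = ennreal (4 ^ n) * (\<integral>\<^sup>+p. ennreal ((norm (?d n p))\<^sup>2) \<partial>M)"
      by (subst nn_integral_cmult[symmetric]) (simp_all add: ennreal_mult')
    also have "\<dots> = ennreal (4 ^ n * (L2.nrm M (?d n))\<^sup>2)"
      using L2_nn_integral[OF d[of n]] by (simp add: ennreal_mult')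
    also have "\<dots> \<le> ennreal (4 ^ n * (1/8) ^ n)" using fast[of n] by (intro ennreal_leI mult_left_mono) auto
    also have "4 ^ n * (1/8) ^ n = (1/2::real) ^ n" by (simp add: power_mult_distrib[symmetric])
    finally show "(\<integral>\<^sup>+p. ?g p n \<partial>M) \<le> ennreal ((1/2) ^ n)" .
  qed simp_all
  also have "\<dots> = ennreal (\<Sum>n. (1/2) ^ n)"
    by (intro suminf_ennreal2) (simp_all add: summable_geometric)
  also have "\<dots> < \<infinity>" by simp
  finally have "AE p in M. (\<Sum>n. ?g p n) \<noteq> \<infinity>"
    by (intro nn_integral_PInf_AE) auto
  then show ?thesis
  proof eventually_elim
    case (elim p)
    have "summable (\<lambda>n. 4 ^ n * (norm (?d n p))\<^sup>2)"
      using elim by (intro summable_suminf_not_top) auto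
    then have "(\<lambda>n. 4 ^ n * (norm (?d n p))\<^sup>2) \<longlonglongrightarrow> 0" by (rule summable_LIMSEQ_zero)
    then have "\<forall>\<^sub>F n in sequentially. 4 ^ n * (norm (?d n p))\<^sup>2 < 1" by (rule order_tendstoD) simp
    then have "\<forall>\<^sub>F n in sequentially. norm (?d n p) \<le> (1/2) ^ n"
    proof eventually_elim
      case (elim n)
      have "(2 ^ n * norm (?d n p))\<^sup>2 < 1\<^sup>2"
        using elim by (simp add: power_mult_distrib power_mult[symmetric] mult.commute[of n] power_mult)
      then have "2 ^ n * norm (?d n p) < 1" by (rule power2_less_imp_less) simp
      then show ?case by (simp add: field_simps)
    qed
    then have "summable (\<lambda>n. ?d n p)"
      by (rule summable_comparison_test_ev) (simp add: summable_geometric)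
    then have "convergent (\<lambda>n. \<Sum>i<n. ?d i p)" by (simp add: summable_iff_convergent)
    then have "convergent (\<lambda>n. s n p - s 0 p)"
      by (simp add: sum_lessThan_telescope[of "\<lambda>n. s n p"])
    then show ?case by (simp add: convergent_diff_const_right_iff)
  qed
qed

text \<open>Completeness of \<open>L2\<close>, with an almost everywhere convergent subsequence. The pointwise limit of a
  rapidly converging subsequence is also the limit in norm, by Fatou's lemma.\<close>

lemma L2_Cauchy_limit:
  fixes s :: "nat \<Rightarrow> 'a \<Rightarrow> 'b::euclidean_space"
  assumes s: "\<And>n. s n \<in> L2_fun M"
    and Cauchy: "\<And>\<epsilon>. 0 < \<epsilon> \<Longrightarrow> \<exists>N. \<forall>m\<ge>N. \<forall>n\<ge>N. L2.nrm M (s m - s n) < \<epsilon>"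
  obtains X r where "X \<in> L2_fun M" "(\<lambda>n. L2.nrm M (s n - X)) \<longlonglongrightarrow> 0"
    "strict_mono (r :: nat \<Rightarrow> nat)" "AE p in M. (\<lambda>k. s (r k) p) \<longlonglongrightarrow> X p"
proof -
  have "\<exists>N. \<forall>m\<ge>N. \<forall>n\<ge>N. (L2.nrm M (s m - s n))\<^sup>2 \<le> (1/8) ^ k" for k :: nat
  proof -
    obtain N where N: "\<forall>m\<ge>N. \<forall>n\<ge>N. L2.nrm M (s m - s n) < sqrt ((1/8) ^ k)"
      using Cauchy[of "sqrt ((1/8) ^ k)"] by auto
    have "(L2.nrm M (s m - s n))\<^sup>2 \<le> (1/8) ^ k" if "m \<ge> N" "n \<ge> N" for m n
    proof -
      have "(L2.nrm M (s m - s n))\<^sup>2 \<le> (sqrt ((1/8) ^ k))\<^sup>2"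
        using N that s by (intro power_mono) (auto intro: less_imp_le)
      then show ?thesis by simp
    qed
    then show ?thesis by blast
  qed
  then obtain N where N: "\<And>k m n. m \<ge> N k \<Longrightarrow> n \<ge> N k \<Longrightarrow> (L2.nrm M (s m - s n))\<^sup>2 \<le> (1/8) ^ k"
    by metis
  \<comment> \<open>The partial sums are strictly increasing and dominate \<open>N\<close>.\<close>
  define r where "r k = (\<Sum>i\<le>k. Suc (N i))" for k
  have r_mono: "strict_mono r" by (simp add: strict_mono_Suc_iff r_def)
  have r_N: "N k \<le> r k" for k
  proof -
    have "Suc (N k) \<le> r k" unfolding r_def by (rule member_le_sum) auto
    then show ?thesis by simp
  qed
  have "(L2.nrm M (s (r (Suc k)) - s (r k)))\<^sup>2 \<le> (1/8) ^ k" for k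
    using r_N[of k] strict_mono_leD[OF r_mono, of k "Suc k"] by (intro N) auto
  from fast_Cauchy_converges_AE[OF s this]
  have conv: "AE p in M. convergent (\<lambda>k. s (r k) p)" .
  have [measurable]: "s n \<in> borel_measurable M" for n using s by (simp add: L2_fun_def)
  define X where "X p = lim (\<lambda>k. s (r k) p)" for p
  have [measurable]: "X \<in> borel_measurable M"
    unfolding X_def by (rule borel_measurable_lim_metric) simp
  have lim: "AE p in M. (\<lambda>k. s (r k) p) \<longlonglongrightarrow> X p"
    using conv by eventually_elim (simp add: X_def convergent_LIMSEQ_iff)
  have bound: "s n - X \<in> L2_fun M \<and> L2.nrm M (s n - X) \<le> \<epsilon>"
    if "0 < \<epsilon>" "\<forall>m\<ge>n0. \<forall>n\<ge>n0. L2.nrm M (s m - s n) < \<epsilon>" "n \<ge> n0" for \<epsilon> n n0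
  proof -
    have "(\<integral>\<^sup>+p. ennreal ((norm (s n p - X p))\<^sup>2) \<partial>M)
        = (\<integral>\<^sup>+p. liminf (\<lambda>k. ennreal ((norm (s n p - s (r k) p))\<^sup>2)) \<partial>M)"
    proof (rule nn_integral_cong_AE)
      show "AE p in M. ennreal ((norm (s n p - X p))\<^sup>2) = liminf (\<lambda>k. ennreal ((norm (s n p - s (r k) p))\<^sup>2))"
        using lim
      proof eventually_elim
        case (elim p)
        have "(\<lambda>k. ennreal ((norm (s n p - s (r k) p))\<^sup>2)) \<longlonglongrightarrow> ennreal ((norm (s n p - X p))\<^sup>2)"
          by (intro tendsto_intros elim tendsto_ennrealI)
        then show ?case using lim_imp_Liminf[OF sequentially_bot] by metis
      qed
    qed
    also have "\<dots> \<le> liminf (\<lambda>k. \<integral>\<^sup>+p. ennreal ((norm (s n p - s (r k) p))\<^sup>2) \<partial>M)"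
      by (rule nn_integral_liminf) simp
    also have "\<dots> \<le> ennreal (\<epsilon>\<^sup>2)"
    proof (rule Liminf_le)
      have "\<forall>\<^sub>F k in sequentially. n0 \<le> r k"
        using filterlim_subseq[OF r_mono] by (simp add: filterlim_at_top)
      then show "\<forall>\<^sub>F k in sequentially. (\<integral>\<^sup>+p. ennreal ((norm (s n p - s (r k) p))\<^sup>2) \<partial>M) \<le> ennreal (\<epsilon>\<^sup>2)"
      proof eventually_elim
        case (elim k)
        have "(\<integral>\<^sup>+p. ennreal ((norm (s n p - s (r k) p))\<^sup>2) \<partial>M) = ennreal ((L2.nrm M (s n - s (r k)))\<^sup>2)"
          using L2_nn_integral[of "s n - s (r k)" M] s by simp
        also have "\<dots> \<le> ennreal (\<epsilon>\<^sup>2)"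
          using that elim s by (intro ennreal_leI power_mono) (auto intro: less_imp_le)
        finally show ?case .
      qed
    qed simp
    finally have le: "(\<integral>\<^sup>+p. ennreal ((norm (s n p - X p))\<^sup>2) \<partial>M) \<le> ennreal (\<epsilon>\<^sup>2)" .
    also have "\<dots> < \<infinity>" by simp
    finally have mem: "s n - X \<in> L2_fun M"
      unfolding L2_fun_def by (auto simp: fun_diff_def intro!: integrableI_bounded)
    have "(L2.nrm M (s n - X))\<^sup>2 \<le> \<epsilon>\<^sup>2"
      using le L2_nn_integral[OF mem] by (simp add: ennreal_le_iff)
    then show ?thesis using mem \<open>0 < \<epsilon>\<close> by (auto intro: power2_le_imp_le)
  qed
  obtain n1 where "\<forall>m\<ge>n1. \<forall>n\<ge>n1. L2.nrm M (s m - s n) < 1" using Cauchy[of 1] by auto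
  then have "s n1 - X \<in> L2_fun M" using bound[of 1 n1 n1] by simp
  then have X: "X \<in> L2_fun M" using L2.mem_diff[OF s[of n1], of "s n1 - X"] by simp
  have "(\<lambda>n. L2.nrm M (s n - X)) \<longlonglongrightarrow> 0"
  proof (rule LIMSEQ_I)
    fix e :: real assume "0 < e"
    then obtain n0 where "\<forall>m\<ge>n0. \<forall>n\<ge>n0. L2.nrm M (s m - s n) < e / 2" using Cauchy[of "e/2"] by auto
    then have "\<forall>n\<ge>n0. L2.nrm M (s n - X) \<le> e / 2" using bound[of "e/2" n0] \<open>0 < e\<close> by simp
    then have "norm (L2.nrm M (s n - X) - 0) < e" if "n \<ge> n0" for n
      using that \<open>0 < e\<close> L2.nrm_nonneg[OF L2.mem_diff[OF s[of n] X]] by fastforce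
    then show "\<exists>no. \<forall>n\<ge>no. norm (L2.nrm M (s n - X) - 0) < e" by blast
  qed
  then show ?thesis using that X r_mono lim by blast
qed

section \<open>The weighted Sobolev space as a semi-inner product space\<close>

text \<open>Local integrability gives measurability on compact boxes, and countably many of them cover \<open>U\<close>.\<close>

lemma loc_integrable_measurable:
  assumes "open U" "loc_integrable U u"
  shows "u \<in> borel_measurable (lebesgue_on U)"
proof -
  obtain D where D: "countable D" "D \<subseteq> Pow U" "\<And>X. X \<in> D \<Longrightarrow> \<exists>a b. X = cbox a b" "\<Union>D = U"
    using open_countable_Union_open_cbox[OF assms(1)] by metis
  have U: "U \<in> sets lebesgue" using assms(1) by auto
  show ?thesis
  proof (rule measurable_piecewise_restrict[OF D(1)])
    show "space (lebesgue_on U) \<subseteq> \<Union>D" using D(4) by simp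
    fix X assume X: "X \<in> D"
    then obtain a b where ab: "X = cbox a b" "X \<subseteq> U" using D(2,3) by blast
    have Xs: "X \<in> sets lebesgue" using ab by simp
    show "X \<inter> space (lebesgue_on U) \<in> sets (lebesgue_on U)"
      using ab U Xs by (simp add: sets_restrict_space_iff Int_absorb2)
    have "u absolutely_integrable_on X" using assms(2) ab by (simp add: loc_integrable_def)
    then have "u \<in> borel_measurable (lebesgue_on X)"
      by (rule absolutely_integrable_measurable[OF _, THEN iffD1, THEN conjunct1, rotated]) (use Xs in auto)
    moreover have "restrict_space (lebesgue_on U) X = lebesgue_on X"
      using ab(2) U Xs by (subst restrict_restrict_space) (auto simp: Int_absorb1)
    ultimately show "u \<in> borel_measurable (restrict_space (lebesgue_on U) X)" by simp
  qed
qed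

text \<open>Tonelli's theorem reduces the claim to integrability of \<open>y powr a\<close> near zero, where \<open>a > -1\<close> enters.\<close>

lemma powr_integrable_strip:
  fixes a R :: real
  assumes "a > -1" "R \<ge> 0"
  shows "integrable lborel (\<lambda>p::real \<times> real. indicator ({-R..R} \<times> {0..R}) p * snd p powr a)"
proof -
  have "(\<lambda>y. y powr a) integrable_on {0..R}" by (rule integrable_on_powr_from_0[OF assms])
  then have "(\<lambda>y. y powr a) absolutely_integrable_on {0..R}"
    by (rule nonnegative_absolutely_integrable_1) simp
  then have i1: "integrable lborel (\<lambda>y. indicator {0..R} y * y powr a)"
    unfolding set_integrable_def by (subst (asm) integrable_completion) auto
  have fin: "(\<integral>\<^sup>+y. ennreal (indicator {0..R} y * y powr a) \<partial>lborel) < \<infinity>"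
    using i1 by (simp add: nn_integral_eq_integral)
  have "snd \<in> borel_measurable (borel :: (real \<times> real) measure)"
    by (intro borel_measurable_continuous_onI continuous_intros)
  then have "(\<lambda>p::real \<times> real. snd p powr a) \<in> borel_measurable borel" by measurable
  then have m: "(\<lambda>p::real \<times> real. indicator ({-R..R} \<times> {0..R}) p * snd p powr a) \<in> borel_measurable borel"
    by (intro borel_measurable_times borel_measurable_indicator borel_closed closed_Times closed_atLeastAtMost)
  have "(\<integral>\<^sup>+p. ennreal (indicator ({-R..R} \<times> {0..R}) p * snd p powr a) \<partial>(lborel :: (real \<times> real) measure))
      = (\<integral>\<^sup>+x. \<integral>\<^sup>+y. ennreal (indicator ({-R..R} \<times> {0..R}) (x, y) * y powr a) \<partial>lborel \<partial>lborel)"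
    unfolding lborel_prod[symmetric]
    by (subst lborel.nn_integral_fst[symmetric]) (use m in \<open>auto simp: lborel_prod\<close>)
  also have "\<dots> = (\<integral>\<^sup>+x. \<integral>\<^sup>+y. indicator {-R..R} x * ennreal (indicator {0..R} y * y powr a) \<partial>lborel \<partial>lborel)"
    by (intro nn_integral_cong) (auto simp: indicator_def)
  also have "\<dots> = (\<integral>\<^sup>+x. indicator {-R..R} x * (\<integral>\<^sup>+y. ennreal (indicator {0..R} y * y powr a) \<partial>lborel) \<partial>lborel)"
    by (intro nn_integral_cong nn_integral_cmult) auto
  also have "\<dots> = emeasure lborel {-R..R} * (\<integral>\<^sup>+y. ennreal (indicator {0..R} y * y powr a) \<partial>lborel)"
    by (subst nn_integral_multc) auto
  also have "\<dots> < \<infinity>" using fin by (simp add: ennreal_mult_less_top emeasure_lborel_Icc_eq)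
  finally show ?thesis
    using m by (intro integrableI_bounded) (auto simp: abs_mult)
qed

definition weakly_differentiable :: "(real \<times> real) set \<Rightarrow> (real \<times> real \<Rightarrow> real) \<Rightarrow> bool" where
  "weakly_differentiable U u \<longleftrightarrow> (\<exists>g. has_weak_deriv U (1, 0) u g) \<and> (\<exists>g. has_weak_deriv U (0, 1) u g)"

text \<open>The vector whose squared Euclidean norm is the density of the Sobolev norm.\<close>

definition energy :: "(real \<times> real) set \<Rightarrow> (real \<times> real \<Rightarrow> real) \<Rightarrow> real \<times> real \<Rightarrow> real \<times> real \<times> real" where
  "energy U u p = (sqrt (snd p) * wdx U u p, sqrt (snd p) * wdy U u p, sqrt (1 + snd p) * u p)"

lemma weakly_differentiable_lincomb:
  assumes "open U" "weakly_differentiable U u" "weakly_differentiable U v"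
  shows "weakly_differentiable U (\<lambda>p. a * u p + b * v p)"
  using assms has_weak_deriv_lincomb[OF assms(1)] unfolding weakly_differentiable_def by meson

lemma energy_AE_eq:
  assumes "open U" "has_weak_deriv U (1, 0) u g" "has_weak_deriv U (0, 1) u k"
  shows "AE p in lebesgue_on U. energy U u p = (sqrt (snd p) * g p, sqrt (snd p) * k p, sqrt (1 + snd p) * u p)"
  using weak_deriv_AE_eq(2)[OF assms(1,2)] weak_deriv_AE_eq(2)[OF assms(1,3)]
  by eventually_elim (simp add: energy_def)

lemma energy_lincomb:
  assumes "open U" "weakly_differentiable U u" "weakly_differentiable U v"
  shows "AE p in lebesgue_on U. energy U (\<lambda>p. a * u p + b * v p) p = a *\<^sub>R energy U u p + b *\<^sub>R energy U v p"
proof -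
  from assms obtain gx gy kx ky where
    g: "has_weak_deriv U (1, 0) u gx" "has_weak_deriv U (0, 1) u gy" and
    k: "has_weak_deriv U (1, 0) v kx" "has_weak_deriv U (0, 1) v ky"
    unfolding weakly_differentiable_def by blast
  show ?thesis
    using energy_AE_eq[OF assms(1) g] energy_AE_eq[OF assms(1) k]
      energy_AE_eq[OF assms(1) has_weak_deriv_lincomb[OF assms(1) g(1) k(1), of a b]
        has_weak_deriv_lincomb[OF assms(1) g(2) k(2), of a b]]
    by eventually_elim (simp add: algebra_simps)
qed

lemma weakly_differentiable_measurable:
  assumes "open U" "weakly_differentiable U u"
  shows "u \<in> borel_measurable (lebesgue_on U)" "wdx U u \<in> borel_measurable (lebesgue_on U)"
    "wdy U u \<in> borel_measurable (lebesgue_on U)"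
proof -
  from assms obtain gx gy where
    g: "has_weak_deriv U (1, 0) u gx" "has_weak_deriv U (0, 1) u gy"
    unfolding weakly_differentiable_def by blast
  note w = weak_deriv_AE_eq(1)[OF assms(1) g(1)] weak_deriv_AE_eq(1)[OF assms(1) g(2)]
  show "u \<in> borel_measurable (lebesgue_on U)" "wdx U u \<in> borel_measurable (lebesgue_on U)"
    "wdy U u \<in> borel_measurable (lebesgue_on U)"
    using w loc_integrable_measurable[OF assms(1)] unfolding has_weak_deriv_def by blast+
qed

lemma fst_snd_measurable [measurable]:
  "snd \<in> borel_measurable (lebesgue_on (U :: (real \<times> real) set))"
  "fst \<in> borel_measurable (lebesgue_on (U :: (real \<times> real) set))"
  by (simp_all add: measurable_restrict_space1 measurable_completion borel_measurable_continuous_onI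
      continuous_on_fst continuous_on_snd)

lemma energy_measurable:
  assumes "open U" "weakly_differentiable U u"
  shows "energy U u \<in> borel_measurable (lebesgue_on U)"
proof -
  note [measurable] = weakly_differentiable_measurable[OF assms]
  show ?thesis unfolding energy_def[abs_def] by measurable
qed

locale heston_domain =
  fixes A :: heston and \<gamma> :: real and U :: "(real \<times> real) set"
  assumes coeffs: "heston_coeffs A" and \<gamma>_pos: "0 < \<gamma>" and dom: "half_plane_domain U"
begin

abbreviation "M \<equiv> hmeasure A \<gamma> U"
abbreviation "w \<equiv> hweight A \<gamma>"

lemma open_U: "open U" and snd_pos: "p \<in> U \<Longrightarrow> 0 < snd p"
  using dom by (auto simp: half_plane_domain_def half_plane_def)

lemma sets_U: "U \<in> sets lebesgue" using open_U by auto

lemma w_pos: "p \<in> U \<Longrightarrow> 0 < w p"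
  using snd_pos[of p] by (simp add: hweight_def case_prod_beta)

lemma w_continuous: "continuous_on U w"
proof -
  have "\<forall>p\<in>U. snd p \<noteq> 0" using snd_pos by force
  then show ?thesis unfolding hweight_def case_prod_beta by (intro continuous_intros)
qed

lemma w_measurable [measurable]: "w \<in> borel_measurable (lebesgue_on U)"
  using w_continuous sets_U by (rule continuous_imp_measurable_on_sets_lebesgue)

lemma space_M [simp]: "space M = U" and sets_M [measurable_cong]: "sets M = sets (lebesgue_on U)"
  by (auto simp: hmeasure_def)

text \<open>The weight is positive on the domain, so the weighted measure has the same null sets.\<close>

lemma AE_M: "(AE p in M. P p) \<longleftrightarrow> (AE p in lebesgue_on U. P p)"
proof -
  have "(AE p in M. P p) \<longleftrightarrow> (AE p in lebesgue_on U. 0 < ennreal (w p) \<longrightarrow> P p)"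
    unfolding hmeasure_def by (rule AE_density) measurable
  also have "\<dots> \<longleftrightarrow> (AE p in lebesgue_on U. P p)"
    by (rule AE_cong) (use w_pos in simp)
  finally show ?thesis .
qed

lemma integrable_M:
  fixes h :: "real \<times> real \<Rightarrow> real"
  assumes "h \<in> borel_measurable (lebesgue_on U)"
  shows "integrable M h \<longleftrightarrow> integrable (lebesgue_on U) (\<lambda>p. w p * h p)"
    "(LINT p|M. h p) = (LINT p|lebesgue_on U. w p * h p)"
proof -
  have nn: "AE p in lebesgue_on U. 0 \<le> w p"
    by (rule AE_I2) (use w_pos in \<open>auto intro: less_imp_le\<close>)
  show "integrable M h \<longleftrightarrow> integrable (lebesgue_on U) (\<lambda>p. w p * h p)"
    unfolding hmeasure_def by (subst integrable_density[OF assms w_measurable nn]) simp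
  show "(LINT p|M. h p) = (LINT p|lebesgue_on U. w p * h p)"
    unfolding hmeasure_def by (subst integral_density[OF assms w_measurable nn]) simp
qed

lemma lebesgue_on_set_integral:
  fixes h :: "real \<times> real \<Rightarrow> real"
  shows "integrable (lebesgue_on U) h \<longleftrightarrow> set_integrable lebesgue U h"
    "(LINT p|lebesgue_on U. h p) = (LINT p:U|lebesgue. h p)"
  using sets_U by (simp_all add: integrable_restrict_space integral_restrict_space
      set_integrable_def set_lebesgue_integral_def)

lemma H1_density_energy: "p \<in> U \<Longrightarrow> H1_density U u p = (norm (energy U u p))\<^sup>2"
  using snd_pos[of p]
  by (simp add: H1_density_def energy_def power2_norm_eq_inner power_mult_distrib
      power2_eq_square[symmetric] algebra_simps)

lemma H1_iff: "u \<in> H1_space A \<gamma> U \<longleftrightarrow> weakly_differentiable U u \<and> energy U u \<in> L2_fun M"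
proof -
  have "integrable M (H1_density U u) \<longleftrightarrow> integrable M (\<lambda>p. (norm (energy U u p))\<^sup>2)"
    by (rule Bochner_Integration.integrable_cong) (simp_all add: H1_density_energy)
  moreover have "energy U u \<in> borel_measurable M" if "weakly_differentiable U u"
    using energy_measurable[OF open_U that] by measurable
  ultimately show ?thesis
    unfolding H1_space_def L2_fun_def weakly_differentiable_def by auto
qed

lemma H1_norm_eq: "H1_norm A \<gamma> U u = L2.nrm M (energy U u)"
proof -
  have "(LINT p|M. H1_density U u p) = (LINT p|M. energy U u p \<bullet> energy U u p)"
    by (rule Bochner_Integration.integral_cong) (simp_all add: H1_density_energy power2_norm_eq_inner)
  then show ?thesis by (simp add: H1_norm_def L2.nrm_def L2_ip_def)
qed

lemma H1_lincomb:
  assumes "u \<in> H1_space A \<gamma> U" "v \<in> H1_space A \<gamma> U"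
  shows "(\<lambda>p. a * u p + b * v p) \<in> H1_space A \<gamma> U"
    "AE p in M. energy U (\<lambda>p. a * u p + b * v p) p = (a *\<^sub>R energy U u + b *\<^sub>R energy U v) p"
proof -
  have wd: "weakly_differentiable U u" "weakly_differentiable U v" using assms by (auto simp: H1_iff)
  have wd': "weakly_differentiable U (\<lambda>p. a * u p + b * v p)"
    by (rule weakly_differentiable_lincomb[OF open_U wd])
  show e: "AE p in M. energy U (\<lambda>p. a * u p + b * v p) p = (a *\<^sub>R energy U u + b *\<^sub>R energy U v) p"
    unfolding AE_M using energy_lincomb[OF open_U wd, of a b] by simp
  have [measurable]: "energy U (\<lambda>p. a * u p + b * v p) \<in> borel_measurable M"
    using energy_measurable[OF open_U wd'] by measurable
  have L: "a *\<^sub>R energy U u + b *\<^sub>R energy U v \<in> L2_fun M"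
    using assms by (intro L2.mem_add L2.mem_scale) (auto simp: H1_iff)
  then have [measurable]: "a *\<^sub>R energy U u + b *\<^sub>R energy U v \<in> borel_measurable M"
    by (simp add: L2_fun_def)
  have "integrable M (\<lambda>p. (norm (energy U (\<lambda>p. a * u p + b * v p) p))\<^sup>2)
      \<longleftrightarrow> integrable M (\<lambda>p. (norm ((a *\<^sub>R energy U u + b *\<^sub>R energy U v) p))\<^sup>2)"
    by (rule integrable_cong_AE) (measurable, use e in eventually_elim, simp)
  then have "energy U (\<lambda>p. a * u p + b * v p) \<in> L2_fun M"
    using L by (simp add: L2_fun_def)
  then show "(\<lambda>p. a * u p + b * v p) \<in> H1_space A \<gamma> U" using wd' by (simp add: H1_iff)
qed

text \<open>Functions are not identified when they agree almost everywhere, so identities for \<open>energy\<close>, which hold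
  only almost everywhere, are transported by this lemma.\<close>

lemma L2_fun_AE_cong:
  fixes X Y :: "real \<times> real \<Rightarrow> 'b::euclidean_space"
  assumes "X \<in> L2_fun M" "Y \<in> L2_fun M" "AE p in M. X p = Y p" "Z \<in> L2_fun M"
  shows "L2_ip M X Z = L2_ip M Y Z" "L2.nrm M X = L2.nrm M Y"
proof -
  have [measurable]: "X \<in> borel_measurable M" "Y \<in> borel_measurable M" "Z \<in> borel_measurable M"
    using assms by (auto simp: L2_fun_def)
  show "L2_ip M X Z = L2_ip M Y Z"
    unfolding L2_ip_def
    by (rule integral_cong_AE) (measurable, use assms(3) in eventually_elim, simp)
  show "L2.nrm M X = L2.nrm M Y"
    unfolding L2.nrm_def L2_ip_def
    by (rule arg_cong[where f = sqrt], rule integral_cong_AE) (measurable, use assms(3) in eventually_elim, simp)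
qed

definition H1_ip :: "(real \<times> real \<Rightarrow> real) \<Rightarrow> (real \<times> real \<Rightarrow> real) \<Rightarrow> real" where
  "H1_ip u v = L2_ip M (energy U u) (energy U v)"

lemma energy_L2: "u \<in> H1_space A \<gamma> U \<Longrightarrow> energy U u \<in> L2_fun M"
  by (simp add: H1_iff)

lemma H1_add:
  assumes "u \<in> H1_space A \<gamma> U" "v \<in> H1_space A \<gamma> U"
  shows "u + v \<in> H1_space A \<gamma> U" "AE p in M. energy U (u + v) p = (energy U u + energy U v) p"
  using H1_lincomb[OF assms, of 1 1] by (simp_all add: plus_fun_def)

lemma H1_scale:
  assumes "u \<in> H1_space A \<gamma> U"
  shows "c *\<^sub>R u \<in> H1_space A \<gamma> U" "AE p in M. energy U (c *\<^sub>R u) p = (c *\<^sub>R energy U u) p"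
  using H1_lincomb[OF assms assms, of c 0] by (simp_all add: plus_fun_def scaleR_fun_def)

lemma zero_weak_deriv: "has_weak_deriv U e (\<lambda>_. 0) (\<lambda>_. 0)"
  using classical_imp_weak_deriv[OF open_U, of "\<lambda>_. 0" "\<lambda>_. 0" "\<lambda>_. 0" e] by simp

lemma H1_zero: "0 \<in> H1_space A \<gamma> U"
proof -
  have wd: "weakly_differentiable U 0"
    using zero_weak_deriv by (auto simp: weakly_differentiable_def zero_fun_def)
  have "AE p in M. energy U 0 p = 0"
    unfolding AE_M using energy_AE_eq[OF open_U zero_weak_deriv zero_weak_deriv]
    by (simp add: zero_fun_def zero_prod_def)
  moreover have [measurable]: "energy U 0 \<in> borel_measurable M"
    using energy_measurable[OF open_U wd] by measurable
  ultimately have "integrable M (\<lambda>p. (norm (energy U 0 p))\<^sup>2)"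
    by (subst integrable_cong_AE[where g = "\<lambda>_. 0"]) (auto elim: eventually_mono)
  then show ?thesis using wd by (simp add: H1_iff L2_fun_def)
qed

end

sublocale heston_domain \<subseteq> H1: semi_inner_space "H1_space A \<gamma> U" H1_ip
proof
  show sub: "subspace (H1_space A \<gamma> U)"
    unfolding subspace_def using H1_zero H1_add(1) H1_scale(1) by blast
  have l: "linear_form_on (H1_space A \<gamma> U) (\<lambda>u. H1_ip u v)" if v: "v \<in> H1_space A \<gamma> U" for v
    unfolding linear_form_on_def
  proof (intro conjI ballI allI)
    fix u u' assume u: "u \<in> H1_space A \<gamma> U" "u' \<in> H1_space A \<gamma> U"
    have "H1_ip (u + u') v = L2_ip M (energy U u + energy U u') (energy U v)"
      unfolding H1_ip_def using u v
      by (intro L2_fun_AE_cong(1) H1_add(2) energy_L2 H1_add(1) L2.mem_add)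
    then show "H1_ip (u + u') v = H1_ip u v + H1_ip u' v"
      using u v by (simp add: L2.ip_simps energy_L2 H1_ip_def)
  next
    fix c u assume u: "u \<in> H1_space A \<gamma> U"
    have "H1_ip (c *\<^sub>R u) v = L2_ip M (c *\<^sub>R energy U u) (energy U v)"
      unfolding H1_ip_def using u v
      by (intro L2_fun_AE_cong(1) H1_scale(2) energy_L2 H1_scale(1) L2.mem_scale)
    then show "H1_ip (c *\<^sub>R u) v = c * H1_ip u v"
      using u v by (simp add: L2.ip_simps energy_L2 H1_ip_def)
  qed
  have sym: "H1_ip u v = H1_ip v u" for u v
    by (simp add: H1_ip_def L2_ip_def inner_commute)
  show "bilinear_form_on (H1_space A \<gamma> U) H1_ip"
    unfolding bilinear_form_on_def
  proof (intro conjI ballI l)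
    fix u assume "u \<in> H1_space A \<gamma> U"
    moreover have "H1_ip u = (\<lambda>v. H1_ip v u)" using sym by blast
    ultimately show "linear_form_on (H1_space A \<gamma> U) (H1_ip u)" using l by simp
  qed
  show "H1_ip u v = H1_ip v u" for u v by (rule sym)
  show "0 \<le> H1_ip u u" for u by (simp add: H1_ip_def L2_ip_def)
qed

context heston_domain begin

lemma H1_nrm: "H1.nrm u = H1_norm A \<gamma> U u"
  by (simp add: H1.nrm_def H1_norm_eq L2.nrm_def H1_ip_def)

lemma H1_diff_nrm:
  assumes "u \<in> H1_space A \<gamma> U" "v \<in> H1_space A \<gamma> U"
  shows "H1.nrm (u - v) = L2.nrm M (energy U u - energy U v)"
proof -
  have "AE p in M. energy U (u - v) p = (energy U u - energy U v) p"
    using H1_lincomb(2)[OF assms, of 1 "-1"] by (simp add: fun_diff_def)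
  moreover have "energy U u - energy U v \<in> L2_fun M" "energy U (u - v) \<in> L2_fun M"
    using assms by (auto intro: energy_L2)
  ultimately show ?thesis
    unfolding H1_nrm H1_norm_eq by (intro L2_fun_AE_cong(2)) 
qed

end

section \<open>Completeness of the weighted Sobolev space\<close>

lemma norm_fst: "norm (fst z) \<le> norm z" and norm_snd: "norm (snd z) \<le> norm z"
  using norm_fst_le[of "fst z" "snd z"] norm_snd_le[of "snd z" "fst z"] by simp_all

lemma L2_fun_mono:
  assumes "X \<in> borel_measurable M" "Y \<in> L2_fun M" "\<And>p. p \<in> space M \<Longrightarrow> norm (X p) \<le> norm (Y p)"
  shows "X \<in> L2_fun M" "L2.nrm M X \<le> L2.nrm M Y"
proof -
  have [measurable]: "X \<in> borel_measurable M" by (rule assms(1))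
  have le: "(norm (X p))\<^sup>2 \<le> (norm (Y p))\<^sup>2" if "p \<in> space M" for p
    using assms(3)[OF that] by (simp add: power_mono)
  have iY: "integrable M (\<lambda>p. (norm (Y p))\<^sup>2)" using assms(2) by (simp add: L2_fun_def)
  then have iX: "integrable M (\<lambda>p. (norm (X p))\<^sup>2)"
    by (rule Bochner_Integration.integrable_bound) (use le in auto)
  then show X: "X \<in> L2_fun M" by (simp add: L2_fun_def)
  have "(L2.nrm M X)\<^sup>2 \<le> (L2.nrm M Y)\<^sup>2"
    unfolding L2_nrm_sq[OF X] L2_nrm_sq[OF assms(2)] by (rule integral_mono[OF iX iY le])
  then show "L2.nrm M X \<le> L2.nrm M Y"
    by (rule power2_le_imp_le) (simp add: assms(2))
qed

lemma L2_weak_limit: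
  assumes "\<And>n. Y n \<in> L2_fun M" "Z \<in> L2_fun M" "(\<lambda>n. L2.nrm M (Y n - Z)) \<longlonglongrightarrow> 0" "\<zeta> \<in> L2_fun M"
  shows "(\<lambda>n. L2_ip M (Y n) \<zeta>) \<longlonglongrightarrow> L2_ip M Z \<zeta>"
proof (rule Lim_null[THEN iffD2])
  have "(\<lambda>n. L2.nrm M (Y n - Z) * L2.nrm M \<zeta>) \<longlonglongrightarrow> 0"
    using tendsto_mult_right[OF assms(3), of "L2.nrm M \<zeta>"] by simp
  moreover have "\<forall>\<^sub>F n in sequentially. norm (L2_ip M (Y n) \<zeta> - L2_ip M Z \<zeta>) \<le> L2.nrm M (Y n - Z) * L2.nrm M \<zeta>"
    using L2.Cauchy_Schwarz[of "Y _ - Z" M \<zeta>] assms by (simp add: L2.ip_simps)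
  ultimately show "(\<lambda>n. L2_ip M (Y n) \<zeta> - L2_ip M Z \<zeta>) \<longlonglongrightarrow> 0"
    by (rule Lim_null_comparison[rotated])
qed

context heston_domain begin

text \<open>With \<open>ab \<le> a\<^sup>2 + b\<^sup>2\<close> for \<open>a = sqrt w * \<bar>Y\<bar>\<close> and \<open>b = 1 / (sqrt w * s)\<close> the quotient is dominated
  by the sum of the integrable function \<open>w * Y\<^sup>2\<close> and a function that is continuous on \<open>U\<close>.\<close>

lemma L2_loc_integrable:
  fixes Y :: "real \<times> real \<Rightarrow> real"
  assumes Y: "Y \<in> L2_fun M" and s: "continuous_on U s" "\<And>p. p \<in> U \<Longrightarrow> 0 < s p"
  shows "loc_integrable U (\<lambda>p. Y p / s p)"
  unfolding loc_integrable_def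
proof (intro allI impI)
  fix K assume K: "compact K \<and> K \<subseteq> U"
  have Ks: "K \<in> sets lebesgue" using K lmeasurable_compact by (blast intro: fmeasurableD)
  have Ym: "Y \<in> borel_measurable (lebesgue_on U)" using Y by (auto simp: L2_fun_def) measurable
  have sm: "s \<in> borel_measurable (lebesgue_on U)"
    using s(1) sets_U by (rule continuous_imp_measurable_on_sets_lebesgue)
  have "(\<lambda>p. Y p / s p) \<in> borel_measurable (lebesgue_on K)"
    by (rule measurable_restrict_mono[of _ _ U]) (use Ym sm K in \<open>auto intro: borel_measurable_divide\<close>)
  then have m: "(\<lambda>p. indicat_real K p *\<^sub>R (Y p / s p)) \<in> borel_measurable lebesgue"
    using Ks by (subst (asm) borel_measurable_restrict_space_iff) auto
  have "integrable M (\<lambda>p. (Y p)\<^sup>2)" using Y by (simp add: L2_fun_def)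
  then have "integrable (lebesgue_on U) (\<lambda>p. w p * (Y p)\<^sup>2)"
    using Ym by (subst integrable_M(1)[symmetric]) auto
  then have 1: "set_integrable lebesgue K (\<lambda>p. w p * (Y p)\<^sup>2)"
    using Ks K unfolding lebesgue_on_set_integral by (auto intro: set_integrable_subset)
  have nz: "w p \<noteq> 0" "s p \<noteq> 0" if "p \<in> U" for p using w_pos[OF that] s(2)[OF that] by auto
  have "continuous_on U (\<lambda>p. 1 / (w p * (s p)\<^sup>2))"
    by (intro continuous_intros w_continuous s(1)) (use nz in auto)
  then have 2: "set_integrable lebesgue K (\<lambda>p. 1 / (w p * (s p)\<^sup>2))"
    using continuous_loc_integrable K by (auto simp: loc_integrable_def)
  show "(\<lambda>p. Y p / s p) absolutely_integrable_on K"
    unfolding set_integrable_def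
  proof (rule Bochner_Integration.integrable_bound[OF set_integral_add(1)[OF 1 2, unfolded set_integrable_def] m], rule always_eventually, rule allI)
    fix p
    show "norm (indicat_real K p *\<^sub>R (Y p / s p)) \<le> norm (indicat_real K p *\<^sub>R (w p * (Y p)\<^sup>2 + 1 / (w p * (s p)\<^sup>2)))"
    proof (cases "p \<in> K")
      case True
      then have pos: "0 < w p" "0 < s p" using K w_pos[of p] s(2)[of p] by auto
      let ?t = "\<bar>Y p\<bar> / s p"
      have "0 \<le> (w p * \<bar>Y p\<bar> - 1 / s p)\<^sup>2 / w p" using pos by simp
      also have "\<dots> = w p * (Y p)\<^sup>2 + 1 / (w p * (s p)\<^sup>2) - 2 * ?t"
        using pos by (simp add: power2_eq_square field_simps)
      finally have "2 * ?t \<le> w p * (Y p)\<^sup>2 + 1 / (w p * (s p)\<^sup>2)" by simp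
      moreover have "0 \<le> ?t" using pos by simp
      ultimately have "?t \<le> w p * (Y p)\<^sup>2 + 1 / (w p * (s p)\<^sup>2)" by linarith
      then show ?thesis using True pos by (simp add: abs_divide)
    qed simp
  qed
qed

text \<open>Testing a quotient \<open>Y / s\<close> against \<open>\<eta>\<close> in unweighted Lebesgue measure is the same as taking the weighted
  inner product of \<open>Y\<close> with \<open>\<eta> / (w * s)\<close>. As \<open>\<eta>\<close> has compact support in \<open>U\<close>, this is a
  square-integrable function, so such tests are continuous in the weighted norm.\<close>

lemma pairing_eq:
  fixes Y :: "real \<times> real \<Rightarrow> real"
  assumes s: "continuous_on U s" "\<And>p. p \<in> U \<Longrightarrow> 0 < s p"
    and \<eta>: "continuous_on U \<eta>" "compact S" "S \<subseteq> U" "\<And>p. p \<in> U \<Longrightarrow> p \<notin> S \<Longrightarrow> \<eta> p = 0"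
  shows "(\<lambda>p. \<eta> p / (w p * s p)) \<in> L2_fun M"
    "Y \<in> L2_fun M \<Longrightarrow> L2_ip M Y (\<lambda>p. \<eta> p / (w p * s p)) = (LINT p:U|lebesgue. Y p / s p * \<eta> p)"
proof -
  let ?\<zeta> = "\<lambda>p. \<eta> p / (w p * s p)"
  have nz: "w p \<noteq> 0" "s p \<noteq> 0" if "p \<in> U" for p using w_pos[OF that] s(2)[OF that] by auto
  have c: "continuous_on U ?\<zeta>" "continuous_on U (\<lambda>p. \<eta> p / (w p * (s p)\<^sup>2))"
    using nz by (auto intro!: continuous_intros w_continuous s(1) \<eta>(1))
  have \<zeta>m: "?\<zeta> \<in> borel_measurable (lebesgue_on U)"
    using c(1) sets_U by (rule continuous_imp_measurable_on_sets_lebesgue)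
  have "set_integrable lebesgue U (\<lambda>p. \<eta> p / (w p * (s p)\<^sup>2) * \<eta> p)"
    by (rule loc_integrable_mult_cpt[OF continuous_loc_integrable[OF c(2)] \<eta>])
  then have "integrable (lebesgue_on U) (\<lambda>p. \<eta> p / (w p * (s p)\<^sup>2) * \<eta> p)"
    by (simp add: lebesgue_on_set_integral)
  also have "?this \<longleftrightarrow> integrable (lebesgue_on U) (\<lambda>p. w p * (?\<zeta> p)\<^sup>2)"
    by (rule Bochner_Integration.integrable_cong) (use nz in \<open>auto simp: power2_eq_square field_simps\<close>)
  also have "\<dots> \<longleftrightarrow> integrable M (\<lambda>p. (?\<zeta> p)\<^sup>2)"
    by (rule integrable_M(1)[symmetric]) (use \<zeta>m in measurable)
  finally have "integrable M (\<lambda>p. (?\<zeta> p)\<^sup>2)" .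
  moreover have "?\<zeta> \<in> borel_measurable M" using \<zeta>m by measurable
  ultimately show "?\<zeta> \<in> L2_fun M" by (simp add: L2_fun_def)
  assume Y: "Y \<in> L2_fun M"
  then have Ym: "Y \<in> borel_measurable (lebesgue_on U)" by (auto simp: L2_fun_def) measurable
  have "L2_ip M Y ?\<zeta> = (LINT p|M. Y p * ?\<zeta> p)" by (simp add: L2_ip_def)
  also have "\<dots> = (LINT p|lebesgue_on U. w p * (Y p * ?\<zeta> p))"
    by (rule integrable_M(2)) (rule borel_measurable_times[OF Ym \<zeta>m])
  also have "\<dots> = (LINT p|lebesgue_on U. Y p / s p * \<eta> p)"
    by (rule Bochner_Integration.integral_cong) (use nz in \<open>auto simp: field_simps\<close>)
  finally show "L2_ip M Y ?\<zeta> = (LINT p:U|lebesgue. Y p / s p * \<eta> p)"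
    by (simp add: lebesgue_on_set_integral)
qed

text \<open>Both sides of the integration by parts formula are inner products with fixed square-integrable functions
  (\<open>pairing_eq\<close>), so they pass to the limit. The factors \<open>a\<close> and \<open>b\<close> stand for \<open>sqrt (1 + y)\<close> and
  \<open>sqrt y\<close>.\<close>

lemma weak_deriv_limit:
  fixes u g :: "nat \<Rightarrow> real \<times> real \<Rightarrow> real" and Y Z :: "real \<times> real \<Rightarrow> real"
  assumes wd: "\<And>n. has_weak_deriv U e (u n) (g n)"
    and a: "continuous_on U a" "\<And>p. p \<in> U \<Longrightarrow> 0 < a p"
    and b: "continuous_on U b" "\<And>p. p \<in> U \<Longrightarrow> 0 < b p"
    and Y: "\<And>n. (\<lambda>p. a p * u n p) \<in> L2_fun M" "Y \<in> L2_fun M"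
      "(\<lambda>n. L2.nrm M ((\<lambda>p. a p * u n p) - Y)) \<longlonglongrightarrow> 0"
    and Z: "\<And>n. (\<lambda>p. b p * g n p) \<in> L2_fun M" "Z \<in> L2_fun M"
      "(\<lambda>n. L2.nrm M ((\<lambda>p. b p * g n p) - Z)) \<longlonglongrightarrow> 0"
  shows "has_weak_deriv U e (\<lambda>p. Y p / a p) (\<lambda>p. Z p / b p)"
  unfolding has_weak_deriv_def
proof (intro conjI ballI)
  show "loc_integrable U (\<lambda>p. Y p / a p)" by (rule L2_loc_integrable[OF Y(2) a])
  show "loc_integrable U (\<lambda>p. Z p / b p)" by (rule L2_loc_integrable[OF Z(2) b])
  have lim: "(\<lambda>n. LINT p:U|lebesgue. v n p * \<eta> p) \<longlonglongrightarrow> (LINT p:U|lebesgue. X p / s p * \<eta> p)"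
    if s: "continuous_on U s" "\<And>p. p \<in> U \<Longrightarrow> 0 < s p"
      and X: "\<And>n. (\<lambda>p. s p * v n p) \<in> L2_fun M" "X \<in> L2_fun M"
        "(\<lambda>n. L2.nrm M ((\<lambda>p. s p * v n p) - X)) \<longlonglongrightarrow> 0"
      and \<eta>: "continuous_on U \<eta>" "compact S" "S \<subseteq> U" "\<And>p. p \<in> U \<Longrightarrow> p \<notin> S \<Longrightarrow> \<eta> p = 0"
    for s \<eta> S and v :: "nat \<Rightarrow> real \<times> real \<Rightarrow> real" and X :: "real \<times> real \<Rightarrow> real"
  proof -
    have "(LINT p:U|lebesgue. s p * v n p / s p * \<eta> p) = (LINT p:U|lebesgue. v n p * \<eta> p)" for n
      by (rule set_lebesgue_integral_cong) (use sets_U s(2) in \<open>force+\<close>)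
    then show ?thesis
      using L2_weak_limit[OF X pairing_eq(1)[OF s \<eta>]]
      by (simp add: pairing_eq(2)[OF s \<eta>] X(1,2))
  qed
  fix \<phi> assume \<phi>: "\<phi> \<in> Cinf_cpt U U"
  obtain S where S: "compact S" "S \<subseteq> U" "\<And>p. p \<notin> S \<Longrightarrow> \<phi> p = 0" "continuous_on U \<phi>"
    "continuous_on U (\<lambda>p. frechet_derivative \<phi> (at p) e)"
    "\<And>p. p \<in> U \<Longrightarrow> p \<notin> S \<Longrightarrow> frechet_derivative \<phi> (at p) e = 0"
    by (rule test_function_directional_derivative[OF open_U \<phi>, of e]) (rule that)
  have 1: "(\<lambda>n. LINT p:U|lebesgue. u n p * frechet_derivative \<phi> (at p) e)
      \<longlonglongrightarrow> (LINT p:U|lebesgue. Y p / a p * frechet_derivative \<phi> (at p) e)"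
    by (rule lim[OF a Y S(5,1,2,6)])
  have 2: "(\<lambda>n. LINT p:U|lebesgue. g n p * \<phi> p) \<longlonglongrightarrow> (LINT p:U|lebesgue. Z p / b p * \<phi> p)"
    by (rule lim[OF b Z S(4,1,2)]) (simp_all add: S(3))
  have "(LINT p:U|lebesgue. u n p * frechet_derivative \<phi> (at p) e) = - (LINT p:U|lebesgue. g n p * \<phi> p)" for n
    using wd[of n] \<phi> by (simp add: has_weak_deriv_def)
  then show "(LINT p:U|lebesgue. Y p / a p * frechet_derivative \<phi> (at p) e) = - (LINT p:U|lebesgue. Z p / b p * \<phi> p)"
    using LIMSEQ_unique[OF 1] tendsto_minus[OF 2] by simp
qed

text \<open>The energy vectors form a Cauchy sequence in \<open>L2\<close>. Dividing the components of their limit by \<open>sqrt y\<close>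
  and \<open>sqrt (1 + y)\<close> gives a function with its weak derivatives. The almost everywhere convergent
  subsequence is used for the closedness of the obstacle set.\<close>

lemma H1_complete:
  assumes s: "\<And>n. s n \<in> H1_space A \<gamma> U"
    and Cauchy: "\<And>\<epsilon>. 0 < \<epsilon> \<Longrightarrow> \<exists>N. \<forall>m\<ge>N. \<forall>n\<ge>N. H1.nrm (s m - s n) < \<epsilon>"
  obtains u r where "u \<in> H1_space A \<gamma> U" "(\<lambda>n. H1.nrm (s n - u)) \<longlonglongrightarrow> 0"
    "strict_mono (r :: nat \<Rightarrow> nat)" "AE p in lebesgue_on U. (\<lambda>k. s (r k) p) \<longlonglongrightarrow> u p"
proof -
  let ?E = "\<lambda>n. energy U (s n)"
  have E: "?E n \<in> L2_fun M" for n using energy_L2[OF s] .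
  have "\<exists>N. \<forall>m\<ge>N. \<forall>n\<ge>N. L2.nrm M (?E m - ?E n) < \<epsilon>" if "0 < \<epsilon>" for \<epsilon>
    using Cauchy[OF that] s by (simp add: H1_diff_nrm)
  from L2_Cauchy_limit[of ?E M, OF E this]
  obtain X r where X: "X \<in> L2_fun M" "(\<lambda>n. L2.nrm M (?E n - X)) \<longlonglongrightarrow> 0"
    "strict_mono (r :: nat \<Rightarrow> nat)" "AE p in M. (\<lambda>k. ?E (r k) p) \<longlonglongrightarrow> X p" by blast
  have wd: "weakly_differentiable U (s n)" for n using s by (simp add: H1_iff)
  have gx: "has_weak_deriv U (1, 0) (s n) (wdx U (s n))" and gy: "has_weak_deriv U (0, 1) (s n) (wdy U (s n))" for n
    using wd[of n] weak_deriv_AE_eq(1)[OF open_U] unfolding weakly_differentiable_def by blast+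
  let ?a = "\<lambda>p::real \<times> real. sqrt (1 + snd p)" and ?b = "\<lambda>p::real \<times> real. sqrt (snd p)"
  have ab: "continuous_on U ?a" "continuous_on U ?b" by (intro continuous_intros)+
  have ab_pos: "0 < ?a p" "0 < ?b p" if "p \<in> U" for p using snd_pos[OF that] by simp_all
  have Xm [measurable]: "X \<in> borel_measurable M" using X(1) by (simp add: L2_fun_def)
  have Em [measurable]: "?E n \<in> borel_measurable M" for n using E[of n] by (simp add: L2_fun_def)
  have comp: "(\<lambda>p. c (?E n p)) \<in> L2_fun M" "(\<lambda>p. c (X p)) \<in> L2_fun M"
    "(\<lambda>n. L2.nrm M ((\<lambda>p. c (?E n p)) - (\<lambda>p. c (X p)))) \<longlonglongrightarrow> 0"
    if c: "bounded_linear c" "\<And>x. norm (c x) \<le> norm x" for c :: "real \<times> real \<times> real \<Rightarrow> real" and n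
  proof -
    have cm: "c \<in> borel_measurable borel"
      by (intro borel_measurable_continuous_onI linear_continuous_on c(1))
    have m: "(\<lambda>p. c (?E n p)) \<in> borel_measurable M" "(\<lambda>p. c (X p)) \<in> borel_measurable M" for n
      using measurable_compose[OF Em cm] measurable_compose[OF Xm cm] by auto
    show 1: "(\<lambda>p. c (?E n p)) \<in> L2_fun M" "(\<lambda>p. c (X p)) \<in> L2_fun M" for n
      using L2_fun_mono(1)[OF m(1) E c(2)] L2_fun_mono(1)[OF m(2) X(1) c(2)] by auto
    have le: "L2.nrm M ((\<lambda>p. c (?E n p)) - (\<lambda>p. c (X p))) \<le> L2.nrm M (?E n - X)" for n
    proof (rule L2_fun_mono(2))
      show "(\<lambda>p. c (?E n p)) - (\<lambda>p. c (X p)) \<in> borel_measurable M"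
        unfolding fun_diff_def using m by (intro borel_measurable_diff)
      show "?E n - X \<in> L2_fun M" using E X(1) by simp
      show "norm (((\<lambda>p. c (?E n p)) - (\<lambda>p. c (X p))) p) \<le> norm ((?E n - X) p)" for p
        using c(2)[of "?E n p - X p"] linear_diff[OF bounded_linear.linear[OF c(1)]] by simp
    qed
    show "(\<lambda>n. L2.nrm M ((\<lambda>p. c (?E n p)) - (\<lambda>p. c (X p)))) \<longlonglongrightarrow> 0"
      by (rule tendsto_sandwich[OF _ _ tendsto_const X(2)]) (use le 1 in simp_all)
  qed
  have n1: "bounded_linear (fst :: real \<times> real \<times> real \<Rightarrow> real)" "norm (fst x) \<le> norm x"
    and n2: "bounded_linear (\<lambda>x. fst (snd x) :: real)" "norm (fst (snd x)) \<le> norm x"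
    and n3: "bounded_linear (\<lambda>x. snd (snd x) :: real)" "norm (snd (snd x)) \<le> norm x" for x :: "real \<times> real \<times> real"
    by (auto intro: bounded_linear_fst bounded_linear_snd bounded_linear_fst_comp bounded_linear_snd_comp
        norm_fst norm_snd order_trans[OF norm_fst norm_snd] order_trans[OF norm_snd norm_snd] simp del: real_norm_def)
  note c1 = comp[OF n1, unfolded energy_def fst_conv]
    and c2 = comp[OF n2, unfolded energy_def fst_conv snd_conv]
    and c3 = comp[OF n3, unfolded energy_def snd_conv]
  define u where "u p = snd (snd (X p)) / ?a p" for p
  define ux where "ux p = fst (X p) / ?b p" for p
  define uy where "uy p = fst (snd (X p)) / ?b p" for p
  have ux: "has_weak_deriv U (1, 0) u ux"
    unfolding u_def[abs_def] ux_def[abs_def]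
    by (rule weak_deriv_limit[OF gx ab(1) ab_pos(1) ab(2) ab_pos(2) c3 c1])
  have uy: "has_weak_deriv U (0, 1) u uy"
    unfolding u_def[abs_def] uy_def[abs_def]
    by (rule weak_deriv_limit[OF gy ab(1) ab_pos(1) ab(2) ab_pos(2) c3 c2])
  have wdu: "weakly_differentiable U u" using ux uy unfolding weakly_differentiable_def by blast
  have "AE p in lebesgue_on U. p \<in> U" by (rule AE_I2) simp
  then have "AE p in lebesgue_on U. energy U u p = X p"
    using energy_AE_eq[OF open_U ux uy]
  proof eventually_elim
    case (elim p)
    then show ?case using ab_pos[of p] by (simp add: u_def ux_def uy_def)
  qed
  then have eX: "AE p in M. energy U u p = X p" by (simp add: AE_M)
  have eum [measurable]: "energy U u \<in> borel_measurable M"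
    using energy_measurable[OF open_U wdu] by measurable
  have "integrable M (\<lambda>p. (norm (energy U u p))\<^sup>2) \<longleftrightarrow> integrable M (\<lambda>p. (norm (X p))\<^sup>2)"
    by (rule integrable_cong_AE) (measurable, use eX in eventually_elim, simp)
  then have eL: "energy U u \<in> L2_fun M" using X(1) by (simp add: L2_fun_def)
  then have uH: "u \<in> H1_space A \<gamma> U" using wdu by (simp add: H1_iff)
  have "H1.nrm (s n - u) = L2.nrm M (?E n - X)" for n
    unfolding H1_diff_nrm[OF s uH]
  proof (rule L2_fun_AE_cong(2))
    show "AE p in M. (?E n - energy U u) p = (?E n - X) p" using eX by eventually_elim simp
  qed (use E eL X(1) in auto)
  then have lim: "(\<lambda>n. H1.nrm (s n - u)) \<longlonglongrightarrow> 0" using X(2) by simp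
  have "AE p in lebesgue_on U. (\<lambda>k. ?E (r k) p) \<longlonglongrightarrow> X p" using X(4) by (simp add: AE_M)
  with \<open>AE p in lebesgue_on U. p \<in> U\<close> have "AE p in lebesgue_on U. (\<lambda>k. s (r k) p) \<longlonglongrightarrow> u p"
  proof eventually_elim
    case (elim p)
    have "(\<lambda>k. snd (snd (?E (r k) p)) / ?a p) \<longlonglongrightarrow> snd (snd (X p)) / ?a p"
      by (intro tendsto_intros elim(2)) (use ab_pos(1)[OF elim(1)] in auto)
    then show ?case using ab_pos(1)[OF elim(1)] by (simp add: energy_def u_def)
  qed
  then show ?thesis using that uH lim X(3) by blast
qed

end

section \<open>Test functions, their closure, and the obstacle set\<close>

lemma Cinf_cpt_lincomb:
  assumes "\<phi> \<in> Cinf_cpt U T" "\<psi> \<in> Cinf_cpt U T"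
  shows "(\<lambda>p. a * \<phi> p + b * \<psi> p) \<in> Cinf_cpt U T"
proof -
  let ?c = "closure {p. \<phi> p \<noteq> 0} \<union> closure {p. \<psi> p \<noteq> 0}"
  have c: "compact ?c" "?c \<subseteq> T" using assms by (auto simp: Cinf_cpt_def)
  have sub: "closure {p. a * \<phi> p + b * \<psi> p \<noteq> 0} \<subseteq> ?c"
  proof (rule closure_minimal)
    show "{p. a * \<phi> p + b * \<psi> p \<noteq> 0} \<subseteq> ?c"
      by (rule order_trans[OF _ Un_mono[OF closure_subset closure_subset]]) auto
  qed auto
  then have "compact (closure {p. a * \<phi> p + b * \<psi> p \<noteq> 0})"
    using compact_Int_closed[OF c(1) closed_closure, of "{p. a * \<phi> p + b * \<psi> p \<noteq> 0}"]
    by (simp add: Int_absorb1)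
  moreover have "Ck_upto k U T (\<lambda>p. a * \<phi> p + b * \<psi> p)" for k
    using assms by (intro Ck_upto_add Ck_upto_mult Ck_upto_const) (auto simp: Cinf_cpt_def)
  ultimately show ?thesis using order_trans[OF sub c(2)] by (simp add: Cinf_cpt_def)
qed

lemma zero_Cinf_cpt: "0 \<in> Cinf_cpt U T"
  using Ck_upto_const[of _ U T 0] by (simp add: Cinf_cpt_def zero_fun_def)

context heston_domain begin

text \<open>The exponential factor of the weight is at most one, and \<open>y powr (\<beta> - 1)\<close> is integrable down to
  \<open>y = 0\<close> since \<open>\<beta> > 0\<close>. The compact set may touch the boundary of the half-plane.\<close>

lemma weight_integrable_compact:
  assumes "compact S"
  shows "integrable M (indicator S :: _ \<Rightarrow> real)"
proof -
  obtain R where R: "\<And>p. p \<in> S \<Longrightarrow> norm p \<le> R" "0 \<le> R"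
    using compact_imp_bounded[OF assms] unfolding bounded_pos by (meson less_imp_le)
  have \<beta>: "hbeta A - 1 > -1" and \<mu>: "0 \<le> hmu A"
    using coeffs by (simp_all add: heston_coeffs_def hbeta_def hmu_def)
  let ?g = "\<lambda>p::real \<times> real. indicator ({-R..R} \<times> {0..R}) p * snd p powr (hbeta A - 1)"
  have g: "integrable lborel ?g" by (rule powr_integrable_strip[OF \<beta> R(2)])
  then have "integrable lebesgue ?g"
    by (subst integrable_completion) (auto dest: borel_measurable_integrable)
  then have gU: "integrable (lebesgue_on U) ?g"
    unfolding lebesgue_on_set_integral set_integrable_def by (rule integrable_mult_indicator[OF sets_U])
  have S: "S \<in> sets lebesgue" using lmeasurable_compact[OF assms] by (rule fmeasurableD)
  then have m: "(indicator S :: _ \<Rightarrow> real) \<in> borel_measurable (lebesgue_on U)"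
    by (intro measurable_restrict_space1) auto
  have "integrable (lebesgue_on U) (\<lambda>p. w p * indicator S p)"
  proof (rule Bochner_Integration.integrable_bound[OF gU])
    show "AE p in lebesgue_on U. norm (w p * indicator S p) \<le> norm (?g p)"
    proof (rule AE_I2)
      fix p assume "p \<in> space (lebesgue_on U)"
      then have p: "p \<in> U" by simp
      show "norm (w p * indicator S p) \<le> norm (?g p)"
      proof (cases "p \<in> S")
        case True
        have "norm p \<le> R" by (rule R(1)[OF True])
        then have "\<bar>fst p\<bar> \<le> R" "\<bar>snd p\<bar> \<le> R"
          using norm_fst[of p] norm_snd[of p] by auto
        then have i: "p \<in> {-R..R} \<times> {0..R}" using snd_pos[OF p] by (cases p) auto
        have "- \<gamma> * \<bar>fst p\<bar> - hmu A * snd p \<le> 0"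
        proof -
          have "0 \<le> \<gamma> * \<bar>fst p\<bar>" "0 \<le> hmu A * snd p" using \<gamma>_pos \<mu> snd_pos[OF p] by simp_all
          then show ?thesis by simp
        qed
        then have "snd p powr (hbeta A - 1) * exp (- \<gamma> * \<bar>fst p\<bar> - hmu A * snd p) \<le> snd p powr (hbeta A - 1)"
          by (intro mult_right_le_one_le) auto
        then have "w p \<le> ?g p" using i by (simp add: hweight_def case_prod_beta)
        then show ?thesis using True w_pos[OF p] by simp
      qed simp
    qed
  qed (use m in measurable)
  then show ?thesis using integrable_M(1)[OF m] by simp
qed

text \<open>The energy vector of a test function is bounded, because the derivatives extend continuously to the
  compact support, and it vanishes off that support, which has finite weighted measure.\<close>

lemma test_function_in_H1:
  assumes \<phi>: "\<phi> \<in> Cinf_cpt U T" and "U \<subseteq> T"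
  shows "\<phi> \<in> H1_space A \<gamma> U"
proof -
  obtain S fx fy where S: "compact S" "S \<subseteq> T" "\<And>p. p \<notin> S \<Longrightarrow> \<phi> p = 0" "continuous_on T \<phi>"
    "\<And>p. p \<in> U \<Longrightarrow> (\<phi> has_derivative (\<lambda>h. fx p * fst h + fy p * snd h)) (at p)"
    "continuous_on T fx" "continuous_on T fy"
    "\<And>p. p \<in> U \<Longrightarrow> p \<notin> S \<Longrightarrow> fx p = 0" "\<And>p. p \<in> U \<Longrightarrow> p \<notin> S \<Longrightarrow> fy p = 0"
    by (rule test_function_derivative[OF open_U \<phi>]) (rule that)
  have c: "continuous_on U \<phi>" "continuous_on U fx" "continuous_on U fy"
    using S(4,6,7) assms(2) by (auto intro: continuous_on_subset)
  note d = classical_imp_weak_deriv[OF open_U c S(5)]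
  have dx: "has_weak_deriv U (1, 0) \<phi> fx" and dy: "has_weak_deriv U (0, 1) \<phi> fy"
    using d[of "(1, 0)"] d[of "(0, 1)"] by simp_all
  let ?G = "\<lambda>p. (sqrt (snd p) * fx p, sqrt (snd p) * fy p, sqrt (1 + snd p) * \<phi> p)"
  have "continuous_on S ?G"
    using S(2,4,6,7) by (intro continuous_intros) (auto intro: continuous_on_subset)
  then have "bounded (?G ` S)" using S(1) compact_continuous_image compact_imp_bounded by blast
  then obtain C where C: "\<And>p. p \<in> S \<Longrightarrow> norm (?G p) \<le> C" by (auto simp: bounded_iff)
  have wd: "weakly_differentiable U \<phi>" using dx dy unfolding weakly_differentiable_def by blast
  have [measurable]: "energy U \<phi> \<in> borel_measurable M"
    using energy_measurable[OF open_U wd] by measurable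
  have inU: "AE p in M. p \<in> U" by (rule AE_I2) simp
  have eq: "AE p in M. energy U \<phi> p = ?G p"
    unfolding AE_M by (rule energy_AE_eq[OF open_U dx dy])
  have "integrable M (\<lambda>p. (norm (energy U \<phi> p))\<^sup>2)"
  proof (rule Bochner_Integration.integrable_bound)
    show "integrable M (\<lambda>p. indicator S p * C\<^sup>2)"
      by (intro integrable_mult_left weight_integrable_compact S(1))
    show "AE p in M. norm ((norm (energy U \<phi> p))\<^sup>2) \<le> norm (indicator S p * C\<^sup>2)"
      using eq inU
    proof eventually_elim
      case (elim p)
      show ?case
      proof (cases "p \<in> S")
        case True
        then have "(norm (?G p))\<^sup>2 \<le> C\<^sup>2" using C by (intro power_mono) auto
        then show ?thesis using True elim(1) by simp
      next
        case False
        then have "?G p = 0" using S(3,8,9) elim(2) by (simp add: zero_prod_def)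
        then show ?thesis using elim(1) by simp
      qed
    qed
  qed simp
  then show ?thesis using wd by (simp add: H1_iff L2_fun_def)
qed

abbreviation "C0 \<equiv> Cinf_cpt U (U \<union> Gamma0 U)"
abbreviation "V \<equiv> H10_space A \<gamma> U"

lemma C0_H1: "\<phi> \<in> C0 \<Longrightarrow> \<phi> \<in> H1_space A \<gamma> U"
  by (rule test_function_in_H1) auto

lemma H10_iff: "u \<in> V \<longleftrightarrow> u \<in> H1_space A \<gamma> U \<and> (\<forall>\<epsilon>>0. \<exists>\<phi>\<in>C0. H1.nrm (u - \<phi>) < \<epsilon>)"
  unfolding H10_space_def H1_nrm fun_diff_def by simp

lemma H10_H1: "u \<in> V \<Longrightarrow> u \<in> H1_space A \<gamma> U"
  by (simp add: H10_iff)

lemma H10_add: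
  assumes "u \<in> V" "v \<in> V"
  shows "u + v \<in> V"
  unfolding H10_iff
proof (intro conjI allI impI)
  have H: "u \<in> H1_space A \<gamma> U" "v \<in> H1_space A \<gamma> U" using assms by (simp_all add: H10_H1)
  then show "u + v \<in> H1_space A \<gamma> U" by simp
  fix \<epsilon> :: real assume "0 < \<epsilon>"
  then obtain \<phi> \<psi> where *: "\<phi> \<in> C0" "H1.nrm (u - \<phi>) < \<epsilon> / 2" "\<psi> \<in> C0" "H1.nrm (v - \<psi>) < \<epsilon> / 2"
    using assms half_gt_zero[of \<epsilon>] unfolding H10_iff by meson
  have "\<phi> + \<psi> \<in> C0" using Cinf_cpt_lincomb[OF *(1,3), of 1 1] by (simp add: plus_fun_def)
  moreover have "H1.nrm (u + v - (\<phi> + \<psi>)) < \<epsilon>"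
  proof -
    have "u + v - (\<phi> + \<psi>) = (u - \<phi>) + (v - \<psi>)" by (rule add_diff_add)
    then have "H1.nrm (u + v - (\<phi> + \<psi>)) \<le> H1.nrm (u - \<phi>) + H1.nrm (v - \<psi>)"
      using H1.nrm_triangle[OF H1.mem_diff[OF H(1) C0_H1[OF *(1)]] H1.mem_diff[OF H(2) C0_H1[OF *(3)]]] by (simp only:)
    then show ?thesis using *(2,4) by linarith
  qed
  ultimately show "\<exists>\<xi>\<in>C0. H1.nrm (u + v - \<xi>) < \<epsilon>" by blast
qed

lemma H1_nrm_scale: "u \<in> H1_space A \<gamma> U \<Longrightarrow> H1.nrm (c *\<^sub>R u) = \<bar>c\<bar> * H1.nrm u"
  by (simp add: H1.nrm_def H1.ip_simps real_sqrt_mult mult.assoc[symmetric])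

lemma H10_scale:
  assumes "u \<in> V"
  shows "c *\<^sub>R u \<in> V"
  unfolding H10_iff
proof (intro conjI allI impI)
  have H: "u \<in> H1_space A \<gamma> U" using assms by (simp add: H10_H1)
  then show "c *\<^sub>R u \<in> H1_space A \<gamma> U" by simp
  fix \<epsilon> :: real assume e: "0 < \<epsilon>"
  have c: "0 < \<bar>c\<bar> + 1" by simp
  then have "0 < \<epsilon> / (\<bar>c\<bar> + 1)" using e by simp
  then obtain \<phi> where \<phi>: "\<phi> \<in> C0" "H1.nrm (u - \<phi>) < \<epsilon> / (\<bar>c\<bar> + 1)"
    using assms unfolding H10_iff by meson
  have d: "u - \<phi> \<in> H1_space A \<gamma> U" using H C0_H1[OF \<phi>(1)] by simp
  have "c *\<^sub>R \<phi> \<in> C0" using Cinf_cpt_lincomb[OF \<phi>(1,1), of c 0] by (simp add: scaleR_fun_def)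
  moreover have "H1.nrm (c *\<^sub>R u - c *\<^sub>R \<phi>) < \<epsilon>"
  proof -
    have "H1.nrm (c *\<^sub>R u - c *\<^sub>R \<phi>) = \<bar>c\<bar> * H1.nrm (u - \<phi>)"
      using H1_nrm_scale[OF d, of c] by (simp add: scaleR_diff_right)
    also have "\<dots> \<le> (\<bar>c\<bar> + 1) * H1.nrm (u - \<phi>)" using d by (intro mult_right_mono) auto
    also have "\<dots> < \<epsilon>" using \<phi>(2) c by (simp add: pos_less_divide_eq mult.commute)
    finally show ?thesis .
  qed
  ultimately show "\<exists>\<xi>\<in>C0. H1.nrm (c *\<^sub>R u - \<xi>) < \<epsilon>" by blast
qed

lemma H10_zero: "0 \<in> V"
  unfolding H10_iff using H1_zero by (intro conjI allI impI bexI[OF _ zero_Cinf_cpt]) simp_all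

lemma H10_closed:
  assumes "\<And>n. s n \<in> V" "u \<in> H1_space A \<gamma> U" "(\<lambda>n. H1.nrm (s n - u)) \<longlonglongrightarrow> 0"
  shows "u \<in> V"
  unfolding H10_iff
proof (intro conjI allI impI assms(2))
  fix \<epsilon> :: real assume "0 < \<epsilon>"
  then have "\<forall>\<^sub>F n in sequentially. H1.nrm (s n - u) < \<epsilon> / 2"
    by (intro order_tendstoD(2)[OF assms(3)]) simp
  then obtain n where n: "H1.nrm (s n - u) < \<epsilon> / 2" by (auto simp: eventually_sequentially)
  obtain \<phi> where \<phi>: "\<phi> \<in> C0" "H1.nrm (s n - \<phi>) < \<epsilon> / 2"
    using assms(1)[of n] \<open>0 < \<epsilon>\<close> half_gt_zero[of \<epsilon>] unfolding H10_iff by meson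
  have H: "s n \<in> H1_space A \<gamma> U" "\<phi> \<in> H1_space A \<gamma> U" using assms(1) \<phi>(1) by (auto intro: H10_H1 C0_H1)
  have "H1.nrm (u - \<phi>) \<le> H1.nrm (s n - u) + H1.nrm (s n - \<phi>)"
    using H1.nrm_triangle_diff[OF assms(2) H] H1.nrm_minus[OF assms(2) H(1)] by simp
  then show "\<exists>\<phi>\<in>C0. H1.nrm (u - \<phi>) < \<epsilon>" using \<phi> n by force
qed

end

sublocale heston_domain \<subseteq> H10: semi_inner_space "H10_space A \<gamma> U" H1_ip
proof
  show "subspace V" unfolding subspace_def using H10_add H10_scale H10_zero by blast
  show "bilinear_form_on V H1_ip"
    using H1.ip_bilinear H10_H1 unfolding bilinear_form_on_def linear_form_on_def by blast
qed (auto intro: H1.ip_sym H1.ip_nonneg H10_H1)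

context heston_domain begin

lemma obstacle_set_subset: "obstacle_set A \<gamma> U \<psi> \<subseteq> V"
  by (auto simp: obstacle_set_def)

lemma obstacle_set_convex: "convex (obstacle_set A \<gamma> U \<psi>)"
  unfolding convex_def
proof (intro ballI allI impI)
  fix u v and a b :: real
  assume uv: "u \<in> obstacle_set A \<gamma> U \<psi>" "v \<in> obstacle_set A \<gamma> U \<psi>" and ab: "0 \<le> a" "0 \<le> b" "a + b = 1"
  have "AE p in lebesgue_on U. u p \<ge> \<psi> p" "AE p in lebesgue_on U. v p \<ge> \<psi> p"
    using uv by (auto simp: obstacle_set_def)
  then have "AE p in lebesgue_on U. (a *\<^sub>R u + b *\<^sub>R v) p \<ge> \<psi> p"
  proof eventually_elim
    case (elim p)
    have "\<psi> p = a * \<psi> p + b * \<psi> p" using ab(3) by (simp add: distrib_right[symmetric])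
    also have "\<dots> \<le> a * u p + b * v p" using elim ab by (intro add_mono mult_left_mono)
    finally show ?case by simp
  qed
  then show "a *\<^sub>R u + b *\<^sub>R v \<in> obstacle_set A \<gamma> U \<psi>"
    using uv by (auto simp: obstacle_set_def)
qed

text \<open>The constraint \<open>v \<ge> \<psi>\<close> passes to the limit along an almost everywhere convergent subsequence.\<close>

lemma obstacle_set_complete: "H10.complete_on (obstacle_set A \<gamma> U \<psi>)"
  unfolding H10.complete_on_def
proof (intro allI impI)
  fix s :: "nat \<Rightarrow> real \<times> real \<Rightarrow> real"
  assume s: "\<forall>n. s n \<in> obstacle_set A \<gamma> U \<psi>"
    and C: "\<forall>\<epsilon>>0. \<exists>N. \<forall>m\<ge>N. \<forall>n\<ge>N. H1.nrm (s m - s n) < \<epsilon>"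
  have sV: "s n \<in> V" for n using s by (simp add: obstacle_set_def)
  obtain u r where u: "u \<in> H1_space A \<gamma> U" "(\<lambda>n. H1.nrm (s n - u)) \<longlonglongrightarrow> 0"
    "strict_mono (r :: nat \<Rightarrow> nat)" "AE p in lebesgue_on U. (\<lambda>k. s (r k) p) \<longlonglongrightarrow> u p"
    by (rule H1_complete[of s]) (use sV H10_H1 C in simp_all)
  have "AE p in lebesgue_on U. \<forall>k. s (r k) p \<ge> \<psi> p"
    using s by (subst AE_all_countable) (simp add: obstacle_set_def)
  with u(4) have "AE p in lebesgue_on U. u p \<ge> \<psi> p"
  proof eventually_elim
    case (elim p)
    show ?case by (rule LIMSEQ_le_const[OF elim(1)]) (use elim(2) in auto)
  qed
  then have "u \<in> obstacle_set A \<gamma> U \<psi>"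
    using H10_closed[OF sV u(1,2)] by (simp add: obstacle_set_def)
  then show "\<exists>u\<in>obstacle_set A \<gamma> U \<psi>. (\<lambda>n. H1.nrm (s n - u)) \<longlonglongrightarrow> 0" using u(2) by blast
qed

end

section \<open>Pointwise estimates for the integrand of the Heston form\<close>

text \<open>The integrand of the shifted Heston form as a function of two energy vectors. A factor \<open>y\<close> in a
  first-order term becomes \<open>sqrt (y / (1 + y))\<close>, as \<open>sqrt y\<close> is part of the derivative component and
  \<open>sqrt (1 + y)\<close> of the last one; this factor is at most one.\<close>

definition form_density :: "heston \<Rightarrow> real \<Rightarrow> real \<Rightarrow> real \<times> real \<Rightarrow> real \<times> real \<times> real \<Rightarrow> real \<times> real \<times> real \<Rightarrow> real" where
  "form_density A \<gamma> l = (\<lambda>(x, y) (\<xi>1, \<xi>2, \<xi>0) (\<eta>1, \<eta>2, \<eta>0).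
     1/2 * (\<xi>1 * \<eta>1 + hrho A * hsigma A * \<xi>2 * \<eta>1 + hrho A * hsigma A * \<xi>1 * \<eta>2 + (hsigma A)\<^sup>2 * \<xi>2 * \<eta>2)
     - \<gamma>/2 * ((\<xi>1 + hrho A * hsigma A * \<xi>2) * \<eta>0 * sgn x * sqrt (y / (1 + y)))
     - ha1 A * \<xi>1 * \<eta>0 * sqrt (y / (1 + y)) + hr A / (1 + y) * \<xi>0 * \<eta>0 + l * \<xi>0 * \<eta>0)"

definition form_bound :: "heston \<Rightarrow> real \<Rightarrow> real" where
  "form_bound A l = 1/2 * (1 + 2 * \<bar>hsigma A\<bar> + (hsigma A)\<^sup>2) + 1/2 * (1 + \<bar>hsigma A\<bar>) + \<bar>ha1 A\<bar> + hr A + \<bar>l\<bar>"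

text \<open>A lower bound for the second-order part: the quadratic form with coefficients \<open>1\<close>, \<open>\<rho> * \<sigma>\<close>, \<open>\<sigma>\<^sup>2\<close>
  is at least \<open>1 - \<bar>\<rho>\<bar>\<close> times its diagonal part.\<close>

definition ellipticity :: "heston \<Rightarrow> real" where
  "ellipticity A = 1/2 * (1 - \<bar>hrho A\<bar>) * min 1 ((hsigma A)\<^sup>2)"

text \<open>A common bound, for \<open>\<gamma> < 1\<close>, of the coefficients of the first-order terms.\<close>

definition drift_bound :: "heston \<Rightarrow> real" where
  "drift_bound A = 1/2 * (1 + \<bar>hsigma A\<bar>) + \<bar>ha1 A\<bar>"

text \<open>Young's inequality spends half of the ellipticity on the first-order terms and leaves
  \<open>drift_bound\<^sup>2 / ellipticity\<close> to the zeroth-order term, which in addition has to retain half of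
  the ellipticity.\<close>

definition shift_threshold :: "heston \<Rightarrow> real" where
  "shift_threshold A = (drift_bound A)\<^sup>2 / ellipticity A + ellipticity A / 2"

lemma ellipticity_pos: "heston_coeffs A \<Longrightarrow> 0 < ellipticity A"
  unfolding heston_coeffs_def ellipticity_def by (intro mult_pos_pos) auto

text \<open>The four steps are ellipticity of the second-order part, a bound of the first-order terms by
  \<open>d * (\<bar>a\<bar> + \<bar>b\<bar>) * \<bar>c\<bar>\<close>, Young's inequality for this product, and the choice of the shift.\<close>

lemma form_density_coercive:
  assumes A: "heston_coeffs A" and \<gamma>: "0 < \<gamma>" "\<gamma> < 1" and y: "0 < snd p" and l: "shift_threshold A \<le> l"
  shows "ellipticity A / 2 * (norm \<xi>)\<^sup>2 \<le> form_density A \<gamma> l p \<xi> \<xi>"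
proof -
  obtain x y where p: "p = (x, y)" by (cases p)
  obtain a b c where \<xi>: "\<xi> = (a, b, c)" by (cases \<xi>)
  define \<rho> \<sigma> e d s where defs: "\<rho> = hrho A" "\<sigma> = hsigma A" "e = ellipticity A" "d = drift_bound A" "s = sqrt (y / (1 + y))"
  have y0: "0 < y" using y p by simp
  have s: "0 \<le> s" "s \<le> 1" using y0 by (auto simp: defs)
  have \<rho>: "\<bar>\<rho>\<bar> < 1" using A by (auto simp: heston_coeffs_def defs)
  have e0: "0 < e" using ellipticity_pos[OF A] by (simp add: defs)
  have d0: "0 \<le> d" by (simp add: defs drift_bound_def)
  have principal: "e * (a\<^sup>2 + b\<^sup>2) \<le> 1/2 * (a * a + \<rho> * \<sigma> * b * a + \<rho> * \<sigma> * a * b + \<sigma>\<^sup>2 * b * b)"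
  proof -
    have "2 * (\<bar>a\<bar> * \<bar>\<sigma> * b\<bar>) \<le> a\<^sup>2 + (\<sigma> * b)\<^sup>2"
      using zero_le_power2[of "\<bar>a\<bar> - \<bar>\<sigma> * b\<bar>"] by (simp add: power2_diff)
    then have "\<bar>\<rho>\<bar> * (2 * (\<bar>a\<bar> * \<bar>\<sigma> * b\<bar>)) \<le> \<bar>\<rho>\<bar> * (a\<^sup>2 + (\<sigma> * b)\<^sup>2)"
      by (rule mult_left_mono) simp
    moreover have "- (2 * (\<rho> * \<sigma> * a * b)) \<le> \<bar>\<rho>\<bar> * (2 * (\<bar>a\<bar> * \<bar>\<sigma> * b\<bar>))"
      using abs_ge_minus_self[of "2 * (\<rho> * \<sigma> * a * b)"] by (simp add: abs_mult mult_ac)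
    ultimately have 1: "(1 - \<bar>\<rho>\<bar>) * (a\<^sup>2 + \<sigma>\<^sup>2 * b\<^sup>2) \<le> a\<^sup>2 + 2 * (\<rho> * \<sigma> * a * b) + \<sigma>\<^sup>2 * b\<^sup>2"
      by (simp add: power_mult_distrib algebra_simps)
    have "min 1 (\<sigma>\<^sup>2) * a\<^sup>2 \<le> 1 * a\<^sup>2" "min 1 (\<sigma>\<^sup>2) * b\<^sup>2 \<le> \<sigma>\<^sup>2 * b\<^sup>2"
      by (intro mult_right_mono; simp)+
    then have "min 1 (\<sigma>\<^sup>2) * (a\<^sup>2 + b\<^sup>2) \<le> a\<^sup>2 + \<sigma>\<^sup>2 * b\<^sup>2" by (simp add: distrib_left)
    then have "(1 - \<bar>\<rho>\<bar>) * (min 1 (\<sigma>\<^sup>2) * (a\<^sup>2 + b\<^sup>2)) \<le> (1 - \<bar>\<rho>\<bar>) * (a\<^sup>2 + \<sigma>\<^sup>2 * b\<^sup>2)"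
      using \<rho> by (intro mult_left_mono) auto
    moreover have "2 * (e * (a\<^sup>2 + b\<^sup>2)) = (1 - \<bar>\<rho>\<bar>) * (min 1 (\<sigma>\<^sup>2) * (a\<^sup>2 + b\<^sup>2))"
      by (simp add: defs ellipticity_def)
    ultimately have "2 * (e * (a\<^sup>2 + b\<^sup>2)) \<le> a\<^sup>2 + 2 * (\<rho> * \<sigma> * a * b) + \<sigma>\<^sup>2 * b\<^sup>2" using 1 by linarith
    then show ?thesis by (simp add: power2_eq_square mult_ac)
  qed
  have drift: "\<gamma>/2 * ((a + \<rho> * \<sigma> * b) * c * sgn x * s) + ha1 A * a * c * s \<le> d * ((\<bar>a\<bar> + \<bar>b\<bar>) * \<bar>c\<bar>)"
  proof -
    let ?S = "\<bar>a\<bar> + \<bar>b\<bar>"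
    have sg: "\<bar>sgn x\<bar> \<le> 1" by (simp add: abs_sgn_eq)
    have "\<bar>a + \<rho> * \<sigma> * b\<bar> \<le> \<bar>a\<bar> + \<bar>\<sigma>\<bar> * \<bar>b\<bar>"
    proof -
      have "\<bar>\<rho> * \<sigma> * b\<bar> \<le> 1 * (\<bar>\<sigma>\<bar> * \<bar>b\<bar>)"
        using \<rho> unfolding abs_mult mult.assoc by (intro mult_right_mono) auto
      then show ?thesis by linarith
    qed
    also have "\<dots> \<le> (1 + \<bar>\<sigma>\<bar>) * ?S" by (simp add: algebra_simps)
    finally have ab: "\<bar>a + \<rho> * \<sigma> * b\<bar> \<le> (1 + \<bar>\<sigma>\<bar>) * ?S" .
    have "\<bar>\<gamma>/2 * ((a + \<rho> * \<sigma> * b) * c * sgn x * s)\<bar> \<le> 1/2 * (((1 + \<bar>\<sigma>\<bar>) * ?S) * \<bar>c\<bar> * 1 * 1)"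
      unfolding abs_mult using \<gamma> ab s sg by (intro mult_mono) auto
    moreover have "\<bar>ha1 A * a * c * s\<bar> \<le> \<bar>ha1 A\<bar> * ?S * \<bar>c\<bar> * 1"
      unfolding abs_mult using s by (intro mult_mono) auto
    ultimately have "\<gamma>/2 * ((a + \<rho> * \<sigma> * b) * c * sgn x * s) + ha1 A * a * c * s
       \<le> 1/2 * (((1 + \<bar>\<sigma>\<bar>) * ?S) * \<bar>c\<bar> * 1 * 1) + \<bar>ha1 A\<bar> * ?S * \<bar>c\<bar> * 1" by linarith
    also have "\<dots> = d * (?S * \<bar>c\<bar>)" by (simp add: defs drift_bound_def algebra_simps add_divide_distrib)
    finally show ?thesis .
  qed
  have young: "d * ((\<bar>a\<bar> + \<bar>b\<bar>) * \<bar>c\<bar>) \<le> e / 2 * (a\<^sup>2 + b\<^sup>2) + d\<^sup>2 / e * c\<^sup>2"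
  proof -
    have "0 \<le> (e * \<bar>t\<bar> - d * \<bar>c\<bar>)\<^sup>2 / (2 * e)" for t using e0 by simp
    moreover have "(e * \<bar>t\<bar> - d * \<bar>c\<bar>)\<^sup>2 / (2 * e) = e / 2 * t\<^sup>2 + d\<^sup>2 / (2 * e) * c\<^sup>2 - d * (\<bar>t\<bar> * \<bar>c\<bar>)" for t
      using e0 by (simp add: power2_diff power_mult_distrib field_simps) (simp add: power2_eq_square algebra_simps)
    ultimately have *: "d * (\<bar>t\<bar> * \<bar>c\<bar>) \<le> e / 2 * t\<^sup>2 + d\<^sup>2 / (2 * e) * c\<^sup>2" for t by simp
    have "d\<^sup>2 / (2 * e) * c\<^sup>2 + d\<^sup>2 / (2 * e) * c\<^sup>2 = d\<^sup>2 / e * c\<^sup>2" using e0 by (simp add: field_simps)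
    moreover have "d * ((\<bar>a\<bar> + \<bar>b\<bar>) * \<bar>c\<bar>) = d * (\<bar>a\<bar> * \<bar>c\<bar>) + d * (\<bar>b\<bar> * \<bar>c\<bar>)"
      by (simp add: algebra_simps)
    moreover have "e / 2 * (a\<^sup>2 + b\<^sup>2) = e / 2 * a\<^sup>2 + e / 2 * b\<^sup>2" by (simp add: distrib_left)
    ultimately show ?thesis using *[of a] *[of b] by linarith
  qed
  have zeroth: "(d\<^sup>2 / e + e / 2) * c\<^sup>2 \<le> hr A / (1 + y) * c * c + l * c * c"
  proof -
    have "(d\<^sup>2 / e + e / 2) * c\<^sup>2 \<le> l * c\<^sup>2"
      using l by (intro mult_right_mono) (auto simp: defs shift_threshold_def)
    moreover have "0 \<le> hr A / (1 + y) * c\<^sup>2"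
      using A y0 by (simp add: heston_coeffs_def)
    ultimately show ?thesis by (simp add: power2_eq_square mult.assoc)
  qed
  have n: "(norm \<xi>)\<^sup>2 = a\<^sup>2 + b\<^sup>2 + c\<^sup>2"
    unfolding \<xi> power2_norm_eq_inner inner_prod_def by (simp add: power2_eq_square)
  have "form_density A \<gamma> l p \<xi> \<xi> = 1/2 * (a * a + \<rho> * \<sigma> * b * a + \<rho> * \<sigma> * a * b + \<sigma>\<^sup>2 * b * b)
     - (\<gamma>/2 * ((a + \<rho> * \<sigma> * b) * c * sgn x * s) + ha1 A * a * c * s) + (hr A / (1 + y) * c * c + l * c * c)"
    by (simp add: form_density_def p \<xi> defs)
  moreover have "e / 2 * (norm \<xi>)\<^sup>2 = e * (a\<^sup>2 + b\<^sup>2) - e / 2 * (a\<^sup>2 + b\<^sup>2) + e / 2 * c\<^sup>2"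
    unfolding n by (simp add: field_simps)
  moreover have "(d\<^sup>2 / e + e / 2) * c\<^sup>2 = d\<^sup>2 / e * c\<^sup>2 + e / 2 * c\<^sup>2" by (simp add: distrib_right)
  ultimately have "e / 2 * (norm \<xi>)\<^sup>2 \<le> form_density A \<gamma> l p \<xi> \<xi>"
    using principal drift young zeroth by linarith
  then show ?thesis by (simp add: defs)
qed

lemma form_density_bounded:
  assumes A: "heston_coeffs A" and \<gamma>: "0 < \<gamma>" "\<gamma> < 1" and y: "0 < snd p"
  shows "\<bar>form_density A \<gamma> l p \<xi> \<eta>\<bar> \<le> form_bound A l * (norm \<xi> * norm \<eta>)"
proof -
  obtain x y where p: "p = (x, y)" by (cases p)
  obtain a b c where \<xi>: "\<xi> = (a, b, c)" by (cases \<xi>)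
  obtain f g h where \<eta>: "\<eta> = (f, g, h)" by (cases \<eta>)
  define \<rho> \<sigma> s N where defs: "\<rho> = hrho A" "\<sigma> = hsigma A" "s = sqrt (y / (1 + y))" "N = norm \<xi> * norm \<eta>"
  have y0: "0 < y" using y p by simp
  have s: "0 \<le> s" "s \<le> 1" using y0 by (auto simp: defs)
  have \<rho>: "\<bar>\<rho>\<bar> \<le> 1" using A by (auto simp: heston_coeffs_def defs)
  have r: "0 \<le> hr A" using A by (simp add: heston_coeffs_def)
  have sg: "\<bar>sgn x\<bar> \<le> 1" by (simp add: abs_sgn_eq)
  have N0: "0 \<le> N" by (simp add: defs)
  have comp: "\<bar>a\<bar> \<le> norm \<xi>" "\<bar>b\<bar> \<le> norm \<xi>" "\<bar>c\<bar> \<le> norm \<xi>" "\<bar>f\<bar> \<le> norm \<eta>" "\<bar>g\<bar> \<le> norm \<eta>" "\<bar>h\<bar> \<le> norm \<eta>"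
    using norm_fst[of \<xi>] order_trans[OF norm_fst norm_snd[of \<xi>]] order_trans[OF norm_snd norm_snd[of \<xi>]]
      norm_fst[of \<eta>] order_trans[OF norm_fst norm_snd[of \<eta>]] order_trans[OF norm_snd norm_snd[of \<eta>]]
    by (simp_all add: \<xi> \<eta>)
  have prod: "\<bar>k * u * v\<bar> \<le> K * N" if "\<bar>k\<bar> \<le> K" "\<bar>u\<bar> \<le> norm \<xi>" "\<bar>v\<bar> \<le> norm \<eta>" for k u v K
  proof -
    have "\<bar>k\<bar> * (\<bar>u\<bar> * \<bar>v\<bar>) \<le> K * (norm \<xi> * norm \<eta>)"
      using that by (intro mult_mono) auto
    then show ?thesis by (simp add: abs_mult defs mult.assoc)
  qed
  have rs: "\<bar>\<rho> * \<sigma>\<bar> \<le> \<bar>\<sigma>\<bar>" using \<rho> by (simp add: abs_mult mult_left_le_one_le)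
  have gs: "\<bar>\<gamma>/2 * (sgn x * s)\<bar> \<le> 1/2" "\<bar>\<gamma>/2 * (sgn x * s) * (\<rho> * \<sigma>)\<bar> \<le> 1/2 * \<bar>\<sigma>\<bar>"
  proof -
    have "\<bar>\<gamma>/2\<bar> * (\<bar>sgn x\<bar> * \<bar>s\<bar>) \<le> 1/2 * (1 * 1)" using \<gamma> sg s by (intro mult_mono) auto
    then show 1: "\<bar>\<gamma>/2 * (sgn x * s)\<bar> \<le> 1/2" by (simp add: abs_mult)
    have "\<bar>\<gamma>/2 * (sgn x * s)\<bar> * \<bar>\<rho> * \<sigma>\<bar> \<le> 1/2 * \<bar>\<sigma>\<bar>" using 1 rs by (intro mult_mono) auto
    then show "\<bar>\<gamma>/2 * (sgn x * s) * (\<rho> * \<sigma>)\<bar> \<le> 1/2 * \<bar>\<sigma>\<bar>" by (simp add: abs_mult)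
  qed
  have as: "\<bar>ha1 A * s\<bar> \<le> \<bar>ha1 A\<bar>" using s by (simp add: abs_mult mult_right_le_one_le)
  have ry: "\<bar>hr A / (1 + y)\<bar> \<le> hr A" using r y0 by (simp add: field_simps)
  have t: "\<bar>1/2 * a * f\<bar> \<le> 1/2 * N" "\<bar>1/2 * (\<rho> * \<sigma>) * b * f\<bar> \<le> 1/2 * \<bar>\<sigma>\<bar> * N"
    "\<bar>1/2 * (\<rho> * \<sigma>) * a * g\<bar> \<le> 1/2 * \<bar>\<sigma>\<bar> * N" "\<bar>1/2 * \<sigma>\<^sup>2 * b * g\<bar> \<le> 1/2 * \<sigma>\<^sup>2 * N"
    "\<bar>\<gamma>/2 * (sgn x * s) * a * h\<bar> \<le> 1/2 * N" "\<bar>\<gamma>/2 * (sgn x * s) * (\<rho> * \<sigma>) * b * h\<bar> \<le> 1/2 * \<bar>\<sigma>\<bar> * N"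
    "\<bar>ha1 A * s * a * h\<bar> \<le> \<bar>ha1 A\<bar> * N" "\<bar>hr A / (1 + y) * c * h\<bar> \<le> hr A * N" "\<bar>l * c * h\<bar> \<le> \<bar>l\<bar> * N"
    using rs by (intro prod comp gs as ry; simp add: abs_mult)+
  have "form_density A \<gamma> l p \<xi> \<eta> = 1/2 * a * f + 1/2 * (\<rho> * \<sigma>) * b * f + 1/2 * (\<rho> * \<sigma>) * a * g + 1/2 * \<sigma>\<^sup>2 * b * g
     - \<gamma>/2 * (sgn x * s) * a * h - \<gamma>/2 * (sgn x * s) * (\<rho> * \<sigma>) * b * h - ha1 A * s * a * h + hr A / (1 + y) * c * h + l * c * h"
    by (simp add: form_density_def p \<xi> \<eta> defs) (simp add: algebra_simps add_divide_distrib)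
  then have "\<bar>form_density A \<gamma> l p \<xi> \<eta>\<bar> \<le> 1/2 * N + 1/2 * \<bar>\<sigma>\<bar> * N + 1/2 * \<bar>\<sigma>\<bar> * N + 1/2 * \<sigma>\<^sup>2 * N + 1/2 * N + 1/2 * \<bar>\<sigma>\<bar> * N
     + \<bar>ha1 A\<bar> * N + hr A * N + \<bar>l\<bar> * N"
    using t unfolding abs_le_iff by (elim conjE) (intro conjI; linarith)
  also have "\<dots> = form_bound A l * N" by (simp add: form_bound_def defs algebra_simps add_divide_distrib)
  finally show ?thesis by (simp add: defs)
qed

lemma form_density_linear:
  "form_density A \<gamma> l p (\<xi> + \<xi>') \<eta> = form_density A \<gamma> l p \<xi> \<eta> + form_density A \<gamma> l p \<xi>' \<eta>"
  "form_density A \<gamma> l p (k *\<^sub>R \<xi>) \<eta> = k * form_density A \<gamma> l p \<xi> \<eta>"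
  "form_density A \<gamma> l p \<eta> (\<xi> + \<xi>') = form_density A \<gamma> l p \<eta> \<xi> + form_density A \<gamma> l p \<eta> \<xi>'"
  "form_density A \<gamma> l p \<eta> (k *\<^sub>R \<xi>) = k * form_density A \<gamma> l p \<eta> \<xi>"
proof -
  obtain x y where p: "p = (x, y)" by (cases p)
  obtain a b c where \<xi>: "\<xi> = (a, b, c)" by (cases \<xi>)
  obtain a' b' c' where \<xi>': "\<xi>' = (a', b', c')" by (cases \<xi>')
  obtain f g h where \<eta>: "\<eta> = (f, g, h)" by (cases \<eta>)
  note s = form_density_def p \<xi> \<xi>' \<eta> algebra_simps add_divide_distrib diff_divide_distrib
  show "form_density A \<gamma> l p (\<xi> + \<xi>') \<eta> = form_density A \<gamma> l p \<xi> \<eta> + form_density A \<gamma> l p \<xi>' \<eta>"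
    by (simp add: s)
  show "form_density A \<gamma> l p (k *\<^sub>R \<xi>) \<eta> = k * form_density A \<gamma> l p \<xi> \<eta>"
    by (simp add: s)
  show "form_density A \<gamma> l p \<eta> (\<xi> + \<xi>') = form_density A \<gamma> l p \<eta> \<xi> + form_density A \<gamma> l p \<eta> \<xi>'"
    by (simp add: s)
  show "form_density A \<gamma> l p \<eta> (k *\<^sub>R \<xi>) = k * form_density A \<gamma> l p \<eta> \<xi>"
    by (simp add: s)
qed

section \<open>The obstacle problem for the Heston form\<close>

context heston_domain begin

lemma L2_nrm_norm:
  assumes "X \<in> L2_fun M"
  shows "(\<lambda>p. norm (X p)) \<in> L2_fun M" "L2.nrm M (\<lambda>p. norm (X p)) = L2.nrm M X"
proof -
  show "(\<lambda>p. norm (X p)) \<in> L2_fun M" using assms by (auto simp: L2_fun_def)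
  show "L2.nrm M (\<lambda>p. norm (X p)) = L2.nrm M X"
    by (simp add: L2.nrm_def L2_ip_def power2_norm_eq_inner[symmetric] power2_eq_square[symmetric])
qed

text \<open>Every term of the Heston form is a sum of products of a bounded function with two energy components.\<close>

lemma component_product_integrable:
  assumes "X \<in> L2_fun M" "Y \<in> L2_fun M" and k: "k \<in> borel_measurable M" "\<And>p. p \<in> U \<Longrightarrow> \<bar>k p\<bar> \<le> K"
    and c: "c \<in> {fst, \<lambda>z. fst (snd z), \<lambda>z. snd (snd z)}" and d: "d \<in> {fst, \<lambda>z. fst (snd z), \<lambda>z. snd (snd z)}"
  shows "integrable M (\<lambda>p. k p * (c (X p :: real \<times> real \<times> real) * d (Y p :: real \<times> real \<times> real)))"
proof -
  have [measurable]: "k \<in> borel_measurable M" "X \<in> borel_measurable M" "Y \<in> borel_measurable M"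
    using assms by (auto simp: L2_fun_def)
  have n: "\<bar>fst z\<bar> \<le> norm z" "\<bar>fst (snd z)\<bar> \<le> norm z" "\<bar>snd (snd z)\<bar> \<le> norm z"
    for z :: "real \<times> real \<times> real"
    using norm_fst[of z] order_trans[OF norm_fst norm_snd[of z]] order_trans[OF norm_snd norm_snd[of z]]
    by simp_all
  have b: "bounded_linear c' \<and> (\<forall>z. \<bar>c' z\<bar> \<le> norm z)"
    if "c' \<in> {fst, \<lambda>z. fst (snd z), \<lambda>z. snd (snd z)}" for c' :: "real \<times> real \<times> real \<Rightarrow> real"
    using that n
    by (auto intro: bounded_linear_fst bounded_linear_fst_comp bounded_linear_snd_comp bounded_linear_snd
        simp del: split_paired_All)
  have m: "c' \<in> borel_measurable borel" if "c' \<in> {fst, \<lambda>z. fst (snd z), \<lambda>z. snd (snd z)}"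
    for c' :: "real \<times> real \<times> real \<Rightarrow> real"
    using b[OF that] by (intro borel_measurable_continuous_onI linear_continuous_on) auto
  have [measurable]: "(\<lambda>p. c (X p)) \<in> borel_measurable M" "(\<lambda>p. d (Y p)) \<in> borel_measurable M"
    using m[OF c] m[OF d] by (auto intro: measurable_compose)
  show ?thesis
  proof (rule Bochner_Integration.integrable_bound)
    show "integrable M (\<lambda>p. K * (norm (X p) * norm (Y p)))"
      by (intro integrable_mult_right L2_fun_inner_integrable(2) assms)
    show "AE p in M. norm (k p * (c (X p) * d (Y p))) \<le> norm (K * (norm (X p) * norm (Y p)))"
    proof (rule AE_I2)
      fix p assume "p \<in> space M"
      then have "\<bar>k p\<bar> \<le> K" using k(2) by simp
      then have K: "0 \<le> K" by (meson abs_ge_zero order_trans)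
      have "\<bar>c (X p)\<bar> \<le> norm (X p)" "\<bar>d (Y p)\<bar> \<le> norm (Y p)" using b[OF c] b[OF d] by blast+
      with \<open>\<bar>k p\<bar> \<le> K\<close> have "\<bar>k p\<bar> * (\<bar>c (X p)\<bar> * \<bar>d (Y p)\<bar>) \<le> K * (norm (X p) * norm (Y p))"
        by (intro mult_mono) auto
      then show "norm (k p * (c (X p) * d (Y p))) \<le> norm (K * (norm (X p) * norm (Y p)))"
        using K by (simp add: abs_mult)
    qed
  qed measurable
qed

text \<open>The form is a sum of five separate integrals. Each of them converges, so they may be combined into the
  integral of \<open>form_density\<close>.\<close>

lemma heston_form_shifted_eq:
  assumes "u \<in> H1_space A \<gamma> U" "v \<in> H1_space A \<gamma> U"
  shows "integrable M (\<lambda>p. form_density A \<gamma> l p (energy U u p) (energy U v p))"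
    "heston_form_shifted A \<gamma> l U u v = (LINT p|M. form_density A \<gamma> l p (energy U u p) (energy U v p))"
proof -
  let ?E = "energy U u" and ?F = "energy U v" and ?rs = "hrho A * hsigma A"
  let ?s = "\<lambda>p::real \<times> real. sqrt (snd p / (1 + snd p))"
  note I = component_product_integrable[OF energy_L2[OF assms(1)] energy_L2[OF assms(2)]]
  have const: "(\<lambda>_. k) \<in> borel_measurable M" "\<bar>k\<bar> \<le> \<bar>k\<bar>" for k :: real by simp_all
  have s_le: "\<bar>?s p\<bar> \<le> 1" if "p \<in> U" for p using snd_pos[OF that] by simp
  have [measurable]: "fst \<in> borel_measurable M" "snd \<in> borel_measurable M"
    using fst_snd_measurable[of U] by measurable
  have sm: "(\<lambda>p. k * sgn (fst p) * ?s p) \<in> borel_measurable M" "(\<lambda>p. k * ?s p) \<in> borel_measurable M"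
      "(\<lambda>p. k / (1 + snd p)) \<in> borel_measurable M" for k
    by measurable
  have sb: "\<bar>k * sgn (fst p) * ?s p\<bar> \<le> \<bar>k\<bar> * 1 * 1" "\<bar>k * ?s p\<bar> \<le> \<bar>k\<bar> * 1" "\<bar>k / (1 + snd p)\<bar> \<le> \<bar>k\<bar>"
    if "p \<in> U" for k p
  proof -
    show "\<bar>k * sgn (fst p) * ?s p\<bar> \<le> \<bar>k\<bar> * 1 * 1" "\<bar>k * ?s p\<bar> \<le> \<bar>k\<bar> * 1"
      unfolding abs_mult using s_le[OF that] by (intro mult_mono; simp add: abs_sgn_eq)+
    show "\<bar>k / (1 + snd p)\<bar> \<le> \<bar>k\<bar>"
      using snd_pos[OF that] by (simp add: abs_divide divide_le_eq mult_left_le_one_le algebra_simps)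
  qed
  define T1 where "T1 p = (wdx U u p * wdx U v p + ?rs * wdy U u p * wdx U v p + ?rs * wdx U u p * wdy U v p
      + (hsigma A)\<^sup>2 * wdy U u p * wdy U v p) * snd p" for p
  define T2 where "T2 p = (wdx U u p + ?rs * wdy U u p) * v p * sgn (fst p) * snd p" for p
  define T3 where "T3 p = ha1 A * snd p * wdx U u p * v p" for p
  define T4 where "T4 p = hr A * u p * v p" for p
  define T5 where "T5 p = (1 + snd p) * u p * v p" for p
  have eq: "T1 p = 1 * (fst (?E p) * fst (?F p)) + ?rs * (fst (snd (?E p)) * fst (?F p))
        + ?rs * (fst (?E p) * fst (snd (?F p))) + (hsigma A)\<^sup>2 * (fst (snd (?E p)) * fst (snd (?F p)))"
      "T2 p = 1 * sgn (fst p) * ?s p * (fst (?E p) * snd (snd (?F p)))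
        + ?rs * sgn (fst p) * ?s p * (fst (snd (?E p)) * snd (snd (?F p)))"
      "T3 p = ha1 A * ?s p * (fst (?E p) * snd (snd (?F p)))"
      "T4 p = hr A / (1 + snd p) * (snd (snd (?E p)) * snd (snd (?F p)))"
      "T5 p = 1 * (snd (snd (?E p)) * snd (snd (?F p)))" if "p \<in> U" for p
  proof -
    define a b where "a = sqrt (snd p)" and "b = sqrt (1 + snd p)"
    have ab: "0 < a" "0 < b" "snd p = a * a" "1 + snd p = b * b" using snd_pos[OF that] by (simp_all add: a_def b_def)
    have s: "?s p = a / b" by (simp add: a_def b_def real_sqrt_divide)
    have E: "?E p = (a * wdx U u p, a * wdy U u p, b * u p)" "?F p = (a * wdx U v p, a * wdy U v p, b * v p)"
      by (simp_all add: energy_def a_def b_def)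
    show "T1 p = 1 * (fst (?E p) * fst (?F p)) + ?rs * (fst (snd (?E p)) * fst (?F p))
        + ?rs * (fst (?E p) * fst (snd (?F p))) + (hsigma A)\<^sup>2 * (fst (snd (?E p)) * fst (snd (?F p)))"
      unfolding T1_def ab(3) E by (simp add: algebra_simps)
    show "T2 p = 1 * sgn (fst p) * ?s p * (fst (?E p) * snd (snd (?F p)))
        + ?rs * sgn (fst p) * ?s p * (fst (snd (?E p)) * snd (snd (?F p)))"
      unfolding T2_def s E unfolding ab(3) using ab(1,2) by (simp add: field_simps)
    show "T3 p = ha1 A * ?s p * (fst (?E p) * snd (snd (?F p)))"
      unfolding T3_def s E unfolding ab(3) using ab(1,2) by (simp add: field_simps)
    show "T4 p = hr A / (1 + snd p) * (snd (snd (?E p)) * snd (snd (?F p)))"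
      unfolding T4_def E unfolding ab(4) using ab(1,2) by (simp add: field_simps)
    show "T5 p = 1 * (snd (snd (?E p)) * snd (snd (?F p)))"
      unfolding T5_def E unfolding ab(4) by (simp add: algebra_simps)
  qed
  have iT: "integrable M T1" "integrable M T2" "integrable M T3" "integrable M T4" "integrable M T5"
  proof -
    have "integrable M (\<lambda>p. 1 * (fst (?E p) * fst (?F p)) + ?rs * (fst (snd (?E p)) * fst (?F p))
        + ?rs * (fst (?E p) * fst (snd (?F p))) + (hsigma A)\<^sup>2 * (fst (snd (?E p)) * fst (snd (?F p))))"
      by (intro Bochner_Integration.integrable_add I[OF const]) simp_all
    then show "integrable M T1" by (rule Bochner_Integration.integrable_cong[THEN iffD1, rotated -1]) (simp_all add: eq)
    have "integrable M (\<lambda>p. 1 * sgn (fst p) * ?s p * (fst (?E p) * snd (snd (?F p)))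
        + ?rs * sgn (fst p) * ?s p * (fst (snd (?E p)) * snd (snd (?F p))))"
      by (intro Bochner_Integration.integrable_add I[OF sm(1) sb(1)]) simp_all
    then show "integrable M T2" by (rule Bochner_Integration.integrable_cong[THEN iffD1, rotated -1]) (simp_all add: eq)
    have "integrable M (\<lambda>p. ha1 A * ?s p * (fst (?E p) * snd (snd (?F p))))"
      by (intro I[OF sm(2) sb(2)]) simp_all
    then show "integrable M T3" by (rule Bochner_Integration.integrable_cong[THEN iffD1, rotated -1]) (simp_all add: eq)
    have "integrable M (\<lambda>p. hr A / (1 + snd p) * (snd (snd (?E p)) * snd (snd (?F p))))"
      by (intro I[OF sm(3) sb(3)]) simp_all
    then show "integrable M T4" by (rule Bochner_Integration.integrable_cong[THEN iffD1, rotated -1]) (simp_all add: eq)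
    have "integrable M (\<lambda>p. 1 * (snd (snd (?E p)) * snd (snd (?F p))))"
      by (intro I[OF const]) simp_all
    then show "integrable M T5" by (rule Bochner_Integration.integrable_cong[THEN iffD1, rotated -1]) (simp_all add: eq)
  qed
  have q: "form_density A \<gamma> l p (?E p) (?F p) = 1/2 * T1 p - \<gamma>/2 * T2 p - T3 p + T4 p + l * T5 p" if "p \<in> U" for p
    unfolding eq[OF that] by (simp add: form_density_def case_prod_beta algebra_simps)
  have i: "integrable M (\<lambda>p. 1/2 * T1 p - \<gamma>/2 * T2 p - T3 p + T4 p + l * T5 p)"
    by (intro Bochner_Integration.integrable_add Bochner_Integration.integrable_diff integrable_mult_right iT)
  then show "integrable M (\<lambda>p. form_density A \<gamma> l p (?E p) (?F p))"
    by (rule Bochner_Integration.integrable_cong[THEN iffD1, rotated -1]) (simp_all add: q)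
  have "(LINT p|M. form_density A \<gamma> l p (?E p) (?F p)) = (LINT p|M. 1/2 * T1 p - \<gamma>/2 * T2 p - T3 p + T4 p + l * T5 p)"
    by (rule Bochner_Integration.integral_cong) (simp_all add: q)
  also have "\<dots> = 1/2 * (LINT p|M. T1 p) - \<gamma>/2 * (LINT p|M. T2 p) - (LINT p|M. T3 p) + (LINT p|M. T4 p) + l * (LINT p|M. T5 p)"
    using iT by simp
  also have "\<dots> = heston_form_shifted A \<gamma> l U u v"
    unfolding heston_form_shifted_def heston_form_def L2_inner_def T1_def T2_def T3_def T4_def T5_def by simp
  finally show "heston_form_shifted A \<gamma> l U u v = (LINT p|M. form_density A \<gamma> l p (?E p) (?F p))" by simp
qed

lemma heston_form_bilinear: "bilinear_form_on (H1_space A \<gamma> U) (heston_form_shifted A \<gamma> l U)"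
proof -
  let ?a = "heston_form_shifted A \<gamma> l U"
  let ?q = "\<lambda>u v p. form_density A \<gamma> l p (energy U u p) (energy U v p)"
  note i = heston_form_shifted_eq(1)[of _ _ l] and e = heston_form_shifted_eq(2)[of _ _ l]
  have m: "?q u v \<in> borel_measurable M" if "u \<in> H1_space A \<gamma> U" "v \<in> H1_space A \<gamma> U" for u v
    by (rule borel_measurable_integrable[OF i[OF that]])
  have "linear_form_on (H1_space A \<gamma> U) (\<lambda>u. ?a u v) \<and> linear_form_on (H1_space A \<gamma> U) (?a v)"
    if v: "v \<in> H1_space A \<gamma> U" for v
    unfolding linear_form_on_def
  proof (intro conjI ballI allI)
    fix u u' assume u: "u \<in> H1_space A \<gamma> U" "u' \<in> H1_space A \<gamma> U"
    note uu = H1_add(1)[OF u]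
    have "(LINT p|M. ?q (u + u') v p) = (LINT p|M. ?q u v p + ?q u' v p)"
      by (rule integral_cong_AE[OF m[OF uu v] borel_measurable_add[OF m[OF u(1) v] m[OF u(2) v]]])
        (use H1_add(2)[OF u] in eventually_elim, simp add: form_density_linear)
    then show "?a (u + u') v = ?a u v + ?a u' v" using u v uu i by (simp add: e)
    have "(LINT p|M. ?q v (u + u') p) = (LINT p|M. ?q v u p + ?q v u' p)"
      by (rule integral_cong_AE[OF m[OF v uu] borel_measurable_add[OF m[OF v u(1)] m[OF v u(2)]]])
        (use H1_add(2)[OF u] in eventually_elim, simp add: form_density_linear)
    then show "?a v (u + u') = ?a v u + ?a v u'" using u v uu i by (simp add: e)
  next
    fix c u assume u: "u \<in> H1_space A \<gamma> U"
    note cu = H1_scale(1)[OF u, of c]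
    have "(LINT p|M. ?q (c *\<^sub>R u) v p) = (LINT p|M. c * ?q u v p)"
      by (rule integral_cong_AE[OF m[OF cu v] borel_measurable_times[OF borel_measurable_const m[OF u v]]])
        (use H1_scale(2)[OF u, of c] in eventually_elim, simp add: form_density_linear)
    then show "?a (c *\<^sub>R u) v = c * ?a u v" using u v cu by (simp add: e)
    have "(LINT p|M. ?q v (c *\<^sub>R u) p) = (LINT p|M. c * ?q v u p)"
      by (rule integral_cong_AE[OF m[OF v cu] borel_measurable_times[OF borel_measurable_const m[OF v u]]])
        (use H1_scale(2)[OF u, of c] in eventually_elim, simp add: form_density_linear)
    then show "?a v (c *\<^sub>R u) = c * ?a v u" using u v cu by (simp add: e)
  qed
  then show ?thesis unfolding bilinear_form_on_def by blast
qed

lemma heston_form_continuous: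
  assumes "\<gamma> < 1" "u \<in> H1_space A \<gamma> U" "v \<in> H1_space A \<gamma> U"
  shows "\<bar>heston_form_shifted A \<gamma> l U u v\<bar> \<le> form_bound A l * H1_norm A \<gamma> U u * H1_norm A \<gamma> U v"
proof -
  let ?q = "\<lambda>p. form_density A \<gamma> l p (energy U u p) (energy U v p)"
  note i = heston_form_shifted_eq(1)[OF assms(2,3), of l]
  note E = energy_L2[OF assms(2)] energy_L2[OF assms(3)]
  have "\<bar>heston_form_shifted A \<gamma> l U u v\<bar> \<le> (LINT p|M. \<bar>?q p\<bar>)"
    unfolding heston_form_shifted_eq(2)[OF assms(2,3)] by (rule integral_abs_bound)
  also have "\<dots> \<le> (LINT p|M. form_bound A l * (norm (energy U u p) * norm (energy U v p)))"
  proof (rule integral_mono)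
    show "integrable M (\<lambda>p. \<bar>?q p\<bar>)" using i by (rule integrable_abs)
    show "integrable M (\<lambda>p. form_bound A l * (norm (energy U u p) * norm (energy U v p)))"
      by (intro integrable_mult_right L2_fun_inner_integrable(2) E)
    show "\<bar>?q p\<bar> \<le> form_bound A l * (norm (energy U u p) * norm (energy U v p))" if "p \<in> space M" for p
      using that snd_pos by (intro form_density_bounded coeffs \<gamma>_pos assms(1)) simp
  qed
  also have "\<dots> = form_bound A l * L2_ip M (\<lambda>p. norm (energy U u p)) (\<lambda>p. norm (energy U v p))"
    by (simp add: L2_ip_def)
  also have "\<dots> \<le> form_bound A l * (L2.nrm M (energy U u) * L2.nrm M (energy U v))"
  proof (rule mult_left_mono)
    show "L2_ip M (\<lambda>p. norm (energy U u p)) (\<lambda>p. norm (energy U v p)) \<le> L2.nrm M (energy U u) * L2.nrm M (energy U v)"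
      using L2.Cauchy_Schwarz[OF L2_nrm_norm(1)[OF E(1)] L2_nrm_norm(1)[OF E(2)]]
      by (simp add: L2_nrm_norm(2)[OF E(1)] L2_nrm_norm(2)[OF E(2)])
    show "0 \<le> form_bound A l" using coeffs by (simp add: form_bound_def heston_coeffs_def)
  qed
  finally show ?thesis by (simp add: H1_norm_eq mult.assoc)
qed

lemma heston_form_coercive:
  assumes "\<gamma> < 1" "shift_threshold A \<le> l" "v \<in> H1_space A \<gamma> U"
  shows "ellipticity A / 2 * (H1_norm A \<gamma> U v)\<^sup>2 \<le> heston_form_shifted A \<gamma> l U v v"
proof -
  have "ellipticity A / 2 * (H1_norm A \<gamma> U v)\<^sup>2 = (LINT p|M. ellipticity A / 2 * (norm (energy U v p))\<^sup>2)"
    by (simp add: H1_norm_eq L2_nrm_sq energy_L2 assms(3))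
  also have "\<dots> \<le> (LINT p|M. form_density A \<gamma> l p (energy U v p) (energy U v p))"
  proof (rule integral_mono)
    show "integrable M (\<lambda>p. ellipticity A / 2 * (norm (energy U v p))\<^sup>2)"
      using energy_L2[OF assms(3)] by (intro integrable_mult_right) (simp add: L2_fun_def)
    show "integrable M (\<lambda>p. form_density A \<gamma> l p (energy U v p) (energy U v p))"
      by (rule heston_form_shifted_eq(1)[OF assms(3,3)])
    show "ellipticity A / 2 * (norm (energy U v p))\<^sup>2 \<le> form_density A \<gamma> l p (energy U v p) (energy U v p)"
      if "p \<in> space M" for p
      using that snd_pos by (intro form_density_coercive coeffs \<gamma>_pos assms(1,2)) simp
  qed
  finally show ?thesis by (simp add: heston_form_shifted_eq(2)[OF assms(3,3)])
qed

lemma H1_imp_L2: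
  assumes "v \<in> H1_space A \<gamma> U"
  shows "v \<in> L2_fun M" "L2.nrm M v \<le> H1.nrm v"
proof -
  have "v \<in> borel_measurable (lebesgue_on U)"
    using assms weakly_differentiable_measurable(1)[OF open_U] by (simp add: H1_iff)
  then have m: "v \<in> borel_measurable M" by measurable
  have le: "norm (v p) \<le> norm (energy U v p)" if "p \<in> space M" for p
  proof -
    have "1 * \<bar>v p\<bar> \<le> sqrt (1 + snd p) * \<bar>v p\<bar>"
      using snd_pos[of p] that by (intro mult_right_mono) auto
    also have "\<dots> = norm (snd (snd (energy U v p)))" using snd_pos[of p] that by (simp add: energy_def abs_mult)
    also have "\<dots> \<le> norm (energy U v p)" by (rule order_trans[OF norm_snd norm_snd])
    finally show ?thesis by simp
  qed
  show "v \<in> L2_fun M" by (rule L2_fun_mono(1)[OF m energy_L2[OF assms] le])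
  show "L2.nrm M v \<le> H1.nrm v"
    unfolding H1_nrm H1_norm_eq by (rule L2_fun_mono(2)[OF m energy_L2[OF assms] le])
qed

lemma L2_space_iff: "f \<in> L2_space A \<gamma> U \<longleftrightarrow> f \<in> L2_fun M"
  by (simp add: L2_space_def L2_fun_def)

lemma L2_inner_eq: "L2_inner A \<gamma> U f v = L2_ip M f v"
  by (simp add: L2_inner_def L2_ip_def)

lemma load_form:
  assumes "f \<in> L2_space A \<gamma> U"
  shows "linear_form_on (H1_space A \<gamma> U) (L2_inner A \<gamma> U f)"
    "v \<in> H1_space A \<gamma> U \<Longrightarrow> \<bar>L2_inner A \<gamma> U f v\<bar> \<le> L2.nrm M f * H1.nrm v"
proof -
  have f: "f \<in> L2_fun M" using assms by (simp add: L2_space_iff)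
  show "linear_form_on (H1_space A \<gamma> U) (L2_inner A \<gamma> U f)"
    unfolding linear_form_on_def L2_inner_eq using f H1_imp_L2(1) by (simp add: L2.ip_simps)
  assume v: "v \<in> H1_space A \<gamma> U"
  have "\<bar>L2_ip M f v\<bar> \<le> L2.nrm M f * L2.nrm M v" by (rule L2.Cauchy_Schwarz[OF f H1_imp_L2(1)[OF v]])
  also have "\<dots> \<le> L2.nrm M f * H1.nrm v" using f H1_imp_L2(2)[OF v] by (intro mult_left_mono) auto
  finally show "\<bar>L2_inner A \<gamma> U f v\<bar> \<le> L2.nrm M f * H1.nrm v" by (simp add: L2_inner_eq)
qed

lemma H1_nrm_zero_AE:
  assumes "v \<in> H1_space A \<gamma> U" "H1.nrm v = 0"
  shows "AE p in lebesgue_on U. v p = 0"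
proof -
  have E: "energy U v \<in> L2_fun M" by (rule energy_L2[OF assms(1)])
  then have "(LINT p|M. (norm (energy U v p))\<^sup>2) = 0"
    using assms(2) by (simp add: H1_nrm H1_norm_eq flip: L2_nrm_sq)
  then have "AE p in M. (norm (energy U v p))\<^sup>2 = 0"
    using E by (subst integral_nonneg_eq_0_iff_AE[symmetric]) (auto simp: L2_fun_def)
  then have "AE p in lebesgue_on U. energy U v p = 0" by (simp add: AE_M)
  moreover have "AE p in lebesgue_on U. p \<in> U" by (rule AE_I2) simp
  ultimately show ?thesis
  proof eventually_elim
    case (elim p)
    then show ?case using snd_pos[of p] by (simp add: energy_def zero_prod_def)
  qed
qed

lemma obstacle_problem_existence:
  assumes cont: "\<And>u v. u \<in> V \<Longrightarrow> v \<in> V \<Longrightarrow>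
      \<bar>heston_form_shifted A \<gamma> l U u v\<bar> \<le> C * H1_norm A \<gamma> U u * H1_norm A \<gamma> U v"
    and coer: "\<And>v. v \<in> V \<Longrightarrow> \<nu> * (H1_norm A \<gamma> U v)\<^sup>2 \<le> heston_form_shifted A \<gamma> l U v v"
    and pos: "0 < C" "0 < \<nu>"
    and f: "f \<in> L2_space A \<gamma> U" and \<psi>: "(\<lambda>p. max (\<psi> p) 0) \<in> V"
  shows "\<exists>u. solves_VI A \<gamma> l U f \<psi> u"
proof -
  let ?K = "obstacle_set A \<gamma> U \<psi>"
  have "(\<lambda>p. max (\<psi> p) 0) \<in> ?K" using \<psi> by (simp add: obstacle_set_def)
  then have ne: "?K \<noteq> {}" by blast
  have sub: "V \<subseteq> H1_space A \<gamma> U" using H10_H1 by blast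
  note bil = bilinear_form_on_subset[OF heston_form_bilinear sub]
    and lin = linear_form_on_subset[OF load_form(1)[OF f] sub]
  have "\<exists>u\<in>?K. \<forall>v\<in>?K. L2_inner A \<gamma> U f (v - u) \<le> heston_form_shifted A \<gamma> l U u (v - u)"
  proof (rule H10.Lions_Stampacchia[OF obstacle_set_subset ne obstacle_set_convex obstacle_set_complete bil _ _ pos(2,1) lin])
    show "\<bar>heston_form_shifted A \<gamma> l U u v\<bar> \<le> C * H10.nrm u * H10.nrm v" if "u \<in> V" "v \<in> V" for u v
      using cont[OF that] by (simp add: H1_nrm)
    show "\<nu> * (H10.nrm v)\<^sup>2 \<le> heston_form_shifted A \<gamma> l U v v" if "v \<in> V" for v
      using coer[OF that] by (simp add: H1_nrm)
    show "\<bar>L2_inner A \<gamma> U f v\<bar> \<le> L2.nrm M f * H10.nrm v" if "v \<in> V" for v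
      by (rule load_form(2)[OF f H10_H1[OF that]])
    show "0 \<le> L2.nrm M f" using f by (simp add: L2_space_iff)
  qed
  then obtain u where u: "u \<in> ?K"
    "\<And>v. v \<in> ?K \<Longrightarrow> L2_inner A \<gamma> U f (v - u) \<le> heston_form_shifted A \<gamma> l U u (v - u)" by blast
  then have "solves_VI A \<gamma> l U f \<psi> u"
    unfolding solves_VI_def by (simp add: fun_diff_def)
  then show ?thesis by blast
qed

text \<open>Adding the two inequalities, each tested with the other solution, gives
  \<open>a_l(u' - u, u' - u) \<le> 0\<close>.\<close>

lemma obstacle_problem_uniqueness:
  assumes coer: "\<And>v. v \<in> V \<Longrightarrow> \<nu> * (H1_norm A \<gamma> U v)\<^sup>2 \<le> heston_form_shifted A \<gamma> l U v v"
    and "0 < \<nu>" and f: "f \<in> L2_space A \<gamma> U"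
    and u: "solves_VI A \<gamma> l U f \<psi> u" and u': "solves_VI A \<gamma> l U f \<psi> u'"
  shows "AE p in lebesgue_on U. u' p = u p"
proof -
  let ?a = "heston_form_shifted A \<gamma> l U" and ?F = "L2_inner A \<gamma> U f"
  have V: "u \<in> V" "u' \<in> V" "u' - u \<in> V"
    using u u' by (auto simp: solves_VI_def obstacle_set_def)
  then have H: "u \<in> H1_space A \<gamma> U" "u' \<in> H1_space A \<gamma> U" "u' - u \<in> H1_space A \<gamma> U" by (auto intro: H10_H1)
  have "?F (u' - u) \<le> ?a u (u' - u)" "?F (u - u') \<le> ?a u' (u - u')"
    using u u' unfolding solves_VI_def fun_diff_def by blast+
  moreover have "?a u' (u - u') = - ?a u' (u' - u)" "?F (u - u') = - ?F (u' - u)"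
    "?a (u' - u) (u' - u) = ?a u' (u' - u) - ?a u (u' - u)"
    using H by (simp_all add: H1.bilinear_simps[OF heston_form_bilinear] H1.form_simps[OF load_form(1)[OF f]])
  ultimately have "?a (u' - u) (u' - u) \<le> 0" by linarith
  then have "\<nu> * (H1_norm A \<gamma> U (u' - u))\<^sup>2 \<le> 0" using coer[OF V(3)] by linarith
  then have "H1.nrm (u' - u) = 0" using \<open>0 < \<nu>\<close> by (simp add: mult_le_0_iff H1_nrm)
  from H1_nrm_zero_AE[OF H(3) this] show ?thesis by simp
qed

end

theorem theorem4p28:
  fixes A :: heston
  assumes "heston_coeffs A"
  shows "\<exists>\<gamma>0>0.
    (\<exists>l0>0. \<forall>l\<ge>l0. admissible_shift A \<gamma>0 l) \<and>
    (\<forall>l. admissible_shift A \<gamma>0 l \<longrightarrow>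
      (\<forall>\<gamma> \<O> f \<psi>.
        0 < \<gamma> \<and> \<gamma> < \<gamma>0 \<and>
        half_plane_domain \<O> \<and> Gamma0 \<O> \<noteq> {} \<and>
        f \<in> L2_space A \<gamma> \<O> \<and>
        \<psi> \<in> H1_space A \<gamma> \<O> \<and> (\<lambda>p. max (\<psi> p) 0) \<in> H10_space A \<gamma> \<O> \<longrightarrow>
        (\<exists>u. solves_VI A \<gamma> l \<O> f \<psi> u \<and>
          (\<forall>u'. solves_VI A \<gamma> l \<O> f \<psi> u' \<longrightarrow>
             (AE p in lebesgue_on \<O>. u' p = u p)))))"
proof (rule exI[of _ 1], intro conjI allI impI)
  have e: "0 < ellipticity A" by (rule ellipticity_pos[OF assms])
  have t: "0 < shift_threshold A" unfolding shift_threshold_def using e by (intro add_nonneg_pos) auto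
  \<comment> \<open>The constants \<open>form_bound A l\<close> and \<open>ellipticity A / 2\<close> depend on neither \<open>\<gamma>\<close> nor the domain.\<close>
  have "admissible_shift A 1 l" if l: "shift_threshold A \<le> l" for l
  proof -
    have b: "0 < form_bound A l"
      using assms unfolding form_bound_def heston_coeffs_def
      by (intro add_pos_nonneg mult_pos_pos) auto
    have "(\<forall>u\<in>H10_space A \<gamma> \<O>. \<forall>v\<in>H10_space A \<gamma> \<O>.
           \<bar>heston_form_shifted A \<gamma> l \<O> u v\<bar> \<le> form_bound A l * H1_norm A \<gamma> \<O> u * H1_norm A \<gamma> \<O> v) \<and>
        (\<forall>v\<in>H10_space A \<gamma> \<O>. ellipticity A / 2 * (H1_norm A \<gamma> \<O> v)\<^sup>2 \<le> heston_form_shifted A \<gamma> l \<O> v v)"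
      if "0 < \<gamma> \<and> \<gamma> < 1 \<and> half_plane_domain \<O> \<and> Gamma0 \<O> \<noteq> {}" for \<gamma> \<O>
    proof -
      interpret heston_domain A \<gamma> \<O> using assms that by unfold_locales auto
      show ?thesis
        using that heston_form_continuous heston_form_coercive[OF _ l] H10_H1 by blast
    qed
    then show ?thesis
      unfolding admissible_shift_def using t l b e
      by (intro conjI exI[of _ "form_bound A l"] exI[of _ "ellipticity A / 2"]) auto
  qed
  then show "\<exists>l0>0. \<forall>l\<ge>l0. admissible_shift A 1 l" using t by blast
next
  fix l \<gamma> \<O> f \<psi>
  assume l: "admissible_shift A 1 l"
    and a: "0 < \<gamma> \<and> \<gamma> < 1 \<and> half_plane_domain \<O> \<and> Gamma0 \<O> \<noteq> {} \<and> f \<in> L2_space A \<gamma> \<O> \<and>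
        \<psi> \<in> H1_space A \<gamma> \<O> \<and> (\<lambda>p. max (\<psi> p) 0) \<in> H10_space A \<gamma> \<O>"
  interpret heston_domain A \<gamma> \<O> using assms a by unfold_locales auto
  obtain C \<nu> where C: "0 < C" "0 < \<nu>"
    "\<And>u v. u \<in> V \<Longrightarrow> v \<in> V \<Longrightarrow> \<bar>heston_form_shifted A \<gamma> l \<O> u v\<bar> \<le> C * H1_norm A \<gamma> \<O> u * H1_norm A \<gamma> \<O> v"
    "\<And>v. v \<in> V \<Longrightarrow> \<nu> * (H1_norm A \<gamma> \<O> v)\<^sup>2 \<le> heston_form_shifted A \<gamma> l \<O> v v"
  proof -
    obtain C \<nu> where "0 < C" "0 < \<nu>" and *: "\<forall>\<gamma> \<O>. 0 < \<gamma> \<and> \<gamma> < 1 \<and> half_plane_domain \<O> \<and> Gamma0 \<O> \<noteq> {} \<longrightarrow>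
        (\<forall>u\<in>H10_space A \<gamma> \<O>. \<forall>v\<in>H10_space A \<gamma> \<O>.
           \<bar>heston_form_shifted A \<gamma> l \<O> u v\<bar> \<le> C * H1_norm A \<gamma> \<O> u * H1_norm A \<gamma> \<O> v) \<and>
        (\<forall>v\<in>H10_space A \<gamma> \<O>.
           heston_form_shifted A \<gamma> l \<O> v v \<ge> \<nu> * (H1_norm A \<gamma> \<O> v)\<^sup>2)"
      using l unfolding admissible_shift_def by (elim conjE exE) (rule that)
    moreover from a have "0 < \<gamma> \<and> \<gamma> < 1 \<and> half_plane_domain \<O> \<and> Gamma0 \<O> \<noteq> {}" by simp
    note *[rule_format, OF this]
    ultimately show ?thesis using that by simp
  qed
  obtain u where u: "solves_VI A \<gamma> l \<O> f \<psi> u"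
    using obstacle_problem_existence[OF C(3,4,1,2)] a by blast
  have "\<forall>u'. solves_VI A \<gamma> l \<O> f \<psi> u' \<longrightarrow> (AE p in lebesgue_on \<O>. u' p = u p)"
    using obstacle_problem_uniqueness[OF C(4,2) _ u] a by blast
  then show "\<exists>u. solves_VI A \<gamma> l \<O> f \<psi> u \<and>
      (\<forall>u'. solves_VI A \<gamma> l \<O> f \<psi> u' \<longrightarrow> (AE p in lebesgue_on \<O>. u' p = u p))"
    using u by blast
qed simp

end
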